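(* The following decision problem is undecidable. Input: a ranked alphabet $\Sigma$ and two regular tree languages $L_1, L_2 \subseteq \mathsf{trees}\,\Sigma$, each given by a deterministic bottom-up tree automaton. Question: does there exist a deterministic tree-walking automaton over $\Sigma$ that accepts every tree in $L_1$ and rejects every tree in $L_2$, i.e. whose accepted language $M$ satisfies $L_1 \subseteq M$ and $M \cap L_2 = \emptyset$?
   Context: A ranked alphabet is a finite set in which each letter has an arity (a natural number; arity $0$ letters label leaves). A tree over $\Sigma$ is a finite, sibling-ordered tree whose nodes are labelled by letters of $\Sigma$, a node labelled by a letter of arity $n$ having exactly $n$ children; $\mathsf{trees}\,\Sigma$ denotes the set of such trees. A deterministic bottom-up tree automaton consists of $\Sigma$, a finite state set $Q$, accepting states $F \subseteq Q$, and for each letter $a$ of arity $n$ a function $\delta_a : Q^n \to Q$; the state of a tree is obtained by applying $\delta$ of the root label to the states of the child subtrees, and the tree is accepted iff its state is in $F$. A regular tree language is one recognised by such an automaton. A deterministic tree-walking automaton consists of $\Sigma$, a finite state set $Q$, an initial state $q_0$, and for each letter $a$ of arity $n$ a function $\delta_a : Q \times \{\text{root},1,\ldots,m\} \to \{\text{accept},\text{reject}\} \cup (Q \times \{\text{parent},1,\ldots,n\})$, where $m$ is the maximal arity in $\Sigma$. A configuration is a pair (state, node). The run starts in $(q_0, \text{root})$; in configuration $(q,v)$ the automaton applies $\delta$ of the label of $v$ to $q$ and to the child number of $v$ (the $i$ such that $v$ is the $i$-th child of its parent, or "root" if $v$ is the root), and then accepts, rejects, or changes state and moves to the parent or to the indicated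 child. A tree is accepted if the run ends with the accept command; the accepted language is the set of accepted trees (all other trees, including those on which the run loops or leaves the tree, are not accepted). *)

theory Defs
  imports Main "HOL-Library.Nat_Bijection"
begin

section \<open>Ranked trees\<close>

record 'a ranked_alphabet =
  letters :: "'a set"
  arity :: "'a \<Rightarrow> nat"

definition ranked_alphabet :: "'a ranked_alphabet \<Rightarrow> bool" where
  "ranked_alphabet \<Sigma> \<longleftrightarrow> finite (letters \<Sigma>)"

datatype 'a tree = Node (root_label: 'a) (children: "'a tree list")

inductive_set trees :: "'a ranked_alphabet \<Rightarrow> 'a tree set" for \<Sigma> where
  "a \<in> letters \<Sigma> \<Longrightarrow> length ts = arity \<Sigma> a \<Longrightarrow> (\<forall>t \<in> set ts. t \<in> trees \<Sigma>)
    \<Longrightarrow> Node a ts \<in> trees \<Sigma>"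

section \<open>Deterministic bottom-up tree automata\<close>

text \<open>The transition functions are total HOL functions. Only their values at letters \<open>a\<close> of the
  alphabet and at tuples in \<^term>\<open>tuples Q n\<close>, for \<open>n\<close> the arity of \<open>a\<close>, are meaningful.\<close>

definition tuples :: "'q set \<Rightarrow> nat \<Rightarrow> 'q list set" where
  "tuples Q n = {qs. length qs = n \<and> set qs \<subseteq> Q}"

record ('a, 'q) dbta =
  dbta_states :: "'q set"
  dbta_final :: "'q set"
  dbta_delta :: "'a \<Rightarrow> 'q list \<Rightarrow> 'q"

definition dbta :: "'a ranked_alphabet \<Rightarrow> ('a, 'q) dbta \<Rightarrow> bool" where
  "dbta \<Sigma> A \<longleftrightarrow> finite (dbta_states A) \<and> dbta_final A \<subseteq> dbta_states A \<and>
    (\<forall>a \<in> letters \<Sigma>. \<forall>qs \<in> tuples (dbta_states A) (arity \<Sigma> a). dbta_delta A a qs \<in> dbta_states A)"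

primrec dbta_state_of :: "('a, 'q) dbta \<Rightarrow> 'a tree \<Rightarrow> 'q" where
  "dbta_state_of A (Node a ts) = dbta_delta A a (map (dbta_state_of A) ts)"

definition dbta_language :: "'a ranked_alphabet \<Rightarrow> ('a, 'q) dbta \<Rightarrow> 'a tree set" where
  "dbta_language \<Sigma> A = {t \<in> trees \<Sigma>. dbta_state_of A t \<in> dbta_final A}"

section \<open>Deterministic tree-walking automata\<close>

datatype child_number = Root | Child nat

datatype direction = Parent | To_Child nat

datatype 'q command = Accept | Reject | Move 'q direction

record ('a, 'q) dtwa =
  dtwa_states :: "'q set"
  dtwa_init :: 'q
  dtwa_delta :: "'a \<Rightarrow> 'q \<Rightarrow> child_number \<Rightarrow> 'q command"

text \<open>The condition on \<open>i\<close> below says \<open>1 \<le> i \<le> m\<close>, where \<open>m\<close> is the maximal arity; it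
  also makes sense for the empty alphabet.\<close>

definition child_numbers :: "'a ranked_alphabet \<Rightarrow> child_number set" where
  "child_numbers \<Sigma> = {Root} \<union> {Child i | i. 1 \<le> i \<and> (\<exists>b \<in> letters \<Sigma>. i \<le> arity \<Sigma> b)}"

definition commands :: "'q set \<Rightarrow> nat \<Rightarrow> 'q command set" where
  "commands Q n =
    {Accept, Reject} \<union> {Move q d | q d. q \<in> Q \<and> d \<in> {Parent} \<union> To_Child ` {1..n}}"

definition dtwa :: "'a ranked_alphabet \<Rightarrow> ('a, 'q) dtwa \<Rightarrow> bool" where
  "dtwa \<Sigma> M \<longleftrightarrow> finite (dtwa_states M) \<and> dtwa_init M \<in> dtwa_states M \<and>
    (\<forall>a \<in> letters \<Sigma>. \<forall>q \<in> dtwa_states M. \<forall>c \<in> child_numbers \<Sigma>.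
      dtwa_delta M a q c \<in> commands (dtwa_states M) (arity \<Sigma> a))"

text \<open>A node is the list of child numbers, counted from 1, on the path from the root to it.\<close>

type_synonym node = "nat list"

fun subtree_at :: "'a tree \<Rightarrow> node \<Rightarrow> 'a tree" where
  "subtree_at t [] = t"
| "subtree_at t (i # v) = subtree_at (children t ! (i - 1)) v"

definition label_at :: "'a tree \<Rightarrow> node \<Rightarrow> 'a" where
  "label_at t v = root_label (subtree_at t v)"

definition child_number_of :: "node \<Rightarrow> child_number" where
  "child_number_of v = (if v = [] then Root else Child (last v))"

definition dtwa_command :: "('a, 'q) dtwa \<Rightarrow> 'a tree \<Rightarrow> 'q \<times> node \<Rightarrow> 'q command" where
  "dtwa_command M t = (\<lambda>(q, v). dtwa_delta M (label_at t v) q (child_number_of v))"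

text \<open>There is no step for the command \<^const>\<open>Parent\<close> at the root, so a run that leaves the
  tree gets stuck without accepting. A step to a child never leaves a tree over \<open>\<Sigma>\<close>
  when \<open>dtwa \<Sigma> M\<close> holds.\<close>

inductive dtwa_step :: "('a, 'q) dtwa \<Rightarrow> 'a tree \<Rightarrow> 'q \<times> node \<Rightarrow> 'q \<times> node \<Rightarrow> bool"
  for M t where
  to_parent: "dtwa_command M t (q, v) = Move q' Parent \<Longrightarrow> v \<noteq> []
    \<Longrightarrow> dtwa_step M t (q, v) (q', butlast v)"
| to_child: "dtwa_command M t (q, v) = Move q' (To_Child i)
    \<Longrightarrow> dtwa_step M t (q, v) (q', v @ [i])"

definition dtwa_accepts :: "('a, 'q) dtwa \<Rightarrow> 'a tree \<Rightarrow> bool" where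
  "dtwa_accepts M t \<longleftrightarrow>
    (\<exists>c. (dtwa_step M t)\<^sup>*\<^sup>* (dtwa_init M, []) c \<and> dtwa_command M t c = Accept)"

definition dtwa_language :: "'a ranked_alphabet \<Rightarrow> ('a, 'q) dtwa \<Rightarrow> 'a tree set" where
  "dtwa_language \<Sigma> M = {t \<in> trees \<Sigma>. dtwa_accepts M t}"

text \<open>State sets are finite, so it is no loss of generality to take the states of the separating
  automaton to be natural numbers.\<close>

definition dtwa_separable :: "'a ranked_alphabet \<Rightarrow> 'a tree set \<Rightarrow> 'a tree set \<Rightarrow> bool" where
  "dtwa_separable \<Sigma> L1 L2 \<longleftrightarrow> (\<exists>M :: ('a, nat) dtwa.
    dtwa \<Sigma> M \<and> L1 \<subseteq> dtwa_language \<Sigma> M \<and> dtwa_language \<Sigma> M \<inter> L2 = {})"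

section \<open>Partial recursive functions and decidable problems\<close>

text \<open>\<open>evaluates f xs y\<close> means that \<open>f\<close> is defined on the arguments \<open>xs\<close> with value \<open>y\<close>.
  \<open>Zero\<close> is the constant zero function of every arity. The recursion variable of \<open>Prim_Rec\<close> and
  the search variable of \<open>Mu\<close> come first in the argument list.\<close>

datatype recf =
    Zero
  | Succ
  | Proj nat
  | Comp recf "recf list"
  | Prim_Rec recf recf
  | Mu recf

inductive evaluates :: "recf \<Rightarrow> nat list \<Rightarrow> nat \<Rightarrow> bool" where
  zero: "evaluates Zero xs 0"
| succ: "evaluates Succ [x] (Suc x)"
| proj: "i < length xs \<Longrightarrow> evaluates (Proj i) xs (xs ! i)"
| comp: "list_all2 (\<lambda>g y. evaluates g xs y) gs ys \<Longrightarrow> evaluates f ys z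
    \<Longrightarrow> evaluates (Comp f gs) xs z"
| prim_rec_0: "evaluates f xs y \<Longrightarrow> evaluates (Prim_Rec f g) (0 # xs) y"
| prim_rec_Suc: "evaluates (Prim_Rec f g) (n # xs) r \<Longrightarrow> evaluates g (n # r # xs) y
    \<Longrightarrow> evaluates (Prim_Rec f g) (Suc n # xs) y"
| mu: "evaluates f (n # xs) 0 \<Longrightarrow> (\<forall>i<n. \<exists>y. evaluates f (i # xs) (Suc y))
    \<Longrightarrow> evaluates (Mu f) xs n"

inductive_cases evaluates_ZeroE: "evaluates Zero xs y"
inductive_cases evaluates_SuccE: "evaluates Succ xs y"
inductive_cases evaluates_ProjE: "evaluates (Proj i) xs y"
inductive_cases evaluates_CompE: "evaluates (Comp f gs) xs y"
inductive_cases evaluates_Prim_Rec_0E: "evaluates (Prim_Rec f g) (0 # xs) y"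
inductive_cases evaluates_Prim_Rec_SucE: "evaluates (Prim_Rec f g) (Suc n # xs) y"
inductive_cases evaluates_MuE: "evaluates (Mu f) xs y"

lemma evaluates_deterministic: "evaluates f xs y \<Longrightarrow> evaluates f xs z \<Longrightarrow> y = z"
proof (induction arbitrary: z rule: evaluates.induct)
  case (zero xs)
  then show ?case by (rule evaluates_ZeroE) simp
next
  case (succ x)
  then show ?case by (rule evaluates_SuccE) simp
next
  case (proj i xs)
  from proj.prems show ?case by (rule evaluates_ProjE) simp
next
  case (comp xs gs ys f y)
  from comp.prems obtain zs where zs: "list_all2 (\<lambda>g y. evaluates g xs y) gs zs" "evaluates f zs z"
    by (rule evaluates_CompE)
  have "ys ! i = zs ! i" if "i < length gs" for i
    using that list_all2_nthD[OF comp.IH(1)] list_all2_nthD[OF zs(1)] by blast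
  then have "ys = zs"
    using list_all2_lengthD[OF comp.IH(1)] list_all2_lengthD[OF zs(1)]
    by (intro nth_equalityI) simp_all
  then show ?case using comp.IH(2) zs(2) by blast
next
  case (prim_rec_0 f xs y g)
  from prim_rec_0.prems show ?case by (rule evaluates_Prim_Rec_0E) (rule prim_rec_0.IH)
next
  case (prim_rec_Suc f g n xs r y)
  from prim_rec_Suc.prems obtain r'
    where "evaluates (Prim_Rec f g) (n # xs) r'" "evaluates g (n # r' # xs) z"
    by (rule evaluates_Prim_Rec_SucE)
  then show ?case using prim_rec_Suc.IH by blast
next
  case (mu f n xs)
  from mu.prems have z: "evaluates f (z # xs) 0" "\<forall>i<z. \<exists>y. evaluates f (i # xs) (Suc y)"
    by (auto elim: evaluates_MuE)
  have "\<not> z < n" using mu.IH(2) z(1) by blast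
  moreover have "\<not> n < z" using mu.IH(1) z(2) by blast
  ultimately show ?case by simp
qed

text \<open>A decision problem is a set \<open>X\<close> of inputs together with a property \<open>P\<close> of inputs; inputs are
  given to an algorithm through the encoding \<open>enc\<close>. An algorithm need not terminate, nor give a
  meaningful answer, on numbers that are not codes of inputs.\<close>

definition decidable_problem :: "('x \<Rightarrow> nat) \<Rightarrow> 'x set \<Rightarrow> ('x \<Rightarrow> bool) \<Rightarrow> bool" where
  "decidable_problem enc X P \<longleftrightarrow>
    (\<exists>f. \<forall>x \<in> X. evaluates f [enc x] (if P x then 1 else 0))"

section \<open>Finite presentations of the inputs\<close>

text \<open>A ranked alphabet is presented by the list of arities of its letters \<open>0, 1, \<dots>\<close>.\<close>

definition alphabet_of :: "nat list \<Rightarrow> nat ranked_alphabet" where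
  "alphabet_of ars = \<lparr>letters = {..<length ars}, arity = (\<lambda>a. ars ! a)\<rparr>"

text \<open>\<open>(n, fs, rs)\<close> presents the automaton with states \<open>0, \<dots>, n - 1\<close>, accepting states \<open>fs\<close>, and
  the transition table \<open>rs\<close>, in which the entry \<open>(a, qs, q)\<close> stands for \<open>\<delta>\<^sub>a qs = q\<close>.\<close>

type_synonym dbta_table = "nat \<times> nat list \<times> (nat \<times> nat list \<times> nat) list"

definition dbta_of :: "dbta_table \<Rightarrow> (nat, nat) dbta" where
  "dbta_of = (\<lambda>(n, fs, rs).
    \<lparr>dbta_states = {..<n}, dbta_final = set fs,
     dbta_delta = (\<lambda>a qs. THE q. (a, qs, q) \<in> set rs)\<rparr>)"

definition valid_dbta_table :: "nat ranked_alphabet \<Rightarrow> dbta_table \<Rightarrow> bool" where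
  "valid_dbta_table \<Sigma> = (\<lambda>(n, fs, rs).
    set fs \<subseteq> {..<n} \<and>
    (\<forall>(a, qs, q) \<in> set rs. a \<in> letters \<Sigma> \<and> qs \<in> tuples {..<n} (arity \<Sigma> a) \<and> q < n) \<and>
    (\<forall>a \<in> letters \<Sigma>. \<forall>qs \<in> tuples {..<n} (arity \<Sigma> a). \<exists>!q. (a, qs, q) \<in> set rs))"

lemma ranked_alphabet_alphabet_of: "ranked_alphabet (alphabet_of ars)"
  by (simp add: ranked_alphabet_def alphabet_of_def)

lemma dbta_dbta_of:
  assumes "valid_dbta_table \<Sigma> T"
  shows "dbta \<Sigma> (dbta_of T)"
proof -
  obtain n fs rs where T: "T = (n, fs, rs)" by (cases T)
  have fs: "set fs \<subseteq> {..<n}"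
    and bound: "\<And>a qs q. (a, qs, q) \<in> set rs \<Longrightarrow> q < n"
    and ex1: "\<And>a qs. a \<in> letters \<Sigma> \<Longrightarrow> qs \<in> tuples {..<n} (arity \<Sigma> a) \<Longrightarrow>
      \<exists>!q. (a, qs, q) \<in> set rs"
    using assms unfolding T valid_dbta_table_def prod.case by blast+
  have "(THE q. (a, qs, q) \<in> set rs) < n"
    if "a \<in> letters \<Sigma>" "qs \<in> tuples {..<n} (arity \<Sigma> a)" for a qs
    using theI'[OF ex1[OF that]] by (rule bound)
  then show ?thesis using fs by (simp add: T dbta_def dbta_of_def)
qed

lemma finite_tuples: "finite Q \<Longrightarrow> finite (tuples Q n)"
  unfolding tuples_def using finite_lists_length_eq[of Q n] by (simp add: conj_commute)

lemma ex_dbta_table: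
  assumes \<Sigma>: "ranked_alphabet \<Sigma>" and A: "dbta \<Sigma> A" and n: "dbta_states A = {..<n}"
  obtains T where "valid_dbta_table \<Sigma> T" "dbta_states (dbta_of T) = dbta_states A"
    "dbta_final (dbta_of T) = dbta_final A"
    "\<forall>a \<in> letters \<Sigma>. \<forall>qs \<in> tuples (dbta_states A) (arity \<Sigma> a).
      dbta_delta (dbta_of T) a qs = dbta_delta A a qs"
proof -
  define R where
    "R = (\<Union>a \<in> letters \<Sigma>. (\<lambda>qs. (a, qs, dbta_delta A a qs)) ` tuples {..<n} (arity \<Sigma> a))"
  have R_iff: "(a, qs, q) \<in> R \<longleftrightarrow>
      a \<in> letters \<Sigma> \<and> qs \<in> tuples {..<n} (arity \<Sigma> a) \<and> q = dbta_delta A a qs" for a qs q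
    by (auto simp: R_def)
  have "finite R" using \<Sigma> by (simp add: R_def ranked_alphabet_def finite_tuples)
  then obtain rs where rs: "set rs = R" by (metis finite_list)
  have final: "dbta_final A \<subseteq> {..<n}" using A n by (simp add: dbta_def)
  then have "finite (dbta_final A)" by (rule finite_subset) simp
  then obtain fs where fs: "set fs = dbta_final A" by (metis finite_list)
  have delta: "dbta_delta A a qs < n"
    if "a \<in> letters \<Sigma>" "qs \<in> tuples {..<n} (arity \<Sigma> a)" for a qs
    using A that by (simp add: dbta_def n)
  show thesis
  proof (rule that[of "(n, fs, rs)"])
    show "valid_dbta_table \<Sigma> (n, fs, rs)"
      using final delta unfolding valid_dbta_table_def prod.case fs rs by (auto simp: R_iff)
  qed (simp_all add: dbta_of_def n fs rs R_iff)
qed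

type_synonym separation_input = "nat list \<times> dbta_table \<times> dbta_table"

definition separation_inputs :: "separation_input set" where
  "separation_inputs =
    {(ars, T1, T2). valid_dbta_table (alphabet_of ars) T1 \<and> valid_dbta_table (alphabet_of ars) T2}"

definition separation_problem :: "separation_input \<Rightarrow> bool" where
  "separation_problem = (\<lambda>(ars, T1, T2).
    dtwa_separable (alphabet_of ars)
      (dbta_language (alphabet_of ars) (dbta_of T1))
      (dbta_language (alphabet_of ars) (dbta_of T2)))"

definition encode_rule :: "nat \<times> nat list \<times> nat \<Rightarrow> nat" where
  "encode_rule = (\<lambda>(a, qs, q). prod_encode (a, prod_encode (list_encode qs, q)))"

definition encode_table :: "dbta_table \<Rightarrow> nat" where
  "encode_table = (\<lambda>(n, fs, rs).
    prod_encode (n, prod_encode (list_encode fs, list_encode (map encode_rule rs))))"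

definition encode_input :: "separation_input \<Rightarrow> nat" where
  "encode_input = (\<lambda>(ars, T1, T2).
    prod_encode (list_encode ars, prod_encode (encode_table T1, encode_table T2)))"

lemma inj_encode_rule: "inj encode_rule"
  by (rule injI) (clarsimp simp: encode_rule_def prod_encode_eq list_encode_eq)

lemma inj_encode_table: "inj encode_table"
  by (rule injI)
    (clarsimp simp: encode_table_def prod_encode_eq list_encode_eq inj_map_eq_map inj_encode_rule)

lemma inj_encode_input: "inj encode_input"
  by (rule injI)
    (clarsimp simp: encode_input_def prod_encode_eq list_encode_eq inj_eq[OF inj_encode_table])

end

theory Submission imports Defs "HOL-Library.Multiset" begin

text \<open>Suppose that separability were decidable. By diagonalisation there is a register machine that
  diverges on its own code \<open>e\<close> iff the instance \<open>input e\<close> is separable. Trees of this instance are binary and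
  only their words of leaves matter, after deletion of blanks. Both languages consist of words of
  letters \<open>a\<close> followed by a sequence of configurations. In the first language \<open>m\<close> letters \<open>a\<close> are followed
  by the initial configuration and \<open>m\<close> pairs of successive configurations. In the second one \<open>2 * m\<close> letters
  are followed by \<open>m\<close> such pairs and one more configuration. Bottom-up automata can check this on trees that
  nest the registers of a pair around its labels.

  If the machine halts, words of both languages cannot share a long prefix of configurations, since the
  pairs of both would overlap to a long computation. Hence a bounded prefix decides, and a depth-first
  walk reads it off.

  If the machine diverges, its computation yields, for every \<open>m\<close>, a tree in each language with the same
  configurations but different numbers of letters \<open>a\<close> and different bracketing. For every
  tree-walking automaton there is a blank pattern \<open>D\<close> with two holes whose behaviour is associative
  (as in the proof of Bojanczyk and Colcombet that tree-walking automata do not recognise all regular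
  languages). If all binary nodes are replaced by \<open>D\<close>, the automaton sees just a product of leaves in a
  finite semigroup and cannot tell the \<open>m\<close>-th power of the letter \<open>a\<close> from the \<open>2 * m\<close>-th one for suitable
  \<open>m\<close>.\<close>

section \<open>Walks through composed devices\<close>

text \<open>A finite bottom-up automaton can compare the unbounded registers of two configurations
  only by nesting them around a label, and such a nesting serves just one pair of neighbours. Hence
  each language checks every second step: numbering the \<open>2 * m + 1\<close> configurations from
  0, the first language checks the steps 1-2, 3-4, ... and the initial configuration, the second one
  0-1, 2-3, .... Configurations that pass both checks form a genuine computation. The letters
  \<open>a\<close> keep the languages apart even then, because \<open>m\<close> and
  \<open>2 * m\<close> differ for positive \<open>m\<close>. A walker might still recognise a
  language by its bracketing, so the bracketing has to be made invisible. Behaviours of patterns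
  only form a finite semigroup; conjugating by an idempotent whose local monoid is a group supplies
  the inverses needed to normalise a two-hole pattern. Associativity then follows since filling any
  hole of either bracketing gives the same device, apart from a few walks that are excluded
  directly. The tree automata are sound on all trees, but are shown to accept only trees built from
  an infinite computation.\<close>

text \<open>A device maps the port and state in which a walk enters to the port and state in which it leaves;
  port 0 is the root and a port \<open>h > 0\<close> is the hole number \<open>h\<close>. A device that does not let a walk leave
  has no value there. In \<open>run a b\<close> the device \<open>b h\<close> is plugged into port \<open>h\<close> of \<open>a\<close>; \<open>Inl\<close> and \<open>Inr\<close> tell
  whether the walk is about to enter \<open>a\<close> or a lower device.\<close>

type_synonym 's dev = "nat \<times> 's \<Rightarrow> nat \<times> 's \<Rightarrow> bool"

inductive run :: "'s dev \<Rightarrow> (nat \<Rightarrow> 's dev)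
    \<Rightarrow> nat \<times> 's + nat \<times> nat \<times> 's \<Rightarrow> nat \<times> 's \<Rightarrow> bool" for a b where
  up_out: "a x (0, r) \<Longrightarrow> run a b (Inl x) (0, r)"
| up_in: "a x (h, r) \<Longrightarrow> 0 < h \<Longrightarrow> run a b (Inr (h, 0, r)) y \<Longrightarrow> run a b (Inl x) y"
| lo_out: "b h x (k, r) \<Longrightarrow> 0 < k \<Longrightarrow> run a b (Inr (h, x)) (k, r)"
| lo_in: "b h x (0, r) \<Longrightarrow> run a b (Inl (h, r)) y \<Longrightarrow> run a b (Inr (h, x)) y"

definition pcomp :: "'s dev \<Rightarrow> (nat \<Rightarrow> 's dev) \<Rightarrow> 's dev" where
  "pcomp a b x y \<longleftrightarrow> (if fst x = 0 then run a b (Inl x) y else (\<exists>h. run a b (Inr (h, x)) y))"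

inductive_cases run_InlE: "run a b (Inl x) y"
inductive_cases run_InrE: "run a b (Inr (h, x)) y"

lemma run_Inl_iff: "run a b (Inl x) y \<longleftrightarrow>
    (\<exists>r. a x (0, r) \<and> y = (0, r)) \<or> (\<exists>h r. a x (h, r) \<and> 0 < h \<and> run a b (Inr (h, 0, r)) y)"
proof
  assume "run a b (Inl x) y"
  then show "(\<exists>r. a x (0, r) \<and> y = (0, r)) \<or> (\<exists>h r. a x (h, r) \<and> 0 < h \<and> run a b (Inr (h, 0, r)) y)"
    by (rule run_InlE) blast+
qed (auto intro: run.intros)

lemma run_Inr_iff: "run a b (Inr (h, x)) y \<longleftrightarrow>
    (b h x y \<and> 0 < fst y) \<or> (\<exists>r. b h x (0, r) \<and> run a b (Inl (h, r)) y)"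
  by (cases y) (auto elim: run_InrE intro: run.intros)

text \<open>The two ways of composing three layers are compared with one walk that switches between them.\<close>

datatype 's point = At_a "nat \<times> 's" | At_b nat "nat \<times> 's" | At_c nat "nat \<times> 's"

inductive flat :: "'s dev \<Rightarrow> (nat \<Rightarrow> 's dev)
    \<Rightarrow> (nat \<Rightarrow> 's dev) \<Rightarrow> 's point \<Rightarrow> nat \<times> 's \<Rightarrow> bool" for a b t where
  A_out: "a x (0, r) \<Longrightarrow> flat a b t (At_a x) (0, r)"
| A_B: "a x (i, r) \<Longrightarrow> 0 < i \<Longrightarrow> flat a b t (At_b i (0, r)) y \<Longrightarrow> flat a b t (At_a x) y"
| B_A: "b i x (0, r) \<Longrightarrow> flat a b t (At_a (i, r)) y \<Longrightarrow> flat a b t (At_b i x) y"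
| B_C: "b i x (h, r) \<Longrightarrow> 0 < h \<Longrightarrow> flat a b t (At_c h (0, r)) y \<Longrightarrow> flat a b t (At_b i x) y"
| C_out: "t h x (k, r) \<Longrightarrow> 0 < k \<Longrightarrow> flat a b t (At_c h x) (k, r)"
| C_B: "t h x (0, r) \<Longrightarrow> flat a b t (At_b i (h, r)) y \<Longrightarrow> flat a b t (At_c h x) y"

inductive_cases flat_BE: "flat a b t (At_b i x) y"
inductive_cases flat_CE: "flat a b t (At_c h x) y"

lemma flat_of_run_ab:
  assumes "run a b z w" and "fst w = 0 \<longrightarrow> y = w" and "0 < fst w \<longrightarrow> flat a b t (At_c (fst w) (0, snd w)) y"
  shows "flat a b t (case z of Inl x \<Rightarrow> At_a x | Inr (i, x) \<Rightarrow> At_b i x) y"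
  using assms by (induction rule: run.induct) (auto intro: flat.intros)

lemma flat_of_run_bc:
  assumes "run (b i) s z w" and "\<And>h x y. s h x y \<Longrightarrow> t h x y"
    and "0 < fst w \<longrightarrow> y = w" and "fst w = 0 \<longrightarrow> flat a b t (At_a (i, snd w)) y"
  shows "flat a b t (case z of Inl x \<Rightarrow> At_b i x | Inr (h, x) \<Rightarrow> At_c h x) y"
  using assms
proof (induction rule: run.induct)
  case (lo_in h x r y')
  then have "flat a b t (At_b i (h, r)) y" "t h x (0, r)" by simp_all
  then show ?case by (simp add: flat.C_B)
qed (auto intro: flat.intros)

lemma flat_of_pcomp_ab:
  assumes "pcomp a b x w" and "fst w = 0 \<longrightarrow> y = w" and "0 < fst w \<longrightarrow> flat a b t (At_c (fst w) (0, snd w)) y"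
  shows "if fst x = 0 then flat a b t (At_a x) y else (\<exists>i. flat a b t (At_b i x) y)"
proof (cases "fst x = 0")
  case True
  then have "run a b (Inl x) w" using assms(1) by (simp add: pcomp_def)
  from flat_of_run_ab[OF this assms(2,3)] show ?thesis using True by simp
next
  case False
  then obtain h where "run a b (Inr (h, x)) w" using assms(1) by (auto simp: pcomp_def)
  from flat_of_run_ab[OF this assms(2,3)] show ?thesis using False by auto
qed

lemma flat_of_pcomp_bc:
  assumes "pcomp (b i) s x w" and "\<And>h x y. s h x y \<Longrightarrow> t h x y"
    and "0 < fst w \<longrightarrow> y = w" and "fst w = 0 \<longrightarrow> flat a b t (At_a (i, snd w)) y"
  shows "if fst x = 0 then flat a b t (At_b i x) y else (\<exists>h. flat a b t (At_c h x) y)"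
proof (cases "fst x = 0")
  case True
  then have "run (b i) s (Inl x) w" using assms(1) by (simp add: pcomp_def)
  from flat_of_run_bc[OF this assms(2-4)] show ?thesis using True by simp
next
  case False
  then obtain h where "run (b i) s (Inr (h, x)) w" using assms(1) by (auto simp: pcomp_def)
  from flat_of_run_bc[OF this assms(2-4)] show ?thesis using False by auto
qed

context
  fixes a :: "'s dev" and b t :: "nat \<Rightarrow> 's dev" and s :: "nat \<Rightarrow> nat \<Rightarrow> 's dev"
    and Hs :: "nat \<Rightarrow> nat set"
  assumes ports: "\<And>i x y. b i x y \<Longrightarrow> fst x \<in> insert 0 (Hs i) \<and> fst y \<in> insert 0 (Hs i)"
    and disj: "\<And>i j h. h \<in> Hs i \<Longrightarrow> h \<in> Hs j \<Longrightarrow> i = j"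
    and nz: "\<And>i. 0 \<notin> Hs i"
    and Hs: "\<And>h i. h \<in> Hs i \<Longrightarrow> s i h = t h" "\<And>h i. h \<notin> Hs i \<Longrightarrow> s i h = bot"
      "\<And>h. (\<And>i. h \<notin> Hs i) \<Longrightarrow> t h = bot"
begin

lemma s_le_t: "s i h x y \<Longrightarrow> t h x y"
  using Hs(1,2)[of h i] by (cases "h \<in> Hs i") auto

lemma t_Hs: "t h x y \<Longrightarrow> \<exists>i. h \<in> Hs i"
  using Hs(3)[of h] by (metis bot_apply bot_bool_def)

lemma t_pos: "t h x y \<Longrightarrow> 0 < h"
  using t_Hs nz gr0I by metis

lemma flat_of_run_right:
  assumes "run (pcomp a b) t z y"
  shows "case z of Inl x \<Rightarrow> (if fst x = 0 then flat a b t (At_a x) y else (\<exists>i. flat a b t (At_b i x) y))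
    | Inr (h, x) \<Rightarrow> flat a b t (At_c h x) y"
  using assms
proof (induction rule: run.induct)
  case (up_out x r)
  then show ?case
    using flat_of_pcomp_ab[of a b x "(0, r)" "(0, r)" t] by simp
next
  case (up_in x h r y)
  then show ?case
    using flat_of_pcomp_ab[of a b x "(h, r)" y t] by simp
next
  case (lo_out h x k r)
  then show ?case by (auto intro: flat.intros)
next
  case (lo_in h x r y)
  have "0 < h" using lo_in.hyps(1) by (rule t_pos)
  then obtain i where "flat a b t (At_b i (h, r)) y" using lo_in.IH by auto
  then show ?case using lo_in.hyps(1) by (simp add: flat.C_B)
qed

text \<open>The induction runs backwards from the end of the flat walk. The exit \<open>w\<close> at
  which the part inside \<open>a\<close> and \<open>b\<close> ends is carried along as a witness,
  and \<open>K w\<close> records how the walk goes on from there: it is over, or it enters a device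
  of \<open>t\<close>.\<close>

lemma run_right_of_flat:
  assumes "flat a b t z y"
  defines "K \<equiv> \<lambda>w. fst w = 0 \<and> y = w \<or> 0 < fst w \<and> run (pcomp a b) t (Inr (fst w, 0, snd w)) y"
  shows "case z of At_a x \<Rightarrow> \<exists>w. run a b (Inl x) w \<and> K w | At_b i x \<Rightarrow> \<exists>w. run a b (Inr (i, x)) w \<and> K w
    | At_c h x \<Rightarrow> run (pcomp a b) t (Inr (h, x)) y"
  using assms(1) unfolding K_def
proof (induction rule: flat.induct)
  case (C_B h x r i y)
  then obtain w where w: "run a b (Inr (i, h, r)) w"
    "fst w = 0 \<and> y = w \<or> 0 < fst w \<and> run (pcomp a b) t (Inr (fst w, 0, snd w)) y" by auto
  then have "pcomp a b (h, r) w" using t_pos[OF C_B.hyps(1)] by (auto simp: pcomp_def)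
  then have "run (pcomp a b) t (Inl (h, r)) y" using w(2)
    by (cases w) (auto simp: run_Inl_iff[of "pcomp a b"])
  then show ?case using C_B.hyps(1) by (auto intro: run.intros)
next
  case (A_out x r)
  then have "run a b (Inl x) (0, r)" by (rule run.intros)
  then show ?case unfolding point.case by (intro exI[of _ "(0, r)"]) simp
next
  case (B_C i x h r y)
  then have "run a b (Inr (i, x)) (h, r)" by (intro run.intros)
  then show ?case using B_C unfolding point.case by (intro exI[of _ "(h, r)"]) simp
next
  case (A_B x i r y)
  then obtain w where w: "run a b (Inr (i, 0, r)) w"
    "fst w = 0 \<and> y = w \<or> 0 < fst w \<and> run (pcomp a b) t (Inr (fst w, 0, snd w)) y" by auto
  then have "run a b (Inl x) w" using A_B.hyps by (intro run.up_in)
  then show ?case using w(2) unfolding point.case by blast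
next
  case (B_A i x r y)
  then obtain w where w: "run a b (Inl (i, r)) w"
    "fst w = 0 \<and> y = w \<or> 0 < fst w \<and> run (pcomp a b) t (Inr (fst w, 0, snd w)) y" by auto
  then have "run a b (Inr (i, x)) w" using B_A.hyps by (intro run.lo_in)
  then show ?case using w(2) unfolding point.case by blast
next
  case (C_out h x k r)
  then show ?case by (auto intro: run.intros)
qed

lemma flat_of_run_left:
  assumes "run a (\<lambda>i. pcomp (b i) (s i)) z y"
  shows "case z of Inl x \<Rightarrow> flat a b t (At_a x) y
    | Inr (i, x) \<Rightarrow> (if fst x = 0 then flat a b t (At_b i x) y else (\<exists>h. flat a b t (At_c h x) y))"
  using assms
proof (induction rule: run.induct)
  case (lo_out h x k r)
  then show ?case 
    using flat_of_pcomp_bc[of b h "s h" x "(k, r)" t "(k, r)" a] s_le_t by simp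
next
  case (lo_in h x r y)
  then show ?case 
    using flat_of_pcomp_bc[of b h "s h" x "(0, r)" t y a] s_le_t by simp
qed (auto intro: flat.intros)

text \<open>Now the walk is cut where it leaves a composed device \<open>pcomp (b i) (s i)\<close>.
  A point \<open>At_c h x\<close> does not remember its middle device, hence the quantification over
  all \<open>i\<close> that own \<open>h\<close>.\<close>

lemma run_left_of_flat:
  assumes "flat a b t z y"
  defines "R \<equiv> run a (\<lambda>i. pcomp (b i) (s i))"
  defines "K \<equiv> \<lambda>i w. 0 < fst w \<and> y = w \<or> fst w = 0 \<and> R (Inl (i, snd w)) y"
  shows "case z of At_a x \<Rightarrow> R (Inl x) y
    | At_b i x \<Rightarrow> \<exists>w. run (b i) (s i) (Inl x) w \<and> K i w
    | At_c h x \<Rightarrow> \<forall>i. h \<in> Hs i \<longrightarrow> (\<exists>w. run (b i) (s i) (Inr (h, x)) w \<and> K i w)"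
  using assms(1) unfolding K_def
proof (induction rule: flat.induct)
  case (A_out x r)
  then show ?case by (auto simp: R_def intro: run.intros)
next
  case (A_B x i r y)
  then obtain w where w: "run (b i) (s i) (Inl (0, r)) w"
    "0 < fst w \<and> y = w \<or> fst w = 0 \<and> R (Inl (i, snd w)) y" by auto
  then have "R (Inr (i, 0, r)) y" unfolding R_def run_Inr_iff[of a]
    by (cases w) (auto simp: pcomp_def)
  then show ?case using A_B by (auto simp: R_def intro: run.intros)
next
  case (B_A i x r y)
  then have "run (b i) (s i) (Inl x) (0, r)" by (intro run.intros)
  then show ?case using B_A unfolding point.case by (intro exI[of _ "(0, r)"]) simp
next
  case (B_C i x h r y)
  then have "h \<in> Hs i" using ports[of i x "(h, r)"] by auto
  then obtain w where w: "run (b i) (s i) (Inr (h, 0, r)) w"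
    "0 < fst w \<and> y = w \<or> fst w = 0 \<and> R (Inl (i, snd w)) y" using B_C by auto
  then have "run (b i) (s i) (Inl x) w" using B_C.hyps by (intro run.up_in)
  then show ?case using w(2) unfolding point.case by blast
next
  case (C_out h x k r)
  have "run (b i) (s i) (Inr (h, x)) (k, r)" if "h \<in> Hs i" for i
    using C_out Hs(1)[OF that] by (intro run.intros) simp_all
  then show ?case using C_out unfolding point.case by (intro allI impI exI[of _ "(k, r)"]) simp
next
  case (C_B h x r j y)
  \<comment> \<open>\<open>flat\<close> merely guesses the middle device \<open>j\<close>. That
    \<open>b j\<close> moves on from port \<open>h\<close> shows that \<open>j\<close> owns
    \<open>h\<close>, and disjointness makes the guess correct.\<close>
  have "\<exists>u. b j (h, r) u" using C_B.hyps(2) by (rule flat_BE) blast+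
  then have "h \<in> Hs j" using ports[of j "(h, r)"] t_pos[OF C_B.hyps(1)] by auto
  then have i: "i = j" if "h \<in> Hs i" for i using disj that by blast
  obtain w where w: "run (b j) (s j) (Inl (h, r)) w"
    "0 < fst w \<and> y = w \<or> fst w = 0 \<and> R (Inl (j, snd w)) y" using C_B by auto
  then have "run (b j) (s j) (Inr (h, x)) w"
    using C_B.hyps(1) Hs(1)[OF \<open>h \<in> Hs j\<close>] by (intro run.lo_in) simp_all
  then show ?case using w(2) i unfolding point.case by blast
qed

text \<open>Both sides coincide with \<open>flat\<close>. Middle devices have disjoint sets of
  holes, so a walk climbing out of a bottom device can resume in only one of them;
  \<open>s i\<close> is \<open>bot\<close> outside \<open>Hs i\<close>, so that \<open>b i\<close>
  cannot be entered from the holes of a sibling.\<close>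

lemma pcomp_assoc: "pcomp a (\<lambda>i. pcomp (b i) (s i)) = pcomp (pcomp a b) t"
proof (intro ext)
  fix x y
  have "pcomp (pcomp a b) t x y \<longleftrightarrow>
      (if fst x = 0 then flat a b t (At_a x) y else (\<exists>h. flat a b t (At_c h x) y))"
  proof (cases "fst x = 0")
    case True
    then have "pcomp (pcomp a b) t x y \<longleftrightarrow> run (pcomp a b) t (Inl x) y" by (simp add: pcomp_def)
    also have "\<dots> \<longleftrightarrow> flat a b t (At_a x) y"
    proof
      assume "flat a b t (At_a x) y"
      from run_right_of_flat[OF this] obtain w where w: "run a b (Inl x) w"
        "fst w = 0 \<and> y = w \<or> 0 < fst w \<and> run (pcomp a b) t (Inr (fst w, 0, snd w)) y" by auto
      then have "pcomp a b x w" using True by (simp add: pcomp_def)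
      then show "run (pcomp a b) t (Inl x) y" using w(2)
        by (cases w) (auto simp: run_Inl_iff[of "pcomp a b"])
    qed (use flat_of_run_right[of "Inl x" y] True in simp)
    finally show ?thesis using True by simp
  next
    case False
    then show ?thesis
      using flat_of_run_right[of "Inr (j, x)" y for j] run_right_of_flat[of "At_c j x" y for j]
      unfolding pcomp_def[of "pcomp a b"] by auto
  qed
  moreover have "pcomp a (\<lambda>i. pcomp (b i) (s i)) x y \<longleftrightarrow>
      (if fst x = 0 then flat a b t (At_a x) y else (\<exists>h. flat a b t (At_c h x) y))"
  proof (cases "fst x = 0")
    case True
    then show ?thesis
      using flat_of_run_left[of "Inl x" y] run_left_of_flat[of "At_a x" y]
      unfolding pcomp_def[of a] by auto
  next
    case False
    have "\<exists>i. run a (\<lambda>i. pcomp (b i) (s i)) (Inr (i, x)) y" if "flat a b t (At_c h x) y" for h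
    proof -
      have "\<exists>y. t h x y" using that by (rule flat_CE) blast+
      then obtain i where "h \<in> Hs i" using t_Hs by blast
      with run_left_of_flat[OF that] obtain w where w: "run (b i) (s i) (Inr (h, x)) w" "0 < fst w \<and> y = w \<or>
          fst w = 0 \<and> run a (\<lambda>i. pcomp (b i) (s i)) (Inl (i, snd w)) y"
        by auto
      then have "pcomp (b i) (s i) x w" using False by (auto simp: pcomp_def)
      then show ?thesis using w(2) unfolding run_Inr_iff[of a] by (cases w) auto
    qed
    then show ?thesis using False flat_of_run_left[of "Inr (j, x)" y for j]
      unfolding pcomp_def[of a] by (auto split: if_splits)
  qed
  ultimately show "pcomp a (\<lambda>i. pcomp (b i) (s i)) x y = pcomp (pcomp a b) t x y" by simp
qed

end

section \<open>Patterns\<close>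

datatype pat = Hole nat | Leaf nat | Bin pat pat

primrec hl :: "pat \<Rightarrow> nat list" where
  "hl (Hole h) = [h]"
| "hl (Leaf a) = []"
| "hl (Bin p q) = hl p @ hl q"

primrec subst :: "(nat \<Rightarrow> pat) \<Rightarrow> pat \<Rightarrow> pat" where
  "subst \<sigma> (Hole h) = \<sigma> h"
| "subst \<sigma> (Leaf a) = Leaf a"
| "subst \<sigma> (Bin p q) = Bin (subst \<sigma> p) (subst \<sigma> q)"

text \<open>Since a walk sees whether it is in a first or in a second child, patterns can only be substituted
  into holes that are first children.\<close>

primrec ok :: "pat \<Rightarrow> bool" where
  "ok (Hole h) \<longleftrightarrow> 0 < h"
| "ok (Leaf a) \<longleftrightarrow> True"
| "ok (Bin p q) \<longleftrightarrow> ok p \<and> ok q \<and> (\<forall>h. q \<noteq> Hole h) \<and> set (hl p) \<inter> set (hl q) = {}"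

lemma subst_subst: "subst \<sigma> (subst \<tau> p) = subst (\<lambda>h. subst \<sigma> (\<tau> h)) p"
  by (induction p) simp_all

lemma subst_cong: "(\<And>h. h \<in> set (hl p) \<Longrightarrow> \<sigma> h = \<tau> h) \<Longrightarrow> subst \<sigma> p = subst \<tau> p"
  by (induction p) auto

lemma hl_subst: "hl (subst \<sigma> p) = concat (map (\<lambda>h. hl (\<sigma> h)) (hl p))"
  by (induction p) simp_all

lemma ok_hl_pos: "ok p \<Longrightarrow> 0 \<notin> set (hl p)"
  by (induction p) auto

lemma ok_subst:
  "ok p \<Longrightarrow> (\<And>h. h \<in> set (hl p) \<Longrightarrow> ok (\<sigma> h)) \<Longrightarrow>
    (\<And>h k. h \<in> set (hl p) \<Longrightarrow> k \<in> set (hl p) \<Longrightarrow> h \<noteq> k \<Longrightarrow> set (hl (\<sigma> h)) \<inter> set (hl (\<sigma> k)) = {}) \<Longrightarrow>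
    ok (subst \<sigma> p)"
proof (induction p)
  case (Bin p q)
  have "ok (subst \<sigma> p)" "ok (subst \<sigma> q)" using Bin by auto
  moreover have "subst \<sigma> q \<noteq> Hole h" for h using Bin.prems(1) by (cases q) auto
  moreover have "set (hl (subst \<sigma> p)) \<inter> set (hl (subst \<sigma> q)) = {}"
  proof -
    have "set (hl (\<sigma> h)) \<inter> set (hl (\<sigma> k)) = {}" if "h \<in> set (hl p)" "k \<in> set (hl q)" for h k
      using Bin.prems(1) Bin.prems(3)[of h k] that by auto
    then show ?thesis by (fastforce simp: hl_subst)
  qed
  ultimately show ?case by simp
qed auto

definition restr :: "(nat \<Rightarrow> 's dev) \<Rightarrow> nat set \<Rightarrow> nat \<Rightarrow> 's dev" where
  "restr f X = (\<lambda>h. if h \<in> X then f h else bot)"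

lemma restr_apply: "restr f X h x y \<longleftrightarrow> h \<in> X \<and> f h x y"
  by (simp add: restr_def)

definition two :: "'s dev \<Rightarrow> 's dev \<Rightarrow> nat \<Rightarrow> 's dev" where
  "two a b = (\<lambda>i. if i = 1 then a else if i = 2 then b else bot)"

lemma two_apply: "two a b i x y \<longleftrightarrow> i = 1 \<and> a x y \<or> i = 2 \<and> b x y"
  by (auto simp: two_def)

definition functional :: "'s dev \<Rightarrow> bool" where
  "functional a \<longleftrightarrow> (\<forall>x y z. a x y \<longrightarrow> a x z \<longrightarrow> y = z)"

lemma functionalD: "functional a \<Longrightarrow> a x y \<Longrightarrow> a x z \<Longrightarrow> y = z"
  unfolding functional_def by blast

lemma run_functional:
  assumes "run a b z y" "run a b z y'" "functional a" "\<And>h. functional (b h)"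
  shows "y = y'"
  using assms
proof (induction arbitrary: y' rule: run.induct)
  case (up_out x r)
  note f = functionalD[OF up_out.prems(2) up_out.hyps]
  from up_out.prems(1) show ?case by (rule run_InlE) (use f in blast)+
next
  case (up_in x h r y)
  note f = functionalD[OF up_in.prems(2) up_in.hyps(1)]
  from up_in.prems(1) show ?case
  proof (rule run_InlE)
    fix k q assume "a x (k, q)" "run a b (Inr (k, 0, q)) y'"
    then show "y = y'" using f[of "(k, q)"] up_in.IH up_in.prems by simp
  qed (use f up_in.hyps in blast)
next
  case (lo_out h x k r)
  note f = functionalD[OF lo_out.prems(3)[of h] lo_out.hyps(1)]
  from lo_out.prems(1) show ?case by (rule run_InrE) (use f lo_out.hyps(2) in blast)+
next
  case (lo_in h x r y)
  note f = functionalD[OF lo_in.prems(3)[of h] lo_in.hyps(1)]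
  from lo_in.prems(1) show ?case
  proof (rule run_InrE)
    fix q assume "b h x (0, q)" "run a b (Inl (h, q)) y'"
    then show "y = y'" using f[of "(0, q)"] lo_in.IH lo_in.prems by simp
  qed (use f in blast)
qed

text \<open>The third hypothesis concerns walks that enter from below: \<open>pcomp\<close>
  quantifies existentially over the lower device, so the port of entry has to determine it.\<close>

lemma pcomp_functional:
  assumes "functional a" "\<And>h. functional (b h)"
    and "\<And>h k x y z. 0 < fst x \<Longrightarrow> b h x y \<Longrightarrow> b k x z \<Longrightarrow> h = k"
  shows "functional (pcomp a b)"
  unfolding functional_def
proof (intro allI impI)
  fix x y z assume yz: "pcomp a b x y" "pcomp a b x z"
  show "y = z"
  proof (cases "fst x = 0")
    case True
    then show ?thesis using yz run_functional[OF _ _ assms(1,2)] by (simp add: pcomp_def)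
  next
    case False
    then obtain h k where hk: "run a b (Inr (h, x)) y" "run a b (Inr (k, x)) z"
      using yz by (auto simp: pcomp_def)
    then have "h = k" using assms(3)[of x h _ k] False unfolding run_Inr_iff by blast
    then show ?thesis using hk run_functional[OF hk(1) _ assms(1,2)] by simp
  qed
qed

section \<open>Behaviours of patterns for a fixed walking automaton\<close>

locale walker =
  fixes act :: "nat \<Rightarrow> child_number \<Rightarrow> 's \<Rightarrow> ('s \<times> direction) option" and S :: "'s set"
  assumes fin: "finite S"
    and closed: "q \<in> S \<Longrightarrow> act a c q = Some (q', d) \<Longrightarrow> q' \<in> S"
begin

text \<open>The identity between the root and port \<open>h\<close>. With states confined to
  \<open>S\<close> it is neutral for all devices that stay in \<open>S\<close>, and only finitely
  many behaviours exist for given holes.\<close>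

definition wire :: "nat \<Rightarrow> 's dev" where
  "wire h x y \<longleftrightarrow> snd x \<in> S \<and> snd y = snd x \<and> (fst x = 0 \<and> fst y = h \<or> fst x = h \<and> fst y = 0)"

definition leaf :: "nat \<Rightarrow> child_number \<Rightarrow> 's dev" where
  "leaf a c x y \<longleftrightarrow> fst x = 0 \<and> snd x \<in> S \<and> (\<exists>q. act a c (snd x) = Some (q, Parent) \<and> y = (0, q))"

text \<open>The next move depends on the state but not on the port of entry: a walk returning from a
  child acts like one that arrives from above in the same state.\<close>

definition node :: "child_number \<Rightarrow> 's dev" where
  "node c x y \<longleftrightarrow> fst x \<le> 2 \<and> snd x \<in> S \<and>
    (\<exists>q. act 0 c (snd x) = Some (q, Parent) \<and> y = (0, q) \<or>
      (\<exists>i \<in> {1, 2}. act 0 c (snd x) = Some (q, To_Child i) \<and> y = (i, q)))"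

primrec beh :: "pat \<Rightarrow> child_number \<Rightarrow> 's dev" where
  "beh (Hole h) c = wire h"
| "beh (Leaf a) c = leaf a c"
| "beh (Bin p q) c = pcomp (node c) (two (beh p (Child 1)) (beh q (Child 2)))"

lemma beh_ports: "beh p c x y \<Longrightarrow> fst x \<in> insert 0 (set (hl p)) \<and> fst y \<in> insert 0 (set (hl p)) \<and>
    snd x \<in> S \<and> snd y \<in> S"
proof (induction p arbitrary: c x y)
  case (Hole h)
  then show ?case by (auto simp: wire_def)
next
  case (Leaf a)
  then show ?case by (auto simp: leaf_def closed)
next
  case (Bin p q)
  let ?b = "two (beh p (Child 1)) (beh q (Child 2))"
  have b: "?b i x y \<Longrightarrow> fst x \<in> insert 0 (set (hl (Bin p q))) \<and> fst y \<in> insert 0 (set (hl (Bin p q)))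
     \<and> snd x \<in> S \<and> snd y \<in> S" for i x y
    using Bin.IH(1)[of "Child 1" x y] Bin.IH(2)[of "Child 2" x y] unfolding two_apply by auto
  have n: "snd x \<in> S \<and> snd y \<in> S" if "node c x y" for x y using that by (auto simp: node_def closed)
  have x: "fst x \<in> insert 0 (set (hl (Bin p q))) \<and> snd x \<in> S"
  proof (cases "fst x = 0")
    case True
    then obtain z where "node c x z" using Bin.prems unfolding beh.simps pcomp_def run_Inl_iff by auto
    then show ?thesis using n[of x z] True by simp
  next
    case False
    then obtain i where "run (node c) ?b (Inr (i, x)) y"
      using Bin.prems unfolding beh.simps pcomp_def by auto
    then have "\<exists>i z. ?b i x z" by (rule run_InrE) blast+
    then show ?thesis using b by blast
  qed
  obtain z where "run (node c) ?b z y" using Bin.prems unfolding beh.simps pcomp_def by metis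
  then have "fst y \<in> insert 0 (set (hl (Bin p q))) \<and> snd y \<in> S"
  proof (induction rule: run.induct)
    case (lo_out h x k r)
    then show ?case using b by blast
  qed (use n in fastforce)+
  then show ?case using x by blast
qed

lemma functional_wire: "functional (wire h)"
  by (auto simp: functional_def wire_def prod_eq_iff)

lemma functional_node: "functional (node c)"
  by (auto simp: functional_def node_def)

lemma functional_beh: "ok p \<Longrightarrow> functional (beh p c)"
proof (induction p arbitrary: c)
  case (Hole h)
  then show ?case by (simp add: functional_wire)
next
  case (Leaf a)
  then show ?case by (auto simp: functional_def leaf_def)
next
  case (Bin p q)
  show ?case unfolding beh.simps
  proof (rule pcomp_functional[OF functional_node])
    fix h
    show "functional (two (beh p (Child 1)) (beh q (Child 2)) h)"
      using Bin by (auto simp: two_def functional_def[of bot])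
  next
    fix h k x y z
    assume *: "0 < fst x" "two (beh p (Child 1)) (beh q (Child 2)) h x y"
      "two (beh p (Child 1)) (beh q (Child 2)) k x z"
    have "fst x \<notin> set (hl p) \<or> fst x \<notin> set (hl q)" using Bin.prems by auto
    then show "h = k" using * beh_ports[of p "Child 1" x y] beh_ports[of q "Child 2" x y]
        beh_ports[of p "Child 1" x z] beh_ports[of q "Child 2" x z]
      unfolding two_apply by auto
  qed
qed

lemma pcomp_wire:
  assumes "\<And>x y. b x y \<Longrightarrow> snd x \<in> S \<and> snd y \<in> S" and "0 < h"
  shows "pcomp (wire h) (restr (\<lambda>_. b) {h}) = b"
proof (intro ext)
  fix x y
  have W: "wire h (0, r) z \<longleftrightarrow> r \<in> S \<and> z = (h, r)" "wire h (h, r) z \<longleftrightarrow> r \<in> S \<and> z = (0, r)" for r z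
    using assms(2) by (auto simp: wire_def prod_eq_iff)
  have out: "run (wire h) f (Inl (h, r)) z \<longleftrightarrow> r \<in> S \<and> z = (0, r)" for r f z
    unfolding run_Inl_iff[of _ _ "(h, r)"] using assms(2) by (auto simp: W)
  have in_iff: "run (wire h) (restr (\<lambda>_. b) {h}) (Inr (k, x)) y \<longleftrightarrow> k = h \<and> b x y" for k x
  proof -
    have "run (wire h) (restr (\<lambda>_. b) {h}) (Inr (k, x)) y \<longleftrightarrow>
        k = h \<and> (b x y \<and> 0 < fst y \<or> (\<exists>r. b x (0, r) \<and> r \<in> S \<and> y = (0, r)))"
      unfolding run_Inr_iff[of _ _ k x] by (auto simp: restr_apply[of _ _ k] out)
    also have "\<dots> \<longleftrightarrow> k = h \<and> b x y"
      using assms(1)[of x y] by (cases y; cases "fst y = 0") auto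
    finally show ?thesis .
  qed
  show "pcomp (wire h) (restr (\<lambda>_. b) {h}) x y = b x y"
  proof (cases "fst x = 0")
    case True
    then have "pcomp (wire h) (restr (\<lambda>_. b) {h}) x y \<longleftrightarrow> run (wire h) (restr (\<lambda>_. b) {h}) (Inl (0, snd x)) y"
      unfolding pcomp_def by (metis prod.collapse)
    also have "\<dots> \<longleftrightarrow> snd x \<in> S \<and> b (0, snd x) y"
      unfolding run_Inl_iff[of "wire h"] using in_iff assms(2) by (auto simp: W)
    also have "\<dots> \<longleftrightarrow> b x y" using assms(1)[of x y] True by (metis prod.collapse)
    finally show ?thesis .
  qed (simp add: pcomp_def in_iff)
qed

lemma pcomp_closed:
  assumes "\<And>x y. a x y \<Longrightarrow> fst x = 0 \<and> fst y = 0"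
  shows "pcomp a (restr f {}) = a"
proof (intro ext)
  fix x y
  show "pcomp a (restr f {}) x y = a x y"
    unfolding pcomp_def run_Inl_iff[of _ _ x] run_Inr_iff[of _ _ _ x] run_Inr_iff[of _ _ _ "(0, _)"] restr_apply
    using assms[of x] by (cases y) (auto; metis fst_conv gr0I)
qed

text \<open>By \<open>pcomp_assoc\<close>, with the holes of the two children as \<open>Hs\<close>.
  What is plugged in is evaluated as a first child; \<open>ok\<close> ensures this position for
  every hole below a \<open>Bin\<close>, and the condition on \<open>c\<close> covers the pattern
  that is itself a hole.\<close>

theorem beh_subst:
  assumes "ok p" and "\<And>h. p = Hole h \<Longrightarrow> c = Child 1"
  shows "beh (subst \<sigma> p) c = pcomp (beh p c) (restr (\<lambda>h. beh (\<sigma> h) (Child 1)) (set (hl p)))"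
  using assms
proof (induction p arbitrary: c)
  case (Hole h)
  have "restr (\<lambda>h. beh (\<sigma> h) (Child 1)) {h} = restr (\<lambda>_. beh (\<sigma> h) (Child 1)) {h}"
    by (auto simp: restr_def)
  then show ?case using Hole pcomp_wire[of "beh (\<sigma> h) (Child 1)" h] beh_ports by simp
next
  case (Leaf a)
  have "pcomp (leaf a c) (restr (\<lambda>h. beh (\<sigma> h) (Child 1)) {}) = leaf a c"
    by (rule pcomp_closed) (auto simp: leaf_def)
  then show ?case by simp
next
  case (Bin p q)
  let ?f = "\<lambda>h. beh (\<sigma> h) (Child 1)"
  let ?b = "two (beh p (Child 1)) (beh q (Child 2))"
  define Hs where "Hs = (\<lambda>i::nat. if i = 1 then set (hl p) else if i = 2 then set (hl q) else {})"
  have "pcomp (node c) (\<lambda>i. pcomp (?b i) (restr ?f (Hs i))) =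
      pcomp (pcomp (node c) ?b) (restr ?f (set (hl (Bin p q))))"
  proof (rule pcomp_assoc[where Hs = Hs])
    fix i x y assume "?b i x y"
    then show "fst x \<in> insert 0 (Hs i) \<and> fst y \<in> insert 0 (Hs i)"
      using beh_ports[of p "Child 1" x y] beh_ports[of q "Child 2" x y]
      unfolding two_apply Hs_def by auto
  next
    fix h assume "\<And>i. h \<notin> Hs i"
    from this[of 1] this[of 2] show "restr ?f (set (hl (Bin p q))) h = bot"
      by (simp add: Hs_def restr_def)
  qed (use Bin.prems(1) ok_hl_pos[of p] ok_hl_pos[of q] in \<open>auto simp: Hs_def restr_def split: if_splits\<close>)
  moreover have "two (beh (subst \<sigma> p) (Child 1)) (beh (subst \<sigma> q) (Child 2)) =
      (\<lambda>i. pcomp (?b i) (restr ?f (Hs i)))"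
  proof
    fix i :: nat
    have "beh (subst \<sigma> p) (Child 1) = pcomp (beh p (Child 1)) (restr ?f (set (hl p)))"
      "beh (subst \<sigma> q) (Child 2) = pcomp (beh q (Child 2)) (restr ?f (set (hl q)))"
      using Bin by simp_all
    moreover have "pcomp bot (restr ?f {}) = (bot :: 's dev)"
      by (rule pcomp_closed) simp
    ultimately show "two (beh (subst \<sigma> p) (Child 1)) (beh (subst \<sigma> q) (Child 2)) i =
        pcomp (?b i) (restr ?f (Hs i))"
      by (simp add: Hs_def two_def)
  qed
  ultimately show ?case by simp
qed

end

section \<open>The two bracketings of a three-hole pattern\<close>

declare One_nat_def [simp del]

text \<open>The number of hole \<open>j\<close> after hole \<open>k\<close> has been filled and the
  later holes have moved down by one; port 0 stays.\<close>

definition skip :: "nat \<Rightarrow> nat \<Rightarrow> nat" where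
  "skip k j = (if j < k then j else j - 1)"

context walker
begin

lemma run_wire_in:
  assumes "f h = wire k" "0 < k"
  shows "run a f (Inr (h, 0, r)) y \<longleftrightarrow> r \<in> S \<and> y = (k, r)"
    and "run a f (Inr (h, k, r)) y \<longleftrightarrow> r \<in> S \<and> run a f (Inl (h, r)) y"
  unfolding run_Inr_iff[of _ _ h] using assms by (auto simp: wire_def prod_eq_iff)

lemma run_blank_in:
  assumes "f h = b" "\<And>x y. b x y \<Longrightarrow> fst x = 0 \<and> fst y = 0"
  shows "run a f (Inr (h, 0, r)) y \<longleftrightarrow> (\<exists>r'. b (0, r) (0, r') \<and> run a f (Inl (h, r')) y)"
  unfolding run_Inr_iff[of _ _ h] using assms(2)[of "(0, r)" y] assms(1) by auto

end

text \<open>These devices belong to a two-hole pattern \<open>D\<close>, an idempotent one-hole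
  pattern \<open>E\<close>, a blank tree \<open>B\<close>, and the bracketings
  \<open>D(D(1, 2), 3)\<close> and \<open>D(1, D(2, 3))\<close>. \<open>d_e'\<close> is the
  consequence of \<open>D(1, E(2)) = D\<close> for walks that bounce off \<open>E\<close>.\<close>

locale tripod = walker act S for act :: "nat \<Rightarrow> child_number \<Rightarrow> 's \<Rightarrow> ('s \<times> direction) option" and S +
  fixes d e b p p' :: "'s dev"
  assumes fun_d: "functional d" and fun_e: "functional e" and fun_b: "functional b"
    and fun_p: "functional p" and fun_p': "functional p'"
    and ports_d: "d x y \<Longrightarrow> fst x \<in> {0, 1, 2} \<and> fst y \<in> {0, 1, 2} \<and> snd x \<in> S \<and> snd y \<in> S"
    and ports_e: "e x y \<Longrightarrow> fst x \<in> {0, 1} \<and> fst y \<in> {0, 1} \<and> snd x \<in> S \<and> snd y \<in> S"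
    and ports_b: "b x y \<Longrightarrow> fst x = 0 \<and> fst y = 0 \<and> snd x \<in> S \<and> snd y \<in> S"
    and ports_p: "p x y \<Longrightarrow> fst x \<in> {0, 1, 2, 3} \<and> fst y \<in> {0, 1, 2, 3} \<and> snd x \<in> S \<and> snd y \<in> S"
    and ports_p': "p' x y \<Longrightarrow> fst x \<in> {0, 1, 2, 3} \<and> fst y \<in> {0, 1, 2, 3} \<and> snd x \<in> S \<and> snd y \<in> S"
    and e_right: "pcomp d (two (wire 1) b) = e"
    and e_left: "pcomp d (two b (wire 1)) = e"
    and b_eq: "pcomp d (two b b) = b"
    and d_e: "pcomp d (two e (wire 2)) = d"
    and d_e': "e (1, q) (1, q') \<Longrightarrow> d (2, q) (2, q')"
    and p_eq: "p = pcomp d (two d (wire 3))"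
    and p'_eq: "p' = pcomp d (two (wire 1) (pcomp d (two (wire 2) (wire 3))))"
    and fill: "k \<in> {1, 2, 3} \<Longrightarrow> pcomp p (\<lambda>h. if h = k then b else
      if h \<in> {1, 2, 3} then wire (skip k h) else bot) = d"
    and fill': "k \<in> {1, 2, 3} \<Longrightarrow> pcomp p' (\<lambda>h. if h = k then b else
      if h \<in> {1, 2, 3} then wire (skip k h) else bot) = d"
begin

text \<open>\<open>R2\<close> and \<open>R1\<close> follow a run in \<open>d\<close> with a blank tree plugged into port 2 resp. 1 (the other port
  is then called 1), \<open>RB\<close> with two blank trees, and \<open>RE\<close> with \<open>e\<close> plugged into port 1.
  \<open>Z2\<close>, \<open>Z1\<close> start at the moment when the blank tree is entered.\<close>

abbreviation "R2 x y \<equiv> run d (two (wire 1) b) (Inl x) y"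
abbreviation "R1 x y \<equiv> run d (two b (wire 1)) (Inl x) y"
abbreviation "RB x y \<equiv> run d (two b b) (Inl x) y"
abbreviation "RE x y \<equiv> run d (two e (wire 2)) (Inl x) y"
abbreviation "Z2 r y \<equiv> \<exists>r'. b (0, r) (0, r') \<and> R2 (2, r') y"
abbreviation "Z1 r y \<equiv> \<exists>r'. b (0, r) (0, r') \<and> R1 (1, r') y"

lemma two_1: "two f g 1 = f" and two_2: "two f g 2 = g"
  by (simp_all add: two_def)

lemma dD: "d x y \<Longrightarrow> d x z \<Longrightarrow> y = z" by (rule functionalD[OF fun_d])

lemma port_cases:
  assumes "d x (j, r)"
  obtains "j = 0" | "j = 1" | "j = 2"
  using ports_d[OF assms] by auto

lemma Inl_step:
  assumes "d x (j, r)"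
  shows "run d f (Inl x) y \<longleftrightarrow> (if j = 0 then y = (0, r) else run d f (Inr (j, 0, r)) y)"
proof
  assume "run d f (Inl x) y"
  then show "if j = 0 then y = (0, r) else run d f (Inr (j, 0, r)) y"
    by (rule run_InlE) (auto dest: dD[OF assms])
next
  assume "if j = 0 then y = (0, r) else run d f (Inr (j, 0, r)) y"
  then show "run d f (Inl x) y" using assms by (auto intro: run.intros split: if_splits)
qed

lemma Inl_dom: "run d f (Inl x) y \<Longrightarrow> \<exists>j r. d x (j, r)"
  by (erule run_InlE) blast+

lemma b_closed: "b x y \<Longrightarrow> fst x = 0 \<and> fst y = 0"
  using ports_b by blast

lemma R2_0: "d x (0, r) \<Longrightarrow> R2 x y \<longleftrightarrow> y = (0, r)"
  and R2_1: "d x (1, r) \<Longrightarrow> R2 x y \<longleftrightarrow> y = (1, r)"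
  and R2_2: "d x (2, r) \<Longrightarrow> R2 x y \<longleftrightarrow> Z2 r y"
  using ports_d[of x] run_wire_in(1)[of "two (wire 1) b" 1 1 d r y]
    run_blank_in[of "two (wire 1) b" 2 b d r y] b_closed
  by (auto simp: Inl_step two_1 two_2)

lemma R1_0: "d x (0, r) \<Longrightarrow> R1 x y \<longleftrightarrow> y = (0, r)"
  and R1_1: "d x (1, r) \<Longrightarrow> R1 x y \<longleftrightarrow> Z1 r y"
  and R1_2: "d x (2, r) \<Longrightarrow> R1 x y \<longleftrightarrow> y = (1, r)"
  using ports_d[of x] run_wire_in(1)[of "two b (wire 1)" 2 1 d r y]
    run_blank_in[of "two b (wire 1)" 1 b d r y] b_closed
  by (auto simp: Inl_step two_1 two_2)

lemma RB_1: "d x (1, r) \<Longrightarrow> RB x y \<longleftrightarrow> (\<exists>r'. b (0, r) (0, r') \<and> RB (1, r') y)"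
  and RB_2: "d x (2, r) \<Longrightarrow> RB x y \<longleftrightarrow> (\<exists>r'. b (0, r) (0, r') \<and> RB (2, r') y)"
  using run_blank_in[of "two b b" 1 b d r y] run_blank_in[of "two b b" 2 b d r y] b_closed
  by (auto simp: Inl_step two_1 two_2)

lemma e_R: "e (0, q) y \<longleftrightarrow> R2 (0, q) y" "e (0, q) y \<longleftrightarrow> R1 (0, q) y"
  using e_right[THEN fun_cong, THEN fun_cong, of "(0, q)" y]
    e_left[THEN fun_cong, THEN fun_cong, of "(0, q)" y]
  by (simp_all add: pcomp_def)

lemma e_up: "e (1, q) y \<longleftrightarrow> q \<in> S \<and> R2 (1, q) y" "e (1, q) y \<longleftrightarrow> q \<in> S \<and> R1 (2, q) y"
proof -
  have h1: "h = 1" if "run d (two (wire 1) b) (Inr (h, 1, q)) y" for h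
    using that by (rule run_InrE) (auto simp: two_apply dest: b_closed)
  have h2: "h = 2" if "run d (two b (wire 1)) (Inr (h, 1, q)) y" for h
    using that by (rule run_InrE) (auto simp: two_apply dest: b_closed)
  have "e (1, q) y \<longleftrightarrow> (\<exists>h. run d (two (wire 1) b) (Inr (h, 1, q)) y)"
    unfolding e_right[symmetric] by (simp add: pcomp_def)
  also have "\<dots> \<longleftrightarrow> run d (two (wire 1) b) (Inr (1, 1, q)) y"
    using h1 by metis
  finally show "e (1, q) y \<longleftrightarrow> q \<in> S \<and> R2 (1, q) y"
    using run_wire_in(2)[of "two (wire 1) b" 1 1 d q y] by (simp add: two_1)
  have "e (1, q) y \<longleftrightarrow> (\<exists>h. run d (two b (wire 1)) (Inr (h, 1, q)) y)"
    unfolding e_left[symmetric] by (simp add: pcomp_def)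
  also have "\<dots> \<longleftrightarrow> run d (two b (wire 1)) (Inr (2, 1, q)) y"
    using h2 by metis
  finally show "e (1, q) y \<longleftrightarrow> q \<in> S \<and> R1 (2, q) y"
    using run_wire_in(2)[of "two b (wire 1)" 2 1 d q y] by (simp add: two_2)
qed

lemma b_RB: "b (0, q) y \<longleftrightarrow> RB (0, q) y"
  using b_eq[THEN fun_cong, THEN fun_cong, of "(0, q)" y] by (simp add: pcomp_def)

lemma d_RE: "d (1, q) y \<longleftrightarrow> (\<exists>r. e (1, q) (1, r) \<and> y = (1, r)) \<or> (\<exists>r. e (1, q) (0, r) \<and> RE (1, r) y)"
  and d_RE2: "d (2, q) y \<longleftrightarrow> q \<in> S \<and> RE (2, q) y"
proof -
  have h1: "h = 1" if "run d (two e (wire 2)) (Inr (h, 1, q)) y" for h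
    using that by (rule run_InrE) (auto simp: two_apply wire_def)
  have h2: "h = 2" if "run d (two e (wire 2)) (Inr (h, 2, q)) y" for h
    using that by (rule run_InrE) (auto simp: two_apply dest: ports_e)
  have "d (1, q) y \<longleftrightarrow> (\<exists>h. run d (two e (wire 2)) (Inr (h, 1, q)) y)"
    using d_e[THEN fun_cong, THEN fun_cong, of "(1, q)" y] by (simp add: pcomp_def)
  also have "\<dots> \<longleftrightarrow> run d (two e (wire 2)) (Inr (1, 1, q)) y"
    using h1 by metis
  also have "\<dots> \<longleftrightarrow> (\<exists>r. e (1, q) (1, r) \<and> y = (1, r)) \<or> (\<exists>r. e (1, q) (0, r) \<and> RE (1, r) y)"
    using ports_e[of "(1, q)" y] by (cases y) (auto simp: run_Inr_iff[of _ _ _ "(1, q)"] two_apply)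
  finally show "d (1, q) y \<longleftrightarrow> (\<exists>r. e (1, q) (1, r) \<and> y = (1, r)) \<or> (\<exists>r. e (1, q) (0, r) \<and> RE (1, r) y)" .
  have "d (2, q) y \<longleftrightarrow> (\<exists>h. run d (two e (wire 2)) (Inr (h, 2, q)) y)"
    using d_e[THEN fun_cong, THEN fun_cong, of "(2, q)" y] by (simp add: pcomp_def)
  also have "\<dots> \<longleftrightarrow> run d (two e (wire 2)) (Inr (2, 2, q)) y"
    using h2 by metis
  finally show "d (2, q) y \<longleftrightarrow> q \<in> S \<and> RE (2, q) y"
    using run_wire_in(2)[of "two e (wire 2)" 2 2 d q y] by (simp add: two_2)
qed

lemma fun_wire_b: "functional (two (wire 1) b h)" "functional (two b (wire 1) h)"
  using fun_b functional_wire by (auto simp: two_def functional_def)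

lemma R1D: "R1 x y \<Longrightarrow> R1 x z \<Longrightarrow> y = z"
  by (rule run_functional[OF _ _ fun_d fun_wire_b(2)])

text \<open>\<open>e\<close> is \<open>d\<close> with one hole filled by \<open>b\<close>, and
  \<open>b\<close> is \<open>d\<close> with both filled. A walk from root to root never passes the
  open hole, since it would leave there; so filling that hole does not change it.\<close>

lemma b_of_e: "e (0, q) (0, r) \<Longrightarrow> b (0, q) (0, r)"
proof -
  have "run d (two b b) z y" if "run d (two (wire 1) b) z y" "fst y = 0"
    "\<forall>r. z \<noteq> Inr (1, 0, r)" "\<forall>r. z \<noteq> Inr (1, 1, r)" for z y
    using that
  proof (induction rule: run.induct)
    case (up_in x h r y)
    then have "h \<noteq> 1" using run_wire_in(1)[of "two (wire 1) b" 1 1 d r y] by (auto simp: two_1)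
    then show ?case using up_in by (auto intro: run.intros)
  next
    case (lo_in h x r y)
    then have "two b b h x (0, r)" by (cases x) (auto simp: two_apply wire_def)
    moreover have "run d (two b b) (Inl (h, r)) y" using lo_in by auto
    ultimately show ?case by (intro run.lo_in)
  qed (auto intro: run.intros)
  note * = this
  assume "e (0, q) (0, r)"
  then have "R2 (0, q) (0, r)" by (simp add: e_R(1))
  then have "RB (0, q) (0, r)" by (rule *) simp_all
  then show "b (0, q) (0, r)" by (simp add: b_RB)
qed

lemma RB_of_R1:
  assumes "R1 x (0, r)"
  shows "RB x (0, r)"
proof -
  have "run d (two b b) z y" if "run d (two b (wire 1)) z y" "fst y = 0"
    "\<forall>r. z \<noteq> Inr (2, 0, r)" "\<forall>r. z \<noteq> Inr (2, 1, r)" for z y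
    using that
  proof (induction rule: run.induct)
    case (up_in x h r y)
    then have "h \<noteq> 2" using run_wire_in(1)[of "two b (wire 1)" 2 1 d r y] by (auto simp: two_2)
    then show ?case using up_in by (auto intro: run.intros)
  next
    case (lo_in h x r y)
    then have "two b b h x (0, r)" by (cases x) (auto simp: two_apply wire_def)
    moreover have "run d (two b b) (Inl (h, r)) y" using lo_in by auto
    ultimately show ?case by (intro run.lo_in)
  qed (auto intro: run.intros)
  from this[OF assms] show ?thesis by simp
qed

text \<open>The walk that left through the open hole in state \<open>s\<close> goes on inside the
  blank tree which now fills this hole, and returns to \<open>d\<close> in state
  \<open>u\<close>.\<close>

lemma RB_of_R2:
  assumes "R2 x (1, s)" and "b (0, s) (0, u)" and "RB (1, u) y"
  shows "RB x y"
proof -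
  have "run d (two b b) z y" if "run d (two (wire 1) b) z w" "w = (1, s)"
    "\<forall>r. z \<noteq> Inr (1, 1, r)" for z w
    using that
  proof (induction rule: run.induct)
    case (up_in x h r w)
    then show ?case by (auto intro: run.intros)
  next
    case (lo_out h x k r)
    then have "h = 1" "wire 1 x (1, s)" using b_closed[of x "(1, s)"] by (auto simp: two_apply)
    then have "x = (0, s)" using lo_out.prems by (cases x) (auto simp: wire_def)
    then have "two b b h x (0, u)" using \<open>h = 1\<close> assms(2) by (simp add: two_1)
    moreover have "run d (two b b) (Inl (h, u)) y" using assms(3) \<open>h = 1\<close> by simp
    ultimately show ?case by (intro run.lo_in)
  next
    case (lo_in h x r w)
    then have "two b b h x (0, r)" by (cases x) (auto simp: two_apply wire_def)
    moreover have "run d (two b b) (Inl (h, r)) y" using lo_in by auto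
    ultimately show ?case by (intro run.lo_in)
  qed simp
  from this[OF assms(1)] show ?thesis by simp
qed

text \<open>Since the walk starts in \<open>d\<close> and ends at port 2, it makes only root-to-root
  excursions into \<open>e\<close>, and \<open>b_of_e\<close> lets the blank tree make the same
  ones.\<close>

lemma R1_of_RE:
  assumes "RE x (2, s)"
  shows "R1 x (1, s)"
proof -
  have "run d (two b (wire 1)) z (1, s)" if "run d (two e (wire 2)) z w" "w = (2, s)"
    "\<forall>h r k. z = Inr (h, k, r) \<longrightarrow> k = 0" for z w
    using that
  proof (induction rule: run.induct)
    case (up_in x h r w)
    then show ?case by (auto intro: run.intros)
  next
    case (lo_out h x k r)
    then have h: "h = 2" "wire 2 x (2, s)" using ports_e[of x "(2, s)"] by (auto simp: two_apply)
    then have "x = (0, s)" "s \<in> S" using lo_out.prems by (cases x; auto simp: wire_def)+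
    then have "two b (wire 1) h x (1, s)" using h(1) by (simp add: two_2 wire_def)
    then show ?case by (intro run.lo_out) simp_all
  next
    case (lo_in h x r w)
    then have "two e (wire 2) h x (0, r)" "fst x = 0" by (cases x; simp)+
    then have "two b (wire 1) h x (0, r)"
      using b_of_e[of "snd x" r] by (cases x) (auto simp: two_apply wire_def)
    moreover have "run d (two b (wire 1)) (Inl (h, r)) (1, s)" using lo_in by auto
    ultimately show ?case by (intro run.lo_in)
  qed simp
  from this[OF assms] show ?thesis by simp
qed

text \<open>A run that has entered \<open>e\<close> bounces off until it passes; a blank tree bounces it the same way.\<close>

lemma bounce:
  assumes "RE x (1, s)" and "d x (1, t)"
  obtains r where "e (0, r) (1, s)" and "\<And>y. Z1 t y \<longleftrightarrow> Z1 r y"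
proof -
  have "\<exists>r. e (0, r) (1, s) \<and>
      (\<forall>y. (case z of Inl x \<Rightarrow> R1 x y | Inr (h, x) \<Rightarrow> Z1 (snd x) y) \<longleftrightarrow> Z1 r y)"
    if "run d (two e (wire 2)) z w" "w = (1, s)" "\<forall>h x. z = Inr (h, x) \<longrightarrow> h = 1 \<and> fst x = 0" for z w
    using that
  proof (induction rule: run.induct)
    case (up_in x h r w)
    have "h = 1"
      using ports_d[OF up_in.hyps(1)] up_in.hyps(2,3) up_in.prems
        run_wire_in(1)[of "two e (wire 2)" 2 2 d r w] by (auto simp: two_2)
    then obtain r' where "e (0, r') (1, s)" "\<forall>y. Z1 r y \<longleftrightarrow> Z1 r' y" using up_in by auto
    moreover have "R1 x y \<longleftrightarrow> Z1 r y" for y using up_in.hyps(1) \<open>h = 1\<close> by (simp add: R1_1)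
    ultimately show ?case by auto
  next
    case (lo_out h x k r)
    then have "h = 1" "x = (0, snd x)" by (auto simp: prod_eq_iff)
    then have "e (0, snd x) (1, s)" using lo_out by (metis two_1)
    then show ?case by auto
  next
    case (lo_in h x r w)
    have "h = 1" "x = (0, snd x)" using lo_in by (auto simp: prod_eq_iff)
    then have "e (0, snd x) (0, r)" using lo_in.hyps(1) by (metis two_1)
    then have b: "b (0, snd x) (0, r)" by (rule b_of_e)
    have "u = r" if "b (0, snd x) (0, u)" for u using functionalD[OF fun_b that b] by simp
    then have "Z1 (snd x) y \<longleftrightarrow> R1 (1, r) y" for y using b by blast
    moreover obtain r' where "e (0, r') (1, s)" "\<forall>y. R1 (1, r) y \<longleftrightarrow> Z1 r' y"
      using lo_in \<open>h = 1\<close> by auto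
    ultimately show ?case by auto
  qed simp
  moreover have "run d (two e (wire 2)) (Inr (1, 0, t)) (1, s)"
    using assms by (simp add: Inl_step)
  ultimately have "\<exists>r. e (0, r) (1, s) \<and> (\<forall>y. Z1 t y \<longleftrightarrow> Z1 r y)" by fastforce
  then show thesis using that by blast
qed

lemma pass: "e (1, q) (1, r) \<Longrightarrow> d (1, q) (1, r)"
  by (simp add: d_RE)

text \<open>With hole 1 blank the second walk gives \<open>e (0, r) (1, s)\<close>. With hole 2
  blank, the same transition of \<open>e\<close> says that entering this blank tree in state
  \<open>s\<close> eventually leads out at port 1 in state \<open>s\<close>. Attached to the first
  walk this yields \<open>e (1, q) (1, s)\<close>, and by \<open>pass\<close> a second exit of
  \<open>d\<close> from \<open>(1, q)\<close>. \<open>not_through_1\<close> is the mirror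
  image.\<close>

lemma not_through_2:
  assumes "d (1, q) (2, s)" and "d (0, r) (2, s)"
  shows False
proof -
  have "q \<in> S" using ports_d[OF assms(1)] by simp
  have "e (0, r) (1, s)" using assms(2) by (simp add: e_R(2) R1_2)
  then have "Z2 s (1, s)" using assms(2) by (simp only: e_R(1) R2_2)
  then have "e (1, q) (1, s)" using assms(1) \<open>q \<in> S\<close> by (simp add: e_up(1) R2_2)
  then have "d (1, q) (1, s)" by (rule pass)
  then show False using dD[OF assms(1), of "(1, s)"] by simp
qed

lemma not_through_1:
  assumes "d (2, q) (1, s)" and "d (0, r) (1, s)"
  shows False
proof -
  have "q \<in> S" using ports_d[OF assms(1)] by simp
  have "e (0, r) (1, s)" using assms(2) by (simp add: e_R(1) R2_1)
  then have "Z1 s (1, s)" using assms(2) by (simp only: e_R(2) R1_1)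
  then have "e (1, q) (1, s)" using assms(1) \<open>q \<in> S\<close> by (simp add: e_up(2) R1_1)
  then have "d (2, q) (2, s)" by (rule d_e')
  then show False using dD[OF assms(1), of "(2, s)"] by simp
qed

text \<open>\<open>pass\<close> forbids \<open>e\<close> to bounce at \<open>(1, q)\<close>, so it
  reaches the root, in a state \<open>u\<close> from which \<open>RE\<close> leads to
  \<open>(2, s)\<close>. The walk from \<open>(2, q)\<close> leads to the same \<open>u\<close>,
  with hole 1 blank. \<open>bounce\<close> moves the situation to a state \<open>r\<close> in which
  \<open>b\<close> is entered from its root; computing \<open>b\<close> on \<open>r\<close> in two
  ways gives \<open>R1\<close> from \<open>(1, u)\<close> both to \<open>(0, u)\<close> and to
  \<open>(1, s)\<close>.\<close>

lemma not_both_siblings: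
  assumes "d (1, q) (2, s)" and "d (2, q) (1, t)"
  shows False
proof -
  have S: "q \<in> S" using ports_d[OF assms(1)] by simp
  have "\<not> e (1, q) (1, r)" for r using pass[of q r] dD[OF assms(1), of "(1, r)"] by auto
  moreover have "(\<exists>r. e (1, q) (1, r) \<and> (2 :: nat, s) = (1, r)) \<or> (\<exists>r. e (1, q) (0, r) \<and> RE (1, r) (2, s))"
    using assms(1) d_RE by metis
  ultimately obtain u where u: "e (1, q) (0, u)" "RE (1, u) (2, s)" by blast
  from u(1) have Z1t: "Z1 t (0, u)" using assms(2) by (simp add: e_up(2) R1_1)
  have "RE (2, q) (1, t)" using assms(2) by (simp add: d_RE2)
  then obtain r where r: "e (0, r) (1, t)" "\<And>y. Z1 t y \<longleftrightarrow> Z1 r y"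
    using bounce assms(2) by metis
  \<comment> \<open>\<open>e (0, r) (1, t)\<close> is read with either hole blank. Going to the root
    at once contradicts the exit at 1; going to hole 1 would make the continuation
    \<open>Z1 t\<close> end both at \<open>(1, t)\<close> and at \<open>(0, u)\<close>.\<close>
  have "d (0, r) (2, t) \<and> Z2 t (1, t)"
  proof -
    have R: "R2 (0, r) (1, t)" "R1 (0, r) (1, t)" using r(1) e_R by simp_all
    then obtain j w where jw: "d (0, r) (j, w)" using Inl_dom by blast
    then show ?thesis
    proof (rule port_cases)
      assume "j = 0" then show ?thesis using R(1) jw by (simp add: R2_0)
    next
      assume j: "j = 1"
      then have "w = t" using R(1) jw by (simp add: R2_1)
      then have "Z1 t (1, t)" using R(2) jw j by (simp add: R1_1)
      then obtain a where a: "b (0, t) (0, a)" "R1 (1, a) (1, t)" by blast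
      obtain c where c: "b (0, t) (0, c)" "R1 (1, c) (0, u)" using Z1t by blast
      have "a = c" using functionalD[OF fun_b a(1) c(1)] by simp
      then show ?thesis using R1D[OF a(2), of "(0, u)"] c(2) by simp
    next
      assume j: "j = 2"
      then have "w = t" using R(2) jw by (simp add: R1_2)
      then show ?thesis using R(1) jw j by (simp add: R2_2)
    qed
  qed
  then obtain a where d0: "d (0, r) (2, t)" and a: "b (0, t) (0, a)" "R2 (2, a) (1, t)" by blast
  obtain c where c: "b (0, t) (0, c)" "R1 (1, c) (0, u)" using Z1t by blast
  have "RB (2, a) (0, u)" using RB_of_R2[OF a(2) c(1) RB_of_R1[OF c(2)]] .
  then have "b (0, r) (0, u)" unfolding b_RB using d0 a(1) by (auto simp: RB_2)
  moreover obtain v where v: "b (0, r) (0, v)" "R1 (1, v) (0, u)" using Z1t r(2) by blast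
  ultimately have "v = u" using functionalD[OF fun_b] by blast
  then show False using R1D[OF v(2), of "(1, s)"] R1_of_RE[OF u(2)] \<open>v = u\<close> by simp
qed

section \<open>Comparing the bracketings after filling one hole\<close>

lemma skip_pos: "0 < k \<Longrightarrow> 0 < i \<Longrightarrow> i \<noteq> k \<Longrightarrow> 0 < skip k i"
  by (auto simp: skip_def)

lemma skip_inj: "i \<noteq> k \<Longrightarrow> j \<noteq> k \<Longrightarrow> skip k i = skip k j \<Longrightarrow> i = j"
  by (auto simp: skip_def split: if_splits)

abbreviation "fillers k \<equiv> (\<lambda>h. if h = k then b else if h \<in> {1, 2, 3} then wire (skip k h) else bot)"

text \<open>A single transition of \<open>P\<close> between ports other than \<open>k\<close> is
  unaffected by what fills hole \<open>k\<close>.\<close>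

lemma fill_exit:
  assumes P: "pcomp P (fillers k) = d" and k: "k \<in> {1, 2, 3}"
    and ports: "\<And>x y. P x y \<Longrightarrow> fst x \<in> {0, 1, 2, 3} \<and> fst y \<in> {0, 1, 2, 3} \<and> snd x \<in> S \<and> snd y \<in> S"
    and ij: "P (i, q) (j, r)" "i \<noteq> k" "j \<noteq> k"
  shows "d (skip k i, q) (skip k j, r)"
proof -
  have S: "i \<in> {0, 1, 2, 3}" "j \<in> {0, 1, 2, 3}" "q \<in> S" "r \<in> S" using ports[OF ij(1)] by auto
  have up: "run P (fillers k) (Inl (i, q)) (skip k j, r)"
  proof (cases "j = 0")
    case True
    then show ?thesis using ij(1) k by (auto simp: skip_def intro: run.intros)
  next
    case False
    then have "run P (fillers k) (Inr (j, 0, r)) (skip k j, r)"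
      using S k ij(3) skip_pos[of k j] by (intro run.lo_out) (auto simp: wire_def)
    then show ?thesis using False ij(1) by (intro run.up_in) auto
  qed
  have "pcomp P (fillers k) (skip k i, q) (skip k j, r)"
  proof (cases "i = 0")
    case True
    then show ?thesis using up k by (auto simp: pcomp_def skip_def)
  next
    case False
    then have "run P (fillers k) (Inr (i, skip k i, q)) (skip k j, r)"
      using S k ij(2) up by (intro run.lo_in[where r = q]) (auto simp: wire_def)
    then show ?thesis using False skip_pos[of k i] k ij(2) by (auto simp: pcomp_def)
  qed
  then show ?thesis using P by simp
qed

text \<open>Every walk of the filled pattern that enters at \<open>i\<close> begins with a
  transition of \<open>P\<close>. This transition may end in hole \<open>k\<close>, so only
  definedness can be concluded.\<close>

lemma fill_dom:
  assumes P: "pcomp P (fillers k) = d" and k: "k \<in> {1, 2, 3}" and ik: "i \<noteq> k"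
    and d: "d (skip k i, q) y"
  shows "\<exists>z. P (i, q) z"
proof (cases "i = 0")
  case True
  then have "run P (fillers k) (Inl (0, q)) y"
    using d k unfolding P[symmetric] pcomp_def by (auto simp: skip_def)
  then show ?thesis unfolding True by (rule run_InlE) blast+
next
  case False
  have i: "0 < skip k i" using skip_pos[of k i] False k ik by auto
  then obtain h where h: "run P (fillers k) (Inr (h, skip k i, q)) y"
    using d unfolding P[symmetric] pcomp_def by auto
  have *: "h = i \<and> z = (0, q)" if "fillers k h (skip k i, q) z" for z
  proof (cases "h = k")
    case True
    then show ?thesis using that b_closed[of "(skip k i, q)" z] i by auto
  next
    case False
    then have "wire (skip k h) (skip k i, q) z" using that by (auto split: if_splits)
    then show ?thesis using i skip_inj[OF ik False] by (auto simp: wire_def prod_eq_iff)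
  qed
  from h have "run P (fillers k) (Inl (i, q)) y" by (rule run_InrE) (use * in auto)
  then show ?thesis by (rule run_InlE) blast+
qed

lemma inner_p:
  assumes "d (k, q) (j, r)" "k \<in> {1, 2}" "j \<in> {1, 2}"
  shows "p (k, q) (j, r)"
proof -
  have "run d (two d (wire 3)) (Inr (1, k, q)) (j, r)"
    using assms by (intro run.lo_out) (auto simp: two_1)
  then show ?thesis using assms(2) unfolding p_eq pcomp_def by auto
qed

lemma inner_p':
  assumes "d (k, q) (j, r)" "k \<in> {1, 2}" "j \<in> {1, 2}"
  shows "p' (k + 1, q) (j + 1, r)"
proof -
  have S: "q \<in> S" "r \<in> S" using ports_d[OF assms(1)] by auto
  have w: "two (wire 2) (wire 3) k = wire (k + 1)" "two (wire 2) (wire 3) j = wire (j + 1)"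
    using assms(2,3) by (auto simp: two_def)
  have "run d (two (wire 2) (wire 3)) (Inr (j, 0, r)) (j + 1, r)"
    using S assms(3) by (intro run.lo_out) (auto simp: w wire_def)
  then have "run d (two (wire 2) (wire 3)) (Inl (k, q)) (j + 1, r)"
    using assms by (intro run.up_in) auto
  then have "run d (two (wire 2) (wire 3)) (Inr (k, k + 1, q)) (j + 1, r)"
    using S by (intro run.lo_in[where r = q]) (auto simp: w wire_def)
  then have "pcomp d (two (wire 2) (wire 3)) (k + 1, q) (j + 1, r)"
    by (auto simp: pcomp_def)
  then have "run d (two (wire 1) (pcomp d (two (wire 2) (wire 3)))) (Inr (2, k + 1, q)) (j + 1, r)"
    by (intro run.lo_out) (auto simp: two_2)
  then show ?thesis unfolding p'_eq by (subst pcomp_def) auto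
qed

text \<open>From hole 3 the walk starts outside the inner \<open>D\<close> of \<open>p\<close>,
  while port 1 belongs to that inner \<open>D\<close>; so its last visit there comes from above.
  \<open>exit_p'_3\<close> is the analogue for the other bracketing.\<close>

lemma exit_p_1:
  assumes "p (3, q) (1, s)"
  shows "\<exists>r. d (0, r) (1, s)"
proof -
  have "\<exists>r. d (0, r) (1, s)"
    if "run d (two d (wire 3)) z w" "w = (1, s)" "\<forall>h k r. z = Inr (h, k, r) \<longrightarrow> k = 0 \<or> k = 3" for z w
    using that
  proof (induction rule: run.induct)
    case (lo_out h x k r)
    then have "d x (1, s)" by (auto simp: two_apply wire_def)
    moreover have "fst x = 0" using lo_out ports_d[OF \<open>d x (1, s)\<close>] by (cases x) auto
    ultimately show ?case by (metis prod.collapse)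
  qed auto
  moreover obtain h where "run d (two d (wire 3)) (Inr (h, 3, q)) (1, s)"
    using assms unfolding p_eq pcomp_def by auto
  ultimately show ?thesis by fastforce
qed

lemma exit_p'_3:
  assumes "p' (1, q) (3, s)"
  shows "\<exists>r. d (0, r) (2, s)"
proof -
  let ?D = "pcomp d (two (wire 2) (wire 3))"
  have D: "d (0, r) (2, s)" if "?D (0, r) (3, s)" for r
  proof -
    from that have "run d (two (wire 2) (wire 3)) (Inl (0, r)) (3, s)" by (simp add: pcomp_def)
    moreover have "d x (2, s)" if "run d (two (wire 2) (wire 3)) (Inl x) (3, s)" for x
      using that
    proof (rule run_InlE)
      fix h r assume *: "d x (h, r)" "0 < h" "run d (two (wire 2) (wire 3)) (Inr (h, 0, r)) (3, s)"
      have "h = 1 \<or> h = 2" using ports_d[OF *(1)] *(2) by auto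
      then show "d x (2, s)"
      proof
        assume "h = 1"
        then show ?thesis using *(3) run_wire_in(1)[of "two (wire 2) (wire 3)" 1 2 d r "(3, s)"]
          by (simp add: two_1)
      next
        assume "h = 2"
        then show ?thesis using *(1,3) run_wire_in(1)[of "two (wire 2) (wire 3)" 2 3 d r "(3, s)"]
          by (simp add: two_2)
      qed
    qed simp
    ultimately show ?thesis by blast
  qed
  have no1: "\<not> ?D (1, r) y" for r y
  proof
    assume "?D (1, r) y"
    then obtain h where "run d (two (wire 2) (wire 3)) (Inr (h, 1, r)) y" by (auto simp: pcomp_def)
    then show False by (rule run_InrE) (auto simp: two_apply wire_def)
  qed
  have "\<exists>r. d (0, r) (2, s)"
    if "run d (two (wire 1) ?D) z w" "w = (3, s)" "\<forall>h k r. z = Inr (h, k, r) \<longrightarrow> k = 0 \<or> k = 1" for z w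
    using that
  proof (induction rule: run.induct)
    case (lo_out h x k r)
    then have *: "?D x (3, s)" by (auto simp: two_apply wire_def)
    moreover have "fst x = 0" using lo_out(3,4) no1 * by (cases x) auto
    ultimately show ?case using D by (metis prod.collapse)
  qed auto
  moreover obtain h where "run d (two (wire 1) ?D) (Inr (h, 1, q)) (3, s)"
    using assms unfolding p'_eq by (subst (asm) pcomp_def) auto
  ultimately show ?thesis by fastforce
qed

text \<open>If some hole \<open>k\<close> is neither the entry nor one of the exits, it is filled
  and both walks become walks of the deterministic \<open>d\<close>. Of the remaining six cases,
  entry at the middle hole is excluded by \<open>not_both_siblings\<close>. For entry at hole 1 or
  3, either \<open>not_through_2\<close> or \<open>not_through_1\<close> applies, or the filled walk
  is one between the holes of the inner \<open>D\<close>, which \<open>inner_p\<close> or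
  \<open>inner_p'\<close> turns into a second value of the same bracketing.\<close>

lemma agree:
  assumes p: "p (i, q) (j, r)" and p': "p' (i, q) (j', r')"
  shows "j = j' \<and> r = r'"
proof (cases "\<exists>k \<in> {1, 2, 3}. k \<noteq> i \<and> k \<noteq> j \<and> k \<noteq> j'")
  case True
  then obtain k where k: "k \<in> {1, 2, 3}" "k \<noteq> i" "k \<noteq> j" "k \<noteq> j'" by blast
  have "d (skip k i, q) (skip k j, r)" using fill_exit[OF fill[OF k(1)] k(1) ports_p p] k by blast
  moreover have "d (skip k i, q) (skip k j', r')"
    using fill_exit[OF fill'[OF k(1)] k(1) ports_p' p'] k by blast
  ultimately have "(skip k j, r) = (skip k j', r')" by (rule dD)
  then show ?thesis using skip_inj[of j k j'] k by simp
next
  case False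
  note ex = fill_exit[OF fill _ ports_p p] and ex' = fill_exit[OF fill' _ ports_p' p']
  have "(i, j, j') \<in> {(1, 2, 3), (1, 3, 2), (2, 1, 3), (2, 3, 1), (3, 1, 2), (3, 2, 1)}"
  proof -
    have "1 \<in> {i, j, j'}" "2 \<in> {i, j, j'}" "3 \<in> {i, j, j'}" using False by blast+
    then show ?thesis by (elim insertE emptyE) simp_all
  qed
  then consider "i = 1" "j = 2" "j' = 3" | "i = 1" "j = 3" "j' = 2" | "i = 2" "j = 1" "j' = 3"
    | "i = 2" "j = 3" "j' = 1" | "i = 3" "j = 1" "j' = 2" | "i = 3" "j = 2" "j' = 1" by auto
  then show ?thesis
  proof cases
    case 1
    then have "d (1, q) (2, r')" using ex'[of 2] by (simp add: skip_def)
    moreover obtain t where "d (0, t) (2, r')" using exit_p'_3 p' 1 by blast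
    ultimately show ?thesis using not_through_2 by blast
  next
    case 2
    then have "d (1, q) (2, r)" using ex[of 2] by (simp add: skip_def)
    then have "p (1, q) (2, r)" by (rule inner_p) auto
    then show ?thesis using functionalD[OF fun_p p, of "(2, r)"] 2 by simp
  next
    case 3
    then have "d (2, q) (1, r)" "d (1, q) (2, r')" using ex[of 3] ex'[of 1] by (simp_all add: skip_def One_nat_def)
    then show ?thesis using not_both_siblings by blast
  next
    case 4
    then have "d (1, q) (2, r)" "d (2, q) (1, r')" using ex[of 1] ex'[of 3] by (simp_all add: skip_def One_nat_def)
    then show ?thesis using not_both_siblings by blast
  next
    case 5
    then have "d (2, q) (1, r)" using ex[of 2] by (simp add: skip_def)
    moreover obtain t where "d (0, t) (1, r)" using exit_p_1 p 5 by blast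
    ultimately show ?thesis using not_through_1 by blast
  next
    case 6
    then have "d (2, q) (1, r')" using ex'[of 2] by (simp add: skip_def)
    then have "p' (2 + 1, q) (1 + 1, r')" by (rule inner_p') auto
    then have "p' (3, q) (2, r')" by simp
    then show ?thesis using functionalD[OF fun_p' p', of "(2, r')"] 6 by simp
  qed
qed

text \<open>Filling any of the three holes of \<open>p\<close> or of \<open>p'\<close> with a blank tree gives \<open>d\<close>. Hence \<open>p\<close> and \<open>p'\<close>
  agree unless the hole of entry, the exit of \<open>p\<close> and the exit of \<open>p'\<close> are the three holes 1, 2 and 3
  in some order.\<close>

theorem p_eq_p': "p = p'"
proof (intro ext iffI)
  fix x y assume xy: "p x y"
  obtain i q j r where [simp]: "x = (i, q)" "y = (j, r)" by (cases x, cases y)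
  have "\<exists>k \<in> {1, 2, 3}. k \<noteq> i \<and> k \<noteq> j" by simp presburger
  then obtain k where k: "k \<in> {1, 2, 3}" "k \<noteq> i" "k \<noteq> j" by blast
  have "d (skip k i, q) (skip k j, r)" using fill_exit[OF fill[OF k(1)] k(1) ports_p] xy k by simp
  from fill_dom[OF fill'[OF k(1)] k(1) k(2)[symmetric] this] obtain z where "p' (i, q) z" by blast
  then show "p' x y" using agree[of i q j r "fst z" "snd z"] xy by simp
next
  fix x y assume xy: "p' x y"
  obtain i q j r where [simp]: "x = (i, q)" "y = (j, r)" by (cases x, cases y)
  have "\<exists>k \<in> {1, 2, 3}. k \<noteq> i \<and> k \<noteq> j" by simp presburger
  then obtain k where k: "k \<in> {1, 2, 3}" "k \<noteq> i" "k \<noteq> j" by blast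
  have "d (skip k i, q) (skip k j, r)" using fill_exit[OF fill'[OF k(1)] k(1) ports_p'] xy k by simp
  from fill_dom[OF fill[OF k(1)] k(1) k(2)[symmetric] this] obtain z where "p (i, q) z" by blast
  then show "p x y" using agree[of i q "fst z" "snd z" j r] xy by (cases z) simp
qed

end

section \<open>Patterns with associative behaviour\<close>

locale finite_semigroup =
  fixes X :: "'a set" and mul :: "'a \<Rightarrow> 'a \<Rightarrow> 'a" (infixl "\<cdot>" 70)
  assumes fin_X: "finite X" and ne_X: "X \<noteq> {}"
    and mul_closed: "x \<in> X \<Longrightarrow> y \<in> X \<Longrightarrow> x \<cdot> y \<in> X"
    and mul_assoc: "x \<in> X \<Longrightarrow> y \<in> X \<Longrightarrow> z \<in> X \<Longrightarrow> (x \<cdot> y) \<cdot> z = x \<cdot> (y \<cdot> z)"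
begin

text \<open>Without a neutral element, \<open>pw a n\<close> is the power with exponent \<open>n + 1\<close>.\<close>

primrec pw :: "'a \<Rightarrow> nat \<Rightarrow> 'a" where
  "pw a 0 = a"
| "pw a (Suc n) = a \<cdot> pw a n"

lemma pw_closed: "a \<in> X \<Longrightarrow> pw a n \<in> X"
  by (induction n) (simp_all add: mul_closed)

lemma pw_add: "a \<in> X \<Longrightarrow> pw a m \<cdot> pw a n = pw a (Suc (m + n))"
  by (induction m) (simp_all add: mul_assoc pw_closed)

lemma idempotent_power:
  assumes "a \<in> X"
  obtains n where "pw a n \<cdot> pw a n = pw a n"
proof -
  have "\<not> inj (pw a)"
    using pw_closed[OF assms] fin_X
    by (metis finite_imageD finite_subset image_subsetI infinite_UNIV_nat)
  then obtain i j where ij: "i < j" "pw a i = pw a j"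
    by (metis injI linorder_neqE_nat)
  define p where "p = j - i"
  have p: "pw a (n + p) = pw a n" if "i \<le> n" for n
  proof (cases "n = i")
    case True
    then show ?thesis using ij by (simp add: p_def)
  next
    case False
    then have n: "n = Suc ((n - i - 1) + i)" "n + p = Suc ((n - i - 1) + j)"
      using that ij by (auto simp: p_def)
    have "pw a (n - i - 1) \<cdot> pw a i = pw a n" using pw_add[OF assms, of "n - i - 1" i] n(1) by simp
    moreover have "pw a (n - i - 1) \<cdot> pw a j = pw a (n + p)"
      using pw_add[OF assms, of "n - i - 1" j] n(2) by simp
    ultimately show ?thesis using ij(2) by simp
  qed
  have kp: "pw a (n + k * p) = pw a n" if "i \<le> n" for n k
  proof (induction k)
    case (Suc k)
    then show ?case using p[of "n + k * p"] that by (simp add: add.assoc add.commute[of p])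
  qed simp
  \<comment> \<open>\<open>pw a n\<close> has exponent \<open>n + 1\<close>, which is thus a
    multiple of the period \<open>p\<close>, with \<open>n\<close> beyond the preperiod
    \<open>i\<close>.\<close>
  define n where "n = Suc i * p - 1"
  have "0 < p" using ij by (simp add: p_def)
  then have n: "i \<le> n" "Suc n = Suc i * p"
    unfolding n_def by (cases p; simp)+
  have "Suc (n + n) = n + Suc i * p" using n(2) by simp
  then have "pw a n \<cdot> pw a n = pw a (n + Suc i * p)" using pw_add[OF assms, of n n] by metis
  then show thesis using that kp[OF n(1), of "Suc i"] by metis
qed

text \<open>Among the idempotents choose \<open>e\<close> with fewest elements of the form
  \<open>e a e\<close>. For such an element \<open>g\<close>, with idempotent power
  \<open>f\<close>, the set of all \<open>f a f\<close> is contained in that of \<open>e\<close>,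
  hence equal to it by minimality, and \<open>e = f\<close> follows. So every \<open>g\<close> has a
  power equal to \<open>e\<close>, and the set is a group with neutral element
  \<open>e\<close>.\<close>

lemma kernel_idempotent:
  "\<exists>e \<in> X. e \<cdot> e = e \<and> (\<forall>a \<in> X. \<exists>u \<in> X.
    u \<cdot> e = u \<and> u \<cdot> (e \<cdot> (a \<cdot> e)) = e \<and> (e \<cdot> (a \<cdot> e)) \<cdot> u = e)"
proof -
  define C where "C = (\<lambda>e. (\<lambda>a. e \<cdot> (a \<cdot> e)) ` X)"
  define I where "I = {e \<in> X. e \<cdot> e = e}"
  have "I \<noteq> {}"
  proof -
    obtain a where a: "a \<in> X" using ne_X by blast
    then obtain n where "pw a n \<cdot> pw a n = pw a n" by (rule idempotent_power)
    then show ?thesis using pw_closed[OF a] unfolding I_def by blast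
  qed
  moreover have "finite I" using fin_X by (simp add: I_def)
  ultimately have e: "arg_min_on (\<lambda>e. card (C e)) I \<in> I"
    "\<And>f. f \<in> I \<Longrightarrow> card (C (arg_min_on (\<lambda>e. card (C e)) I)) \<le> card (C f)"
    using arg_min_if_finite(1)[of I] arg_min_least[of I _ "\<lambda>e. card (C e)"] by simp_all
  define e where "e = arg_min_on (\<lambda>e. card (C e)) I"
  note e = e[folded e_def]
  have eX: "e \<in> X" and ee: "e \<cdot> e = e" using e(1) by (auto simp: I_def)
  have "\<exists>u \<in> X. u \<cdot> e = u \<and> u \<cdot> (e \<cdot> (a \<cdot> e)) = e \<and> (e \<cdot> (a \<cdot> e)) \<cdot> u = e" if a: "a \<in> X" for a
  proof -
    define g where "g = e \<cdot> (a \<cdot> e)"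
    have g: "g \<in> X" "e \<cdot> g = g" "g \<cdot> e = g"
      using a eX ee by (simp_all add: g_def mul_closed mul_assoc flip: mul_assoc[of e e])
    obtain m where m: "pw g m \<cdot> pw g m = pw g m" using g(1) by (rule idempotent_power)
    define f where "f = pw g m"
    have pe: "pw g n \<cdot> e = pw g n" "e \<cdot> pw g n = pw g n" for n
      using g eX by (induction n) (simp_all add: mul_assoc pw_closed flip: mul_assoc[of e])
    have f: "f \<in> X" "f \<cdot> f = f" "e \<cdot> f = f" "f \<cdot> e = f"
      using pw_closed[OF g(1)] m pe by (auto simp: f_def)
    have "C f \<subseteq> C e"
    proof
      fix x assume "x \<in> C f"
      then obtain c where c: "c \<in> X" "x = f \<cdot> (c \<cdot> f)" by (auto simp: C_def)
      have "e \<cdot> (x \<cdot> e) = x"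
        using c f eX by (simp add: mul_assoc mul_closed flip: mul_assoc[of e f])
      moreover have "x \<in> X" using c f by (simp add: mul_closed)
      ultimately show "x \<in> C e" unfolding C_def by (metis image_eqI)
    qed
    moreover have "card (C e) \<le> card (C f)" using e(2) f by (simp add: I_def)
    moreover have "finite (C e)" using fin_X by (simp add: C_def)
    ultimately have "C f = C e" by (metis card_seteq)
    moreover have "e \<in> C e" unfolding C_def using eX ee by (metis image_eqI)
    ultimately obtain c where "c \<in> X" "e = f \<cdot> (c \<cdot> f)" by (auto simp: C_def)
    then have "f \<cdot> e = e" using f by (simp add: mul_closed flip: mul_assoc)
    then have "e = pw g m" using f by (simp add: f_def)
    then have e2: "pw g (Suc (m + m)) = e" using pw_add[OF g(1), of m m] ee by simp
    then have "g \<cdot> pw g (m + m) = e" by simp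
    moreover have "pw g (m + m) \<cdot> g = e" using pw_add[OF g(1), of "m + m" 0] e2 by simp
    ultimately show ?thesis using pe pw_closed[OF g(1)] unfolding g_def[symmetric] by blast
  qed
  then show ?thesis using eX ee by blast
qed

end

section \<open>Blank patterns with prescribed holes\<close>

primrec blank :: "pat \<Rightarrow> bool" where
  "blank (Hole h) \<longleftrightarrow> True"
| "blank (Leaf a) \<longleftrightarrow> a = 1"
| "blank (Bin p q) \<longleftrightarrow> blank p \<and> blank q"

lemma blank_subst: "blank p \<Longrightarrow> (\<And>h. h \<in> set (hl p) \<Longrightarrow> blank (\<sigma> h)) \<Longrightarrow> blank (subst \<sigma> p)"
  by (induction p) auto

definition pats :: "nat list \<Rightarrow> pat set" where
  "pats hs = {p. ok p \<and> hl p = hs \<and> blank p}"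

definition plug1 :: "pat \<Rightarrow> pat \<Rightarrow> pat" where
  "plug1 p x = subst (\<lambda>_. x) p"

definition plug :: "pat \<Rightarrow> pat \<Rightarrow> pat \<Rightarrow> pat" where
  "plug p x y = subst (\<lambda>h. if h = 1 then x else y) p"

lemma subst_plug: "subst \<sigma> (plug p x y) = plug p (subst \<sigma> x) (subst \<sigma> y)"
  by (simp add: plug_def subst_subst if_distrib)

lemma subst_plug1: "subst \<sigma> (plug1 p x) = plug1 p (subst \<sigma> x)"
  by (simp add: plug1_def subst_subst)

lemma subst_pats0: "hl p = [] \<Longrightarrow> subst \<sigma> p = p"
  by (induction p) auto

lemma subst_pats1: "p \<in> pats [1] \<Longrightarrow> subst \<sigma> p = plug1 p (\<sigma> 1)"
  unfolding plug1_def pats_def by (rule subst_cong) simp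

lemma subst_pats2: "p \<in> pats [1, 2] \<Longrightarrow> subst \<sigma> p = plug p (\<sigma> 1) (\<sigma> 2)"
  unfolding plug_def pats_def by (rule subst_cong) auto

lemma subst_id: "(\<And>h. h \<in> set (hl p) \<Longrightarrow> \<sigma> h = Hole h) \<Longrightarrow> subst \<sigma> p = p"
  by (induction p) auto

lemma plug1_Hole: "p \<in> pats [1] \<Longrightarrow> plug1 p (Hole 1) = p"
  unfolding plug1_def pats_def by (rule subst_id) simp

lemma plug_Hole: "p \<in> pats [1, 2] \<Longrightarrow> plug p (Hole 1) (Hole 2) = p"
  unfolding plug_def pats_def by (rule subst_id) auto

lemma plug1_plug1: "plug1 (plug1 p x) y = plug1 p (plug1 x y)"
  unfolding plug1_def[of _ y] by (rule subst_plug1)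

lemma plug1_plug: "plug1 (plug p x z) y = plug p (plug1 x y) (plug1 z y)"
  unfolding plug1_def[of _ y] by (rule subst_plug)

lemma plug1_simps: "plug1 (Hole h) y = y" "hl p = [] \<Longrightarrow> plug1 p y = p"
  by (simp_all add: plug1_def subst_pats0)

lemma plug1_pats: "p \<in> pats [1] \<Longrightarrow> x \<in> pats hs \<Longrightarrow> plug1 p x \<in> pats hs"
  unfolding plug1_def pats_def
  by (auto simp: hl_subst intro!: ok_subst blank_subst)

lemma plug_pats: "p \<in> pats [1, 2] \<Longrightarrow> x \<in> pats hs \<Longrightarrow> y \<in> pats hs' \<Longrightarrow> set hs \<inter> set hs' = {} \<Longrightarrow>
    plug p x y \<in> pats (hs @ hs')"
  unfolding plug_def pats_def
  by (auto simp: hl_subst intro!: ok_subst blank_subst) blast+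

context walker
begin

abbreviation \<beta> :: "pat \<Rightarrow> 's dev" where "\<beta> p \<equiv> beh p (Child 1)"

lemma beh_subst_cong:
  assumes "ok p" "ok q" "hl p = hl q" "\<beta> p = \<beta> q"
    and "\<And>h. h \<in> set (hl p) \<Longrightarrow> \<beta> (\<sigma> h) = \<beta> (\<tau> h)"
  shows "\<beta> (subst \<sigma> p) = \<beta> (subst \<tau> q)"
proof -
  have "restr (\<lambda>h. \<beta> (\<sigma> h)) (set (hl p)) = restr (\<lambda>h. \<beta> (\<tau> h)) (set (hl q))"
    using assms(3,5) by (auto simp: restr_def)
  then show ?thesis using assms(1,2,4) by (simp add: beh_subst)
qed

lemma plug1_cong:
  "p \<in> pats [1] \<Longrightarrow> q \<in> pats [1] \<Longrightarrow> \<beta> p = \<beta> q \<Longrightarrow> \<beta> x = \<beta> y \<Longrightarrow> \<beta> (plug1 p x) = \<beta> (plug1 q y)"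
  unfolding plug1_def by (rule beh_subst_cong) (auto simp: pats_def)

lemma plug_cong:
  "p \<in> pats [1, 2] \<Longrightarrow> \<beta> x = \<beta> x' \<Longrightarrow> \<beta> y = \<beta> y' \<Longrightarrow> \<beta> (plug p x y) = \<beta> (plug p x' y')"
  unfolding plug_def by (rule beh_subst_cong) (auto simp: pats_def)

lemma beh_plug: "p \<in> pats [1, 2] \<Longrightarrow> \<beta> (plug p x y) = pcomp (\<beta> p) (two (\<beta> x) (\<beta> y))"
proof -
  assume p: "p \<in> pats [1, 2]"
  have "restr (\<lambda>h. \<beta> (if h = 1 then x else y)) {1, 2} = two (\<beta> x) (\<beta> y)"
    by (auto simp: restr_def two_def fun_eq_iff)
  then show ?thesis using p by (simp add: plug_def pats_def beh_subst)
qed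

definition comp1 :: "'s dev \<Rightarrow> 's dev \<Rightarrow> 's dev" where
  "comp1 a b = pcomp a (restr (\<lambda>_. b) {1})"

lemma beh_plug1: "p \<in> pats [1] \<Longrightarrow> \<beta> (plug1 p x) = comp1 (\<beta> p) (\<beta> x)"
  by (simp add: plug1_def pats_def beh_subst comp1_def)

lemma finite_beh: "finite (\<beta> ` {p. hl p = hs})"
proof -
  let ?F = "(insert 0 (set hs)) \<times> S"
  have "\<beta> ` {p. hl p = hs} \<subseteq> (\<lambda>R x y. (x, y) \<in> R) ` Pow (?F \<times> ?F)"
  proof
    fix r assume "r \<in> \<beta> ` {p. hl p = hs}"
    then obtain p where p: "hl p = hs" "r = \<beta> p" by blast
    have "{(x, y). r x y} \<subseteq> ?F \<times> ?F" using beh_ports[of p "Child 1"] p by fastforce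
    moreover have "r = (\<lambda>x y. (x, y) \<in> {(x, y). r x y})" by simp
    ultimately show "r \<in> (\<lambda>R x y. (x, y) \<in> R) ` Pow (?F \<times> ?F)" by blast
  qed
  moreover have "finite ((\<lambda>R x y. (x, y) \<in> R) ` Pow (?F \<times> ?F))" using fin by simp
  ultimately show ?thesis by (rule finite_subset)
qed

lemma semigroup_pats1: "finite_semigroup (\<beta> ` pats [1]) comp1"
proof
  show "finite (\<beta> ` pats [1])"
    using finite_beh[of "[1]"] by (rule rev_finite_subset) (auto simp: pats_def)
  have "Hole 1 \<in> pats [1]" by (simp add: pats_def)
  then show "\<beta> ` pats [1] \<noteq> {}" by blast
next
  fix x y assume "x \<in> \<beta> ` pats [1]" "y \<in> \<beta> ` pats [1]"
  then show "comp1 x y \<in> \<beta> ` pats [1]" using plug1_pats by (auto simp flip: beh_plug1)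
next
  fix x y z assume "x \<in> \<beta> ` pats [1]" "y \<in> \<beta> ` pats [1]" "z \<in> \<beta> ` pats [1]"
  then show "comp1 (comp1 x y) z = comp1 x (comp1 y z)"
    using plug1_pats by (auto simp: plug1_plug1 simp flip: beh_plug1)
qed

text \<open>Let \<open>e\<close> be an idempotent in the minimal ideal of the semigroup of one-hole patterns. Plugging the
  blank tree \<open>Z\<close> into either hole of the two-hole pattern \<open>D0\<close> gives elements of the group around \<open>e\<close>.
  With their inverses plugged into the holes, the result \<open>D\<close> becomes \<open>e\<close> when the blank tree \<open>B\<close> is plugged
  into either hole.\<close>

theorem ex_associative_pattern:
  "\<exists>D \<in> pats [1, 2]. \<forall>x y z. \<beta> (plug D (plug D x y) z) = \<beta> (plug D x (plug D y z))"
proof -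
  interpret finite_semigroup "\<beta> ` pats [1]" comp1 by (rule semigroup_pats1)
  obtain e where e: "e \<in> \<beta> ` pats [1]" "comp1 e e = e" "\<forall>a \<in> \<beta> ` pats [1]. \<exists>u \<in> \<beta> ` pats [1].
      comp1 u e = u \<and> comp1 u (comp1 e (comp1 a e)) = e \<and> comp1 (comp1 e (comp1 a e)) u = e"
    using kernel_idempotent by (elim bexE conjE)
  then obtain E where E: "E \<in> pats [1]" "\<beta> E = e" by blast
  have EE: "\<beta> (plug1 E (plug1 E x)) = \<beta> (plug1 E x)" for x
    using E e(2) plug1_cong[of "plug1 E E" E x x] plug1_pats[OF E(1) E(1)]
    by (simp add: plug1_plug1 beh_plug1)
  have ex: "\<exists>U \<in> pats [1]. (\<forall>x. \<beta> (plug1 U (plug1 E x)) = \<beta> (plug1 U x)) \<and>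
      (\<forall>x. \<beta> (plug1 U (plug1 E (plug1 A (plug1 E x)))) = \<beta> (plug1 E x)) \<and>
      (\<forall>x. \<beta> (plug1 E (plug1 A (plug1 E (plug1 U x)))) = \<beta> (plug1 E x))"
    if A: "A \<in> pats [1]" for A
  proof -
    obtain U where U: "U \<in> pats [1]" "comp1 (\<beta> U) e = \<beta> U"
      "comp1 (\<beta> U) (comp1 e (comp1 (\<beta> A) e)) = e" "comp1 (comp1 e (comp1 (\<beta> A) e)) (\<beta> U) = e"
      using e(3)[rule_format, of "\<beta> A"] A by blast
    note P = plug1_pats
    have "\<beta> (plug1 (plug1 U E) x) = \<beta> (plug1 U x)" for x
      using U E by (intro plug1_cong P) (simp_all add: beh_plug1)
    moreover have "\<beta> (plug1 (plug1 U (plug1 E (plug1 A E))) x) = \<beta> (plug1 E x)" for x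
      using U E A by (intro plug1_cong P) (simp_all add: beh_plug1 P)
    moreover have "\<beta> (plug1 (plug1 (plug1 E (plug1 A E)) U) x) = \<beta> (plug1 E x)" for x
      using U E A by (intro plug1_cong P) (simp_all add: beh_plug1 P)
    ultimately show ?thesis using U(1) unfolding plug1_plug1 by blast
  qed
  \<comment> \<open>A bare \<open>Bin (Hole 1) (Hole 2)\<close> would have a hole as second child;
    the additional blank leaves turn both holes into first children.\<close>
  define N where "N = Bin (Bin (Hole 1) (Leaf 1)) (Bin (Hole 2) (Leaf 1))"
  have H: "Hole 1 \<in> pats [1]" "Hole 2 \<in> pats [2]" by (simp_all add: pats_def)
  have N: "N \<in> pats [1, 2]" by (auto simp: N_def pats_def)
  define Z where "Z = plug1 E (Leaf 1)"
  have Z: "Z \<in> pats []" unfolding Z_def by (rule plug1_pats[OF E(1)]) (simp add: pats_def)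
  have EZ: "\<beta> (plug1 E Z) = \<beta> Z" unfolding Z_def by (rule EE)
  \<comment> \<open>With \<open>E\<close> at the root and at both holes, filling one hole by
    \<open>Z\<close> leaves an element of the form \<open>E l E\<close> or \<open>E r E\<close>, to
    which the group property applies.\<close>
  define D0 where "D0 = plug1 E (plug N E (plug1 E (Hole 2)))"
  have D0: "D0 \<in> pats [1, 2]"
    using plug1_pats[OF E(1) plug_pats[OF N E(1) plug1_pats[OF E(1) H(2)]]] by (simp add: D0_def)
  have D0_plug: "plug D0 x y = plug1 E (plug N (plug1 E x) (plug1 E y))" for x y
    unfolding D0_def plug_def[of _ x y] using subst_pats1[OF E(1)]
    by (simp add: subst_plug subst_plug1)
  define l where "l = plug N (Hole 1) (plug1 E Z)"
  define r where "r = plug N (plug1 E Z) (Hole 1)"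
  have lr: "l \<in> pats [1]" "r \<in> pats [1]"
    using plug_pats[OF N H(1) plug1_pats[OF E(1) Z]] plug_pats[OF N plug1_pats[OF E(1) Z] H(1)]
    by (simp_all add: l_def r_def)
  have closed_plug1: "plug1 Z x = Z" "plug1 (plug1 E Z) x = plug1 E Z" for x
    using Z plug1_pats[OF E(1) Z] by (simp_all add: pats_def plug1_simps)
  have D0_l: "plug D0 x Z = plug1 E (plug1 l (plug1 E x))" for x
    by (simp add: D0_plug l_def plug1_plug plug1_simps closed_plug1)
  have D0_r: "plug D0 Z x = plug1 E (plug1 r (plug1 E x))" for x
    by (simp add: D0_plug r_def plug1_plug plug1_simps closed_plug1)
  obtain U where U: "U \<in> pats [1]" "\<And>x. \<beta> (plug1 U (plug1 E x)) = \<beta> (plug1 U x)"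
    "\<And>x. \<beta> (plug1 U (plug1 E (plug1 l (plug1 E x)))) = \<beta> (plug1 E x)"
    "\<And>x. \<beta> (plug1 E (plug1 l (plug1 E (plug1 U x)))) = \<beta> (plug1 E x)"
    using ex[OF lr(1)] by blast
  obtain V where V: "V \<in> pats [1]" "\<And>x. \<beta> (plug1 V (plug1 E x)) = \<beta> (plug1 V x)"
    "\<And>x. \<beta> (plug1 V (plug1 E (plug1 r (plug1 E x)))) = \<beta> (plug1 E x)"
    "\<And>x. \<beta> (plug1 E (plug1 r (plug1 E (plug1 V x)))) = \<beta> (plug1 E x)"
    using ex[OF lr(2)] by blast
  define B where "B = plug D0 Z Z"
  have B: "B \<in> pats []" using plug_pats[OF D0 Z Z] by (simp add: B_def)
  define D where "D = plug D0 U (plug1 V (Hole 2))"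
  have D: "D \<in> pats [1, 2]"
    using plug_pats[OF D0 U(1) plug1_pats[OF V(1) H(2)]] by (simp add: D_def)
  have D_plug: "plug D x y = plug D0 (plug1 U x) (plug1 V y)" for x y
    unfolding D_def plug_def[of _ x y] using subst_pats1[OF U(1)]
    by (simp add: subst_plug subst_plug1)
  have c1: "\<beta> (plug1 E x) = \<beta> (plug1 E y)" if "\<beta> x = \<beta> y" for x y
    using E(1) that by (intro plug1_cong) auto
  \<comment> \<open>\<open>B\<close> is both \<open>E r E Z\<close> and \<open>E l E Z\<close>,
    being \<open>D0\<close> with \<open>Z\<close> in both holes; therefore either inverse takes it
    back to \<open>Z\<close>.\<close>
  have VB: "\<beta> (plug1 V B) = \<beta> Z" unfolding B_def D0_r using V(3)[of Z] EZ by simp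
  have UB: "\<beta> (plug1 U B) = \<beta> Z" unfolding B_def D0_l using U(3)[of Z] EZ by simp
  have EB: "\<beta> (plug1 E B) = \<beta> B" unfolding B_def D0_plug by (rule EE)
  have DxB: "\<beta> (plug D x B) = \<beta> (plug1 E x)" for x
    using plug_cong[OF D0 refl VB, of "plug1 U x"] U(4)[of x] by (simp add: D_plug D0_l)
  have DBx: "\<beta> (plug D B x) = \<beta> (plug1 E x)" for x
    using plug_cong[OF D0 UB refl, of "plug1 V x"] V(4)[of x] by (simp add: D_plug D0_r)
  have DEx: "\<beta> (plug D (plug1 E x) y) = \<beta> (plug D x y)" for x y
    unfolding D_plug by (rule plug_cong[OF D0 U(2) refl])
  have DxE: "\<beta> (plug D x (plug1 E y)) = \<beta> (plug D x y)" for x y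
    unfolding D_plug by (rule plug_cong[OF D0 refl V(2)])
  have ED: "\<beta> (plug1 E (plug D x y)) = \<beta> (plug D x y)" for x y
    unfolding D_plug D0_plug by (rule EE)
  define P where "P = plug D D (Hole 3)"
  define P' where "P' = plug D (Hole 1) (plug D (Hole 2) (Hole 3))"
  have H3: "Hole 3 \<in> pats [3]" by (simp add: pats_def)
  have P: "P \<in> pats [1, 2, 3]" using plug_pats[OF D D H3] by (simp add: P_def)
  have P': "P' \<in> pats [1, 2, 3]"
    using plug_pats[OF D H(1) plug_pats[OF D H(2) H3]] by (simp add: P'_def)
  have sP: "subst \<sigma> P = plug D (plug D (\<sigma> 1) (\<sigma> 2)) (\<sigma> 3)" for \<sigma>
    unfolding P_def subst_plug using subst_pats2[OF D] by simp
  have sP': "subst \<sigma> P' = plug D (\<sigma> 1) (plug D (\<sigma> 2) (\<sigma> 3))" for \<sigma>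
    unfolding P'_def subst_plug by simp
  have D12: "plug D (Hole 1) (Hole 2) = D" using D by (rule plug_Hole)
  have E1: "plug1 E (Hole 1) = E" using E(1) by (rule plug1_Hole)
  define fl where "fl = (\<lambda>k h. if h = k then B else Hole (skip k h))"
  have fl: "restr (\<lambda>h. \<beta> (fl k h)) {1, 2, 3} = (\<lambda>h. if h = k then \<beta> B else
      if h \<in> {1, 2, 3} then wire (skip k h) else bot)" if "k \<in> {1, 2, 3}" for k
    using that by (auto simp: restr_def fl_def fun_eq_iff)
  have fP: "\<beta> (subst (fl k) P) = \<beta> D" if "k \<in> {1, 2, 3}" for k
  proof -
    have "\<beta> (plug D (plug D B (Hole 1)) (Hole 2)) = \<beta> D"
      using plug_cong[OF D DBx refl, of "Hole 1" "Hole 2"] DEx[of "Hole 1" "Hole 2"] D12 by simp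
    moreover have "\<beta> (plug D (plug D (Hole 1) B) (Hole 2)) = \<beta> D"
      using plug_cong[OF D DxB refl, of "Hole 1" "Hole 2"] DEx[of "Hole 1" "Hole 2"] D12 by simp
    moreover have "\<beta> (plug D (plug D (Hole 1) (Hole 2)) B) = \<beta> D"
      using DxB[of D] ED[of "Hole 1" "Hole 2"] D12 by simp
    ultimately show ?thesis using that by (auto simp: sP fl_def skip_def One_nat_def)
  qed
  have fP': "\<beta> (subst (fl k) P') = \<beta> D" if "k \<in> {1, 2, 3}" for k
  proof -
    have "\<beta> (plug D B (plug D (Hole 1) (Hole 2))) = \<beta> D"
      using DBx[of D] ED[of "Hole 1" "Hole 2"] D12 by simp
    moreover have "\<beta> (plug D (Hole 1) (plug D B (Hole 2))) = \<beta> D"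
      using plug_cong[OF D refl DBx, of "Hole 1" "Hole 2"] DxE[of "Hole 1" "Hole 2"] D12 by simp
    moreover have "\<beta> (plug D (Hole 1) (plug D (Hole 2) B)) = \<beta> D"
      using plug_cong[OF D refl DxB, of "Hole 1" "Hole 2"] DxE[of "Hole 1" "Hole 2"] D12 by simp
    ultimately show ?thesis using that by (auto simp: sP' fl_def skip_def One_nat_def)
  qed
  have "tripod act S (\<beta> D) e (\<beta> B) (\<beta> P) (\<beta> P')"
  proof
    fix x y
    show "\<beta> D x y \<Longrightarrow> fst x \<in> {0, 1, 2} \<and> fst y \<in> {0, 1, 2} \<and> snd x \<in> S \<and> snd y \<in> S"
      using beh_ports[of D "Child 1" x y] D by (simp add: pats_def)
    show "e x y \<Longrightarrow> fst x \<in> {0, 1} \<and> fst y \<in> {0, 1} \<and> snd x \<in> S \<and> snd y \<in> S"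
      using beh_ports[of E "Child 1" x y] E by (simp add: pats_def)
    show "\<beta> B x y \<Longrightarrow> fst x = 0 \<and> fst y = 0 \<and> snd x \<in> S \<and> snd y \<in> S"
      using beh_ports[of B "Child 1" x y] B by (simp add: pats_def)
    show "\<beta> P x y \<Longrightarrow> fst x \<in> {0, 1, 2, 3} \<and> fst y \<in> {0, 1, 2, 3} \<and> snd x \<in> S \<and> snd y \<in> S"
      using beh_ports[of P "Child 1" x y] P by (simp add: pats_def)
    show "\<beta> P' x y \<Longrightarrow> fst x \<in> {0, 1, 2, 3} \<and> fst y \<in> {0, 1, 2, 3} \<and> snd x \<in> S \<and> snd y \<in> S"
      using beh_ports[of P' "Child 1" x y] P' by (simp add: pats_def)
  next
    show "functional (\<beta> D)" "functional e" "functional (\<beta> B)" "functional (\<beta> P)" "functional (\<beta> P')"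
      using functional_beh[of D] functional_beh[of E] functional_beh[of B] functional_beh[of P]
        functional_beh[of P'] D E B P P' by (auto simp: pats_def)
  next
    show "pcomp (\<beta> D) (two (wire 1) (\<beta> B)) = e"
      using beh_plug[OF D, of "Hole 1" B] DxB[of "Hole 1"] E E1 by simp
    show "pcomp (\<beta> D) (two (\<beta> B) (wire 1)) = e"
      using beh_plug[OF D, of B "Hole 1"] DBx[of "Hole 1"] E E1 by simp
    show "pcomp (\<beta> D) (two (\<beta> B) (\<beta> B)) = \<beta> B"
      using beh_plug[OF D, of B B] DBx[of B] EB by simp
    show "pcomp (\<beta> D) (two e (wire 2)) = \<beta> D"
      using beh_plug[OF D, of E "Hole 2"] DEx[of "Hole 1" "Hole 2"] E E1 D12 by simp
    show "\<beta> P = pcomp (\<beta> D) (two (\<beta> D) (wire 3))"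
      unfolding P_def using beh_plug[OF D, of D "Hole 3"] by simp
    show "\<beta> P' = pcomp (\<beta> D) (two (wire 1) (pcomp (\<beta> D) (two (wire 2) (wire 3))))"
      unfolding P'_def using beh_plug[OF D] by simp
  next
    fix k :: nat assume k: "k \<in> {1, 2, 3}"
    have "ok P" "hl P = [1, 2, 3]" "ok P'" "hl P' = [1, 2, 3]" using P P' by (simp_all add: pats_def)
    then show "pcomp (\<beta> P) (\<lambda>h. if h = k then \<beta> B else if h \<in> {1, 2, 3} then wire (skip k h) else bot) = \<beta> D"
      "pcomp (\<beta> P') (\<lambda>h. if h = k then \<beta> B else if h \<in> {1, 2, 3} then wire (skip k h) else bot) = \<beta> D"
      using fP[OF k] fP'[OF k] beh_subst[of P "Child 1" "fl k"] beh_subst[of P' "Child 1" "fl k"]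
      unfolding fl[OF k, symmetric] by simp_all
  next
    \<comment> \<open>A walk that \<open>E\<close> reflects at its hole is also reflected by
      \<open>D(1, E(2))\<close> at hole 2, and this pattern behaves like \<open>D\<close>.\<close>
    fix q q' assume eq: "e (1, q) (1, q')"
    have S: "q \<in> S" "q' \<in> S" using eq beh_ports[of E "Child 1" "(1, q)"] E(2) by auto
    let ?w = "restr (\<lambda>_. wire 2) {1 :: nat}"
    have "run e ?w (Inr (1, 0, q')) (2, q')"
      using S by (intro run.lo_out) (auto simp: restr_def wire_def)
    then have "run e ?w (Inl (1, q)) (2, q')" using eq by (intro run.up_in) auto
    then have "run e ?w (Inr (1, 2, q)) (2, q')"
      using S by (intro run.lo_in[where r = q]) (auto simp: restr_def wire_def)
    then have "\<beta> (plug1 E (Hole 2)) (2, q) (2, q')"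
      using E by (auto simp: beh_plug1 comp1_def pcomp_def)
    then have "run (\<beta> D) (two (wire 1) (\<beta> (plug1 E (Hole 2)))) (Inr (2, 2, q)) (2, q')"
      by (intro run.lo_out) (auto simp: two_def)
    then have "\<beta> (plug D (Hole 1) (plug1 E (Hole 2))) (2, q) (2, q')"
      using beh_plug[OF D, of "Hole 1" "plug1 E (Hole 2)"] by (auto simp: pcomp_def)
    then show "\<beta> D (2, q) (2, q')" using DxE[of "Hole 1" "Hole 2"] D12 by simp
  qed
  then have PP': "\<beta> P = \<beta> P'" by (rule tripod.p_eq_p')
  have "\<beta> (plug D (plug D x y) z) = \<beta> (plug D x (plug D y z))" for x y z
  proof -
    let ?\<sigma> = "\<lambda>h :: nat. if h = 1 then x else if h = 2 then y else z"
    have "\<beta> (subst ?\<sigma> P) = \<beta> (subst ?\<sigma> P')"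
      using P P' PP' by (intro beh_subst_cong) (auto simp: pats_def)
    then show ?thesis by (simp add: sP sP')
  qed
  then show ?thesis using D by blast
qed

end

section \<open>Tree-walking automata on binary trees\<close>

primrec tr :: "pat \<Rightarrow> nat tree" where
  "tr (Hole h) = Node 1 []"
| "tr (Leaf a) = Node a []"
| "tr (Bin p q) = Node 0 [tr p, tr q]"

primrec leaves :: "pat \<Rightarrow> nat list" where
  "leaves (Hole h) = []"
| "leaves (Leaf a) = [a]"
| "leaves (Bin p q) = leaves p @ leaves q"

abbreviation bin_alphabet :: "nat \<Rightarrow> nat ranked_alphabet" where
  "bin_alphabet k \<equiv> alphabet_of (2 # replicate k 0)"

lemma arity_bin_alphabet: "a \<in> letters (bin_alphabet k) \<Longrightarrow> arity (bin_alphabet k) a = (if a = 0 then 2 else 0)"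
  by (cases a) (auto simp: alphabet_of_def)

lemma letters_bin_alphabet: "letters (bin_alphabet k) = {..k}"
  by (auto simp: alphabet_of_def)

lemma subtree_at_append: "subtree_at t (v @ w) = subtree_at (subtree_at t v) w"
  by (induction t v rule: subtree_at.induct) simp_all

text \<open>Acceptance becomes an extra state \<open>None\<close> that climbs to the root, so that
  it too is an exit of a device; rejection is the absence of a move. Moves to foreign states are cut
  off to meet the closure condition of \<open>walker\<close> for all letters and child
  numbers.\<close>

definition act_of :: "('a, 'q) dtwa \<Rightarrow> 'a \<Rightarrow> child_number \<Rightarrow> 'q option \<Rightarrow> ('q option \<times> direction) option" where
  "act_of M a c x = (case x of None \<Rightarrow> Some (None, Parent) | Some q \<Rightarrow>
    (case dtwa_delta M a q c of Accept \<Rightarrow> Some (None, Parent) | Reject \<Rightarrow> None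
      | Move q' d \<Rightarrow> if q' \<in> dtwa_states M then Some (Some q', d) else None))"

locale binary_dtwa =
  fixes k :: nat and M :: "(nat, 'q) dtwa"
  assumes M: "dtwa (bin_alphabet k) M"
begin

abbreviation "states \<equiv> insert None (Some ` dtwa_states M)"

sublocale walker "act_of M" states
proof
  show "finite states" using M by (simp add: dtwa_def)
next
  fix q a c q' d assume "q \<in> states" "act_of M a c q = Some (q', d)"
  then show "q' \<in> states" by (auto simp: act_of_def split: option.splits command.splits if_splits)
qed

lemma beh_None: "act_of M a c None = Some (None, Parent)"
  by (simp add: act_of_def)

lemma closed_ports:
  assumes "hl p = []" "beh p c x y"
  shows "fst x = 0 \<and> fst y = 0 \<and> snd x \<in> states \<and> snd y \<in> states"
  using beh_ports[OF assms(2)] assms(1) by simp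

text \<open>\<open>leads t v x v' y\<close>: the walk that is at \<open>v\<close> in state \<open>x\<close> leaves \<open>v'\<close> upwards in state \<open>y\<close>,
  where \<open>None\<close> stands for acceptance.\<close>

definition leads :: "nat tree \<Rightarrow> node \<Rightarrow> 'q option \<Rightarrow> node \<Rightarrow> 'q option \<Rightarrow> bool" where
  "leads t v x v' y \<longleftrightarrow> (case x of None \<Rightarrow> y = None | Some q \<Rightarrow> (case y of
      None \<Rightarrow> \<exists>c. (dtwa_step M t)\<^sup>*\<^sup>* (q, v) c \<and> dtwa_command M t c = Accept
    | Some q' \<Rightarrow> \<exists>q1. (dtwa_step M t)\<^sup>*\<^sup>* (q, v) (q1, v') \<and> dtwa_command M t (q1, v') = Move q' Parent))"

lemma leads_trans:
  assumes "leads t (v @ [i]) x (v @ [i]) r" and "leads t v r v y"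
  shows "leads t (v @ [i]) x v y"
proof (cases x)
  case None
  then show ?thesis using assms by (simp add: leads_def)
next
  case (Some q)
  show ?thesis
  proof (cases r)
    case None
    then show ?thesis using assms Some by (simp add: leads_def)
  next
    case r: (Some q')
    then obtain q1 where q1: "(dtwa_step M t)\<^sup>*\<^sup>* (q, v @ [i]) (q1, v @ [i])"
      "dtwa_command M t (q1, v @ [i]) = Move q' Parent"
      using assms(1) Some by (auto simp: leads_def)
    have "dtwa_step M t (q1, v @ [i]) (q', v)" using to_parent[OF q1(2)] by simp
    with q1(1) have st: "(dtwa_step M t)\<^sup>*\<^sup>* (q, v @ [i]) (q', v)" by simp
    then show ?thesis using assms(2) r Some unfolding leads_def
      by (auto split: option.splits intro: rtranclp_trans[OF st])
  qed
qed

lemma leads_step: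
  assumes "(dtwa_step M t) (q, v) (q', v')" and "leads t v' (Some q') w y"
  shows "leads t v (Some q) w y"
  using assms unfolding leads_def by (auto split: option.splits intro: converse_rtranclp_into_rtranclp)

lemma act_of_Move: "act_of M a c (Some q) = Some (Some q', d) \<Longrightarrow> dtwa_delta M a q c = Move q' d"
  and act_of_Accept: "act_of M a c (Some q) = Some (None, d) \<Longrightarrow> dtwa_delta M a q c = Accept \<and> d = Parent"
  by (auto simp: act_of_def split: command.splits if_splits)

lemma leads_leave:
  assumes cmd: "\<And>q. dtwa_command M t (q, v) = dtwa_delta M a q c"
    and act: "act_of M a c x = Some (y, Parent)"
  shows "leads t v x v y"
proof (cases x)
  case None
  then show ?thesis using act by (simp add: leads_def beh_None)
next
  case (Some q)
  show ?thesis
  proof (cases y)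
    case None
    then have "dtwa_command M t (q, v) = Accept" using act Some act_of_Accept by (simp add: cmd)
    then show ?thesis using Some None unfolding leads_def by auto
  next
    case (Some q')
    then have "dtwa_command M t (q, v) = Move q' Parent"
      using act \<open>x = Some q\<close> act_of_Move by (simp add: cmd)
    then show ?thesis using Some \<open>x = Some q\<close> unfolding leads_def by auto
  qed
qed

lemma leads_of_beh:
  assumes "subtree_at t v = tr p" "hl p = []" "beh p (child_number_of v) (0, x) (0, y)"
  shows "leads t v x v y"
  using assms
proof (induction p arbitrary: v x y)
  case (Hole h)
  then show ?case by simp
next
  case (Leaf a)
  have cmd: "dtwa_command M t (q, v) = dtwa_delta M a q (child_number_of v)" for q
    using Leaf.prems(1) by (simp add: dtwa_command_def label_at_def)
  have "act_of M a (child_number_of v) x = Some (y, Parent)"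
    using Leaf.prems(3) by (auto simp: leaf_def)
  with cmd show ?case by (rule leads_leave)
next
  case (Bin p1 p2)
  define c where "c = child_number_of v"
  have cmd: "dtwa_command M t (q, v) = dtwa_delta M 0 q c" for q
    using Bin.prems(1) by (simp add: dtwa_command_def label_at_def c_def)
  have child: "leads t (v @ [i]) x' (v @ [i]) r"
    if two: "two (beh p1 (Child 1)) (beh p2 (Child 2)) i (0, x') (0, r)" for i x' r
  proof -
    consider "i = 1" "beh p1 (Child 1) (0, x') (0, r)" | "i = 2" "beh p2 (Child 2) (0, x') (0, r)"
      using two unfolding two_apply by blast
    then show ?thesis
    proof cases
      case 1
      then show ?thesis using Bin.IH(1)[of "v @ [1]" x' r] Bin.prems(1,2)
        by (simp add: subtree_at_append child_number_of_def)
    next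
      case 2
      then show ?thesis using Bin.IH(2)[of "v @ [2]" x' r] Bin.prems(1,2)
        by (simp add: subtree_at_append child_number_of_def)
    qed
  qed
  have "case z of Inl x' \<Rightarrow> leads t v (snd x') v (snd w)
      | Inr (i, x') \<Rightarrow> fst x' = 0 \<longrightarrow> leads t (v @ [i]) (snd x') v (snd w)"
    if "run (node c) (two (beh p1 (Child 1)) (beh p2 (Child 2))) z w" for z w
    using that
  proof (induction rule: run.induct)
    case (up_out x' r)
    then have "act_of M 0 c (snd x') = Some (r, Parent)" by (auto simp: node_def)
    with cmd have "leads t v (snd x') v r" by (rule leads_leave)
    then show ?case by simp
  next
    case (up_in x' i r w)
    then have a: "act_of M 0 c (snd x') = Some (r, To_Child i)" by (auto simp: node_def)
    then obtain q q' where q: "snd x' = Some q" "r = Some q'"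
      using act_of_Accept by (cases "snd x'"; cases r) (fastforce simp: beh_None)+
    then have "dtwa_step M t (q, v) (q', v @ [i])"
      using a by (intro to_child) (auto simp: cmd dest: act_of_Move)
    then show ?case using up_in.IH q leads_step by auto
  next
    case (lo_out i x' j r)
    then show ?case using closed_ports[of p1 "Child 1" x'] closed_ports[of p2 "Child 2" x'] Bin.prems(2)
      by (fastforce simp: two_apply)
  next
    case (lo_in i x' r w)
    have "leads t (v @ [i]) (snd x') v (snd w)" if "fst x' = 0"
      using leads_trans child[of i "snd x'" r] lo_in that by (cases x') fastforce
    then show ?case by simp
  qed
  then show ?case using Bin.prems(3) unfolding c_def by (fastforce simp: pcomp_def)
qed

lemma command_in:
  assumes "subtree_at t v = tr p" "set (leaves p) \<subseteq> {1..k}" "hl p = []" "q \<in> dtwa_states M"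
    and "child_number_of v \<in> {Root, Child 1, Child 2}"
  shows "dtwa_command M t (q, v) \<in> commands (dtwa_states M) (case p of Bin _ _ \<Rightarrow> 2 | _ \<Rightarrow> 0)"
proof -
  have 0: "0 \<in> letters (bin_alphabet k)" by (simp add: letters_bin_alphabet)
  have "Child i \<in> child_numbers (bin_alphabet k)" if "1 \<le> i" "i \<le> 2" for i
    using that arity_bin_alphabet[OF 0] unfolding child_numbers_def by (auto intro!: bexI[OF _ 0])
  moreover have "Root \<in> child_numbers (bin_alphabet k)" by (simp add: child_numbers_def)
  ultimately have "child_number_of v \<in> child_numbers (bin_alphabet k)" using assms(5) by auto
  moreover have "label_at t v = (case p of Leaf a \<Rightarrow> a | _ \<Rightarrow> 0)"
    using assms(1,3) by (cases p) (auto simp: label_at_def)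
  moreover have "(case p of Leaf a \<Rightarrow> a | _ \<Rightarrow> 0) \<in> letters (bin_alphabet k)"
    using assms(2) by (cases p) (auto simp: letters_bin_alphabet)
  ultimately have "dtwa_command M t (q, v) \<in>
      commands (dtwa_states M) (arity (bin_alphabet k) (case p of Leaf a \<Rightarrow> a | _ \<Rightarrow> 0))"
    using M assms(4) unfolding dtwa_def dtwa_command_def by auto
  moreover have "arity (bin_alphabet k) (case p of Leaf a \<Rightarrow> a | _ \<Rightarrow> 0) = (case p of Bin _ _ \<Rightarrow> 2 | _ \<Rightarrow> 0)"
    using assms(2,3) arity_bin_alphabet[of _ k] by (cases p) (auto simp: letters_bin_alphabet)
  ultimately show ?thesis by simp
qed

text \<open>Induction on the number of steps left until acceptance. Either the walk accepts below
  \<open>v\<close>, or it returns to the parent of \<open>v\<close> with fewer steps left; the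
  second alternative is what the parent needs in order to resume after a visit to a child.\<close>

lemma beh_of_steps:
  assumes "(dtwa_step M t ^^ n) (q, v) d" "dtwa_command M t d = Accept" "q \<in> dtwa_states M"
    "subtree_at t v = tr p" "set (leaves p) \<subseteq> {1..k}" "hl p = []"
    "child_number_of v \<in> {Root, Child 1, Child 2}"
  shows "beh p (child_number_of v) (0, Some q) (0, None) \<or>
    (\<exists>q' m. m < n \<and> v \<noteq> [] \<and> q' \<in> dtwa_states M \<and> (dtwa_step M t ^^ m) (q', butlast v) d \<and>
      beh p (child_number_of v) (0, Some q) (0, Some q'))"
  using assms
proof (induction n arbitrary: q v p rule: less_induct)
  case (less n)
  define c where "c = child_number_of v"
  define a where "a = label_at t v"
  have cmd: "dtwa_command M t (q, v) = dtwa_delta M a q c"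
    by (simp add: dtwa_command_def a_def c_def)
  have a: "a = (case p of Leaf a \<Rightarrow> a | _ \<Rightarrow> 0)"
    using less.prems(4,6) by (cases p) (auto simp: label_at_def a_def)
  note cin = command_in[OF less.prems(4,5,6,3,7), unfolded cmd]
  have out: "beh p c (0, Some q) (0, x)" if "act_of M a c (Some q) = Some (x, Parent)" for x
    using that less.prems(3,6) a
    by (cases p) (auto simp: leaf_def node_def pcomp_def intro!: run.up_out)
  show ?case
  proof (cases "dtwa_delta M a q c")
    case Accept
    then have "beh p c (0, Some q) (0, None)" by (intro out) (simp add: act_of_def)
    then show ?thesis by (simp add: c_def)
  next
    case Reject
    then have "\<not> dtwa_step M t (q, v) e" for e using cmd by (auto elim: dtwa_step.cases)
    then have "n = 0" using less.prems(1) by (metis not0_implies_Suc relpowp_Suc_D2)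
    then show ?thesis using less.prems(1,2) cmd Reject by simp
  next
    case (Move q' dir)
    have q': "q' \<in> dtwa_states M" using cin Move by (auto simp: commands_def)
    have act: "act_of M a c (Some q) = Some (Some q', dir)" using Move q' by (simp add: act_of_def)
    have "n \<noteq> 0" using less.prems(1,2) cmd Move by (metis command.distinct(3) relpowp_0_E)
    then obtain n' where n: "n = Suc n'" using not0_implies_Suc by blast
    then obtain e where e: "dtwa_step M t (q, v) e" "(dtwa_step M t ^^ n') e d"
      using less.prems(1) by (metis relpowp_Suc_D2)
    show ?thesis
    proof (cases dir)
      case Parent
      then have "v \<noteq> []" "e = (q', butlast v)" using e(1) cmd Move by (auto elim!: dtwa_step.cases)
      moreover have "beh p c (0, Some q) (0, Some q')" using act Parent by (intro out) simp
      ultimately show ?thesis using e(2) n q' unfolding c_def by blast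
    next
      case (To_Child i)
      then have e': "e = (q', v @ [i])" using e(1) cmd Move by (auto elim!: dtwa_step.cases)
      obtain p1 p2 where p: "p = Bin p1 p2" and i12: "1 \<le> i" "i \<le> 2"
        using cin Move To_Child by (cases p) (auto simp: commands_def)
      then have i: "i = 1 \<or> i = 2" by linarith
      let ?b = "two (beh p1 (Child 1)) (beh p2 (Child 2))"
      define pi where "pi = (if i = 1 then p1 else p2)"
      have bi: "?b i = beh pi (Child i)" using i by (auto simp: two_def pi_def)
      have cn: "child_number_of (v @ [i]) = Child i" by (simp add: child_number_of_def)
      have in_child: "beh p c (0, Some q) y" if "run (node c) ?b (Inr (i, 0, Some q')) y" for y
        using that act To_Child i less.prems(3) a unfolding p beh.simps pcomp_def
        by (auto intro!: run.up_in[of "node c" _ i "Some q'"] simp: node_def)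
      have "subtree_at t (v @ [i]) = tr pi"
        using less.prems(4) i by (auto simp: subtree_at_append p pi_def)
      moreover have "set (leaves pi) \<subseteq> {1..k}" "hl pi = []"
        using less.prems(5,6) by (auto simp: p pi_def)
      ultimately consider "beh pi (Child i) (0, Some q') (0, None)"
        | q'' m where "m < n'" "q'' \<in> dtwa_states M" "(dtwa_step M t ^^ m) (q'', v) d"
          "beh pi (Child i) (0, Some q') (0, Some q'')"
        using less.IH[of n' q' "v @ [i]" pi] n q' e(2) less.prems(2) i unfolding e' cn by auto
      then show ?thesis
      proof cases
        case 1
        have "run (node c) ?b (Inl (i, None)) (0, None)"
          using i by (intro run.up_out) (auto simp: node_def beh_None)
        then have "run (node c) ?b (Inr (i, 0, Some q')) (0, None)"
          using 1 bi by (intro run.lo_in[where r = None]) simp_all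
        then show ?thesis using in_child by (simp add: c_def)
      next
        case (2 q'' m)
        \<comment> \<open>Back from the child in state \<open>q''\<close>, the node acts as if
          entered from above in that state, so the induction hypothesis for the same
          \<open>v\<close> and fewer steps can be appended.\<close>
        have lift: "beh p c (0, Some q) y" if y: "beh p c (0, Some q'') y" for y
        proof -
          have "run (node c) ?b (Inl (0, Some q'')) y" using y by (simp add: p pcomp_def)
          moreover have "node c (0, Some q'') = node c (i, Some q'')"
            using i by (auto simp: node_def fun_eq_iff)
          ultimately have "run (node c) ?b (Inl (i, Some q'')) y" by (simp add: run_Inl_iff)
          then have "run (node c) ?b (Inr (i, 0, Some q')) y"
            using 2(4) bi by (intro run.lo_in[where r = "Some q''"]) simp_all
          then show ?thesis by (rule in_child)
        qed
        have "m < n" using 2(1) n by simp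
        from less.IH[OF this 2(3) less.prems(2) 2(2) less.prems(4-7)] lift \<open>m < n\<close>
        show ?thesis unfolding c_def[symmetric] by (meson less_trans)
      qed
    qed
  qed
qed

lemma accepts_iff:
  assumes "set (leaves p) \<subseteq> {1..k}" "hl p = []"
  shows "dtwa_accepts M (tr p) \<longleftrightarrow> beh p Root (0, Some (dtwa_init M)) (0, None)"
proof
  assume "dtwa_accepts M (tr p)"
  then obtain n d where "(dtwa_step M (tr p) ^^ n) (dtwa_init M, []) d" "dtwa_command M (tr p) d = Accept"
    unfolding dtwa_accepts_def by (metis rtranclp_imp_relpowp)
  then show "beh p Root (0, Some (dtwa_init M)) (0, None)"
    using beh_of_steps[of n "tr p" "dtwa_init M" "[]" d p] assms M
    by (auto simp: dtwa_def child_number_of_def)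
next
  assume "beh p Root (0, Some (dtwa_init M)) (0, None)"
  then have "leads (tr p) [] (Some (dtwa_init M)) [] None"
    using leads_of_beh[of "tr p" "[]" p] assms by (simp add: child_number_of_def)
  then show "dtwa_accepts M (tr p)" by (simp add: leads_def dtwa_accepts_def)
qed

end

section \<open>Replacing binary nodes by an associative pattern\<close>

primrec expand :: "pat \<Rightarrow> pat \<Rightarrow> pat" where
  "expand D (Hole h) = Hole h"
| "expand D (Leaf a) = Leaf a"
| "expand D (Bin p q) = plug D (expand D p) (expand D q)"

lemma hl_expand: "D \<in> pats [1, 2] \<Longrightarrow> hl p = [] \<Longrightarrow> hl (expand D p) = []"
  by (induction p) (auto simp: plug_def hl_subst pats_def)

lemma leaves_blank: "blank p \<Longrightarrow> set (leaves p) \<subseteq> {1}"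
  by (induction p) auto

lemma set_leaves_subst: "set (leaves (subst \<sigma> p)) \<subseteq> set (leaves p) \<union> (\<Union>h \<in> set (hl p). set (leaves (\<sigma> h)))"
  by (induction p) auto

lemma leaves_expand:
  "D \<in> pats [1, 2] \<Longrightarrow> hl p = [] \<Longrightarrow> set (leaves (expand D p)) \<subseteq> insert 1 (set (leaves p))"
proof (induction p)
  case (Bin p q)
  let ?\<sigma> = "\<lambda>h :: nat. if h = 1 then expand D p else expand D q"
  have "set (leaves (expand D (Bin p q))) \<subseteq> set (leaves D) \<union> (\<Union>h \<in> {1, 2}. set (leaves (?\<sigma> h)))"
    using set_leaves_subst[of ?\<sigma> D] Bin.prems(1) by (simp add: plug_def pats_def)
  also have "\<dots> \<subseteq> insert 1 (set (leaves (Bin p q)))"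
    using Bin leaves_blank[of D] by (auto simp: pats_def)
  finally show ?case .
qed auto

context walker
begin

text \<open>Under \<open>D\<close>, behaviours of closed patterns multiply associatively, so an
  expanded tree evaluates to the product of its leaves for any bracketing. \<open>m\<close> is an
  exponent for which the power of \<open>a\<close> is idempotent.\<close>

lemma ex_pumping:
  "\<exists>D \<in> pats [1, 2]. \<exists>m > 0. \<forall>s t w. hl s = [] \<longrightarrow> hl t = [] \<longrightarrow> leaves s = replicate m a @ w \<longrightarrow>
    leaves t = replicate (2 * m) a @ w \<longrightarrow> \<beta> (expand D s) = \<beta> (expand D t)"
proof -
  obtain D where D: "D \<in> pats [1, 2]"
    "\<And>x y z. \<beta> (plug D (plug D x y) z) = \<beta> (plug D x (plug D y z))"
    using ex_associative_pattern by blast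
  define mul where "mul = (\<lambda>x y. pcomp (\<beta> D) (two x y))"
  have mul: "mul (\<beta> x) (\<beta> y) = \<beta> (plug D x y)" for x y
    using beh_plug[OF D(1)] by (simp add: mul_def)
  let ?T = "\<beta> ` {p. hl p = []}"
  interpret T: finite_semigroup ?T mul
  proof
    show "finite ?T" by (rule finite_beh)
    have "Leaf 0 \<in> {p. hl p = []}" by simp
    then show "?T \<noteq> {}" by blast
  next
    fix x y assume "x \<in> ?T" "y \<in> ?T"
    then obtain p q where pq: "x = \<beta> p" "y = \<beta> q" "hl p = []" "hl q = []" by blast
    then have "hl (plug D p q) = []" using D(1) by (auto simp: plug_def hl_subst pats_def)
    then show "mul x y \<in> ?T" by (auto simp: pq mul)
  next
    fix x y z assume "x \<in> ?T" "y \<in> ?T" "z \<in> ?T"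
    then show "mul (mul x y) z = mul x (mul y z)" using D(2) by (auto simp: mul)
  qed
  \<comment> \<open>The fold starts from the last leaf since the semigroup may lack a neutral
    element.\<close>
  define prd where "prd = (\<lambda>xs :: nat list. foldr (\<lambda>a x. mul (\<beta> (Leaf a)) x) (butlast xs) (\<beta> (Leaf (last xs))))"
  have leafT: "\<beta> (Leaf b) \<in> ?T" for b by (rule imageI) simp
  have prd_single: "prd [b] = \<beta> (Leaf b)" for b by (simp add: prd_def)
  have prd_Cons: "prd (b # xs) = mul (\<beta> (Leaf b)) (prd xs)" if "xs \<noteq> []" for b xs
    using that by (simp add: prd_def)
  have prdT: "prd xs \<in> ?T" if "xs \<noteq> []" for xs
    using that
  proof (induction xs rule: list_nonempty_induct)
    case (single b)
    show ?case unfolding prd_single by (rule leafT)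
  next
    case (cons b xs)
    show ?case unfolding prd_Cons[OF cons(1)] by (rule T.mul_closed[OF leafT cons(2)])
  qed
  have prd_append: "prd (xs @ ys) = mul (prd xs) (prd ys)" if "xs \<noteq> []" "ys \<noteq> []" for xs ys
    using that
  proof (induction xs rule: list_nonempty_induct)
    case (single b)
    then show ?case by (simp add: prd_single prd_Cons)
  next
    case (cons b xs)
    then have "prd ((b # xs) @ ys) = mul (\<beta> (Leaf b)) (mul (prd xs) (prd ys))"
      by (simp add: prd_Cons)
    also have "\<dots> = mul (prd (b # xs)) (prd ys)"
      using T.mul_assoc[OF leafT prdT[OF cons(1)] prdT[OF that(2)]] by (simp add: prd_Cons[OF cons(1)])
    finally show ?case .
  qed
  have ne: "leaves p \<noteq> []" if "hl p = []" for p using that by (induction p) auto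
  have expand_prd: "\<beta> (expand D p) = prd (leaves p)" if "hl p = []" for p
    using that
  proof (induction p)
    case (Bin p q)
    then show ?case using ne by (simp add: prd_append flip: mul)
  qed (auto simp: prd_single)
  obtain n where n: "mul (T.pw (\<beta> (Leaf a)) n) (T.pw (\<beta> (Leaf a)) n) = T.pw (\<beta> (Leaf a)) n"
    using leafT by (rule T.idempotent_power)
  have pw: "prd (replicate (Suc j) a) = T.pw (\<beta> (Leaf a)) j" for j
    by (induction j) (simp_all add: prd_single prd_Cons)
  have two: "replicate (2 * Suc n) a = replicate (Suc n) a @ replicate (Suc n) a"
    by (metis mult_2 replicate_add)
  have "prd (replicate (2 * Suc n) a) = prd (replicate (Suc n) a)"
    unfolding two using prd_append[of "replicate (Suc n) a" "replicate (Suc n) a"] n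
    by (simp only: pw) simp
  then have "prd (replicate (2 * Suc n) a @ w) = prd (replicate (Suc n) a @ w)" for w
    by (cases "w = []") (simp_all add: prd_append del: replicate.simps)
  then have "\<beta> (expand D s) = \<beta> (expand D t)"
    if "hl s = []" "hl t = []" "leaves s = replicate (Suc n) a @ w" "leaves t = replicate (2 * Suc n) a @ w" for s t w
    using that expand_prd by metis
  then show ?thesis using D(1) zero_less_Suc by blast
qed

end

text \<open>The added root with a blank second child makes the expanded tree a first child, the only
  position for which associativity of \<open>D\<close> is known.\<close>

theorem dtwa_confused:
  fixes M :: "(nat, 'q) dtwa"
  assumes "dtwa (bin_alphabet k) M" and "1 \<le> k"
  shows "\<exists>D \<in> pats [1, 2]. \<exists>m > 0. \<forall>s t w. hl s = [] \<longrightarrow> hl t = [] \<longrightarrow> leaves s = replicate m a @ w \<longrightarrow>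
      leaves t = replicate (2 * m) a @ w \<longrightarrow> set (leaves s) \<subseteq> {1..k} \<longrightarrow>
      dtwa_accepts M (tr (Bin (expand D s) (Leaf 1))) = dtwa_accepts M (tr (Bin (expand D t) (Leaf 1)))"
proof -
  interpret binary_dtwa k M using assms(1) by unfold_locales
  obtain D m where Dm: "D \<in> pats [1, 2]" "0 < m"
    "\<And>s t w. hl s = [] \<Longrightarrow> hl t = [] \<Longrightarrow> leaves s = replicate m a @ w \<Longrightarrow>
      leaves t = replicate (2 * m) a @ w \<Longrightarrow> \<beta> (expand D s) = \<beta> (expand D t)"
    using ex_pumping by blast
  have "dtwa_accepts M (tr (Bin (expand D s) (Leaf 1))) = dtwa_accepts M (tr (Bin (expand D t) (Leaf 1)))"
    if st: "hl s = []" "hl t = []" "leaves s = replicate m a @ w" "leaves t = replicate (2 * m) a @ w"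
      "set (leaves s) \<subseteq> {1..k}" for s t w
  proof -
    have "set (leaves t) \<subseteq> {1..k}" using st(3-5) by auto
    then have "set (leaves (Bin (expand D s) (Leaf 1))) \<subseteq> {1..k}" "set (leaves (Bin (expand D t) (Leaf 1))) \<subseteq> {1..k}"
      using leaves_expand[OF Dm(1)] st(1,2,5) assms(2) by fastforce+
    moreover have "hl (Bin (expand D s) (Leaf 1)) = []" "hl (Bin (expand D t) (Leaf 1)) = []"
      using hl_expand[OF Dm(1)] st(1,2) by simp_all
    moreover have "beh (Bin (expand D s) (Leaf 1)) Root = beh (Bin (expand D t) (Leaf 1)) Root"
      using Dm(3)[OF st(1-4)] by simp
    ultimately show ?thesis using accepts_iff by metis
  qed
  then show ?thesis using Dm(1,2) by blast
qed

section \<open>Computable functions\<close>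

definition computable :: "nat \<Rightarrow> (nat list \<Rightarrow> nat) \<Rightarrow> bool" where
  "computable m f \<longleftrightarrow> (\<exists>r. \<forall>xs. length xs = m \<longrightarrow> evaluates r xs (f xs))"

lemma computable_cong: "(\<And>xs. length xs = m \<Longrightarrow> f xs = g xs) \<Longrightarrow> computable m g \<Longrightarrow> computable m f"
  by (auto simp: computable_def)

lemma computable_nth: "i < m \<Longrightarrow> computable m (\<lambda>xs. xs ! i)"
  unfolding computable_def by (rule exI[of _ "Proj i"]) (auto intro: evaluates.proj)

lemma computable_comp:
  assumes f: "computable (length gs) f" and gs: "\<And>g. g \<in> set gs \<Longrightarrow> computable m g"
  shows "computable m (\<lambda>xs. f (map (\<lambda>g. g xs) gs))"
proof -
  obtain r where r: "\<And>xs. length xs = length gs \<Longrightarrow> evaluates r xs (f xs)"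
    using f unfolding computable_def by blast
  have "\<forall>g \<in> set gs. \<exists>r. \<forall>xs. length xs = m \<longrightarrow> evaluates r xs (g xs)"
    using gs by (simp add: computable_def)
  then obtain R where R: "\<And>g xs. g \<in> set gs \<Longrightarrow> length xs = m \<Longrightarrow> evaluates (R g) xs (g xs)"
    by metis
  have "evaluates (Comp r (map R gs)) xs (f (map (\<lambda>g. g xs) gs))" if "length xs = m" for xs
  proof (rule evaluates.comp)
    show "list_all2 (\<lambda>g y. evaluates g xs y) (map R gs) (map (\<lambda>g. g xs) gs)"
      using R that by (simp add: list_all2_conv_all_nth)
    show "evaluates r (map (\<lambda>g. g xs) gs) (f (map (\<lambda>g. g xs) gs))" using r by simp
  qed
  then show ?thesis unfolding computable_def by blast
qed

lemma computable_Suc: "computable m f \<Longrightarrow> computable m (\<lambda>xs. Suc (f xs))"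
proof -
  assume f: "computable m f"
  have "computable 1 (\<lambda>xs. Suc (xs ! 0))" unfolding computable_def
  proof (intro exI[of _ Succ] allI impI)
    fix xs :: "nat list" assume "length xs = 1"
    then obtain x where "xs = [x]" by (auto simp: length_Suc_conv One_nat_def)
    then show "evaluates Succ xs (Suc (xs ! 0))" by (simp add: evaluates.succ)
  qed
  then show ?thesis using computable_comp[of "[f]" "\<lambda>xs. Suc (xs ! 0)" m] f by (simp add: One_nat_def)
qed

lemma computable_const: "computable m (\<lambda>_. c)"
proof (induction c)
  case 0
  then show ?case unfolding computable_def by (blast intro: evaluates.zero)
qed (rule computable_Suc)

lemma computable_drop:
  assumes "computable m f"
  shows "computable (m + n) (\<lambda>ys. f (drop n ys))"
proof (rule computable_cong)
  let ?gs = "map (\<lambda>i ys. ys ! (n + i)) [0..<m]"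
  show "computable (m + n) (\<lambda>ys. f (map (\<lambda>g. g ys) ?gs))"
    using assms by (intro computable_comp) (auto intro: computable_nth)
  fix ys :: "nat list" assume "length ys = m + n"
  then have "drop n ys = map (\<lambda>g. g ys) ?gs" by (intro nth_equalityI) auto
  then show "f (drop n ys) = f (map (\<lambda>g. g ys) ?gs)" by simp
qed

lemma computable_rec:
  assumes n: "computable m n" and z: "computable m z"
    and s: "computable (m + 2) (\<lambda>ys. s (ys ! 0) (ys ! 1) (drop 2 ys))"
  shows "computable m (\<lambda>xs. rec_nat (z xs) (\<lambda>k r. s k r xs) (n xs))"
proof -
  obtain rz where rz: "\<And>xs. length xs = m \<Longrightarrow> evaluates rz xs (z xs)"
    using z unfolding computable_def by blast
  obtain rs where rs: "\<And>ys. length ys = m + 2 \<Longrightarrow> evaluates rs ys (s (ys ! 0) (ys ! 1) (drop 2 ys))"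
    using s unfolding computable_def by blast
  have "evaluates (Prim_Rec rz rs) (k # xs) (rec_nat (z xs) (\<lambda>k r. s k r xs) k)"
    if "length xs = m" for k xs
  proof (induction k)
    case 0
    then show ?case using rz that by (auto intro: evaluates.intros)
  next
    case (Suc k)
    let ?r = "rec_nat (z xs) (\<lambda>k r. s k r xs) k"
    have "evaluates rs (k # ?r # xs) (s k ?r xs)"
      using rs[of "k # ?r # xs"] that by simp
    then show ?case using evaluates.prim_rec_Suc[OF Suc] by simp
  qed
  then have "\<forall>ys. length ys = Suc m \<longrightarrow> evaluates (Prim_Rec rz rs) ys
      (rec_nat (z (tl ys)) (\<lambda>k r. s k r (tl ys)) (hd ys))"
    by (auto simp: length_Suc_conv)
  then have "computable (Suc m) (\<lambda>ys. rec_nat (z (tl ys)) (\<lambda>k r. s k r (tl ys)) (hd ys))"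
    unfolding computable_def by blast
  then have "computable m (\<lambda>xs. (\<lambda>ys. rec_nat (z (tl ys)) (\<lambda>k r. s k r (tl ys)) (hd ys))
      (map (\<lambda>g. g xs) (n # map (\<lambda>i xs. xs ! i) [0..<m])))"
    using n by (intro computable_comp) (auto intro: computable_nth)
  then show ?thesis
  proof (rule computable_cong[rotated])
    fix xs :: "nat list" assume "length xs = m"
    then have "map ((\<lambda>g. g xs) \<circ> (\<lambda>i xs. xs ! i)) [0..<m] = xs" by (auto intro: nth_equalityI)
    then show "rec_nat (z xs) (\<lambda>k r. s k r xs) (n xs) = (\<lambda>ys. rec_nat (z (tl ys)) (\<lambda>k r. s k r (tl ys)) (hd ys))
      (map (\<lambda>g. g xs) (n # map (\<lambda>i xs. xs ! i) [0..<m]))" by simp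
  qed
qed

lemma computable_comp1:
  assumes "computable 1 (\<lambda>xs. F (xs ! 0))" "computable m f"
  shows "computable m (\<lambda>xs. F (f xs))"
  using computable_comp[of "[f]" "\<lambda>xs. F (xs ! 0)" m] assms by (simp add: One_nat_def)

lemma computable_add:
  assumes "computable m f" "computable m g"
  shows "computable m (\<lambda>xs. f xs + g xs)"
proof (rule computable_cong)
  show "computable m (\<lambda>xs. rec_nat (g xs) (\<lambda>k r. Suc r) (f xs))"
    using assms by (intro computable_rec computable_Suc computable_nth) simp_all
  have "a + b = rec_nat b (\<lambda>k r. Suc r) a" for a b by (induction a) simp_all
  then show "f xs + g xs = rec_nat (g xs) (\<lambda>k r. Suc r) (f xs)" for xs .
qed

lemma computable_minus:
  assumes "computable m f" "computable m g"
  shows "computable m (\<lambda>xs. f xs - g xs)"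
proof (rule computable_cong)
  have "computable 1 (\<lambda>xs. rec_nat 0 (\<lambda>k r. k) (xs ! 0))"
    by (intro computable_rec computable_const computable_nth) simp_all
  moreover have "rec_nat 0 (\<lambda>k r. k) a = a - 1" for a :: nat by (induction a) simp_all
  ultimately have pred: "computable 1 (\<lambda>xs. xs ! 0 - 1)" by simp
  show "computable m (\<lambda>xs. rec_nat (f xs) (\<lambda>k r. r - 1) (g xs))"
    using assms by (intro computable_rec computable_comp1[OF pred] computable_nth) simp_all
  have "a - b = rec_nat a (\<lambda>k r. r - 1) b" for a b :: nat by (induction b) auto
  then show "f xs - g xs = rec_nat (f xs) (\<lambda>k r. r - 1) (g xs)" for xs .
qed

lemma computable_mult:
  assumes "computable m f" "computable m g"
  shows "computable m (\<lambda>xs. f xs * g xs)"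
proof (rule computable_cong)
  show "computable m (\<lambda>xs. rec_nat 0 (\<lambda>k r. r + g xs) (f xs))"
    using assms by (intro computable_rec computable_const computable_add computable_nth computable_drop) simp_all
  have "a * b = rec_nat 0 (\<lambda>k r. r + b) a" for a b by (induction a) simp_all
  then show "f xs * g xs = rec_nat 0 (\<lambda>k r. r + g xs) (f xs)" for xs .
qed

definition decidable :: "nat \<Rightarrow> (nat list \<Rightarrow> bool) \<Rightarrow> bool" where
  "decidable m P \<longleftrightarrow> computable m (\<lambda>xs. if P xs then 1 else 0)"

lemma computable_if:
  assumes "decidable m P" "computable m f" "computable m g"
  shows "computable m (\<lambda>xs. if P xs then f xs else g xs)"
proof (rule computable_cong)
  show "computable m (\<lambda>xs. (if P xs then 1 else 0) * f xs + (1 - (if P xs then 1 else 0)) * g xs)"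
    using assms unfolding decidable_def
    by (intro computable_add computable_mult computable_minus computable_const)
qed simp

lemma decidable_eq:
  assumes "computable m f" "computable m g"
  shows "decidable m (\<lambda>xs. f xs = g xs)"
  unfolding decidable_def
proof (rule computable_cong)
  show "computable m (\<lambda>xs. 1 - ((f xs - g xs) + (g xs - f xs)))"
    using assms by (intro computable_add computable_minus computable_const)
qed auto

lemma decidable_less:
  assumes "computable m f" "computable m g"
  shows "decidable m (\<lambda>xs. f xs < g xs)"
  unfolding decidable_def
proof (rule computable_cong)
  show "computable m (\<lambda>xs. 1 - (Suc (f xs) - g xs))"
    using assms by (intro computable_minus computable_const computable_Suc)
qed auto

lemma decidable_not: "decidable m P \<Longrightarrow> decidable m (\<lambda>xs. \<not> P xs)"
  unfolding decidable_def[of _ "\<lambda>xs. \<not> P xs"]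
  by (rule computable_cong[OF _ computable_if[OF _ computable_const[of m 0] computable_const[of m 1]]]) auto

lemma decidable_conj: "decidable m P \<Longrightarrow> decidable m Q \<Longrightarrow> decidable m (\<lambda>xs. P xs \<and> Q xs)"
  unfolding decidable_def[of _ "\<lambda>xs. P xs \<and> Q xs"]
  by (rule computable_cong[OF _ computable_if[OF _ _ computable_const[of m 0], of P "\<lambda>xs. if Q xs then 1 else 0"]])
    (auto simp: decidable_def)

lemma decidable_disj: "decidable m P \<Longrightarrow> decidable m Q \<Longrightarrow> decidable m (\<lambda>xs. P xs \<or> Q xs)"
  unfolding decidable_def[of _ "\<lambda>xs. P xs \<or> Q xs"]
  by (rule computable_cong[OF _ computable_if[OF _ computable_const[of m 1], of P "\<lambda>xs. if Q xs then 1 else 0"]])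
    (auto simp: decidable_def)

lemma computable_pow2:
  assumes "computable m f"
  shows "computable m (\<lambda>xs. 2 ^ f xs)"
proof (rule computable_cong)
  show "computable m (\<lambda>xs. rec_nat 1 (\<lambda>k r. r + r) (f xs))"
    using assms by (intro computable_rec computable_const computable_add computable_nth) simp_all
  have "(2 :: nat) ^ a = rec_nat 1 (\<lambda>k r. r + r) a" for a by (induction a) simp_all
  then show "(2 :: nat) ^ f xs = rec_nat 1 (\<lambda>k r. r + r) (f xs)" for xs .
qed

lemma computable_div:
  assumes "computable m f" "computable m g"
  shows "computable m (\<lambda>xs. f xs div g xs)"
proof (rule computable_cong)
  \<comment> \<open>If \<open>r\<close> is the quotient for \<open>k\<close>, it grows exactly when
    \<open>k + 1\<close> reaches \<open>(r + 1) * b\<close>.\<close>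
  let ?s = "\<lambda>b k r. if Suc r * b < Suc (Suc k) then Suc r else r"
  show "computable m (\<lambda>xs. if g xs = 0 then 0 else rec_nat 0 (\<lambda>k r. ?s (g xs) k r) (f xs))"
    using assms
    by (intro computable_if decidable_eq computable_rec computable_const decidable_less computable_mult
      computable_Suc computable_drop computable_nth) simp_all
  have "a div b = rec_nat 0 (?s b) a" if "b \<noteq> 0" for a b
  proof (induction a)
    case (Suc a)
    have "Suc a div b = ?s b a (a div b)"
    proof (cases "Suc (a div b) * b < Suc (Suc a)")
      case True
      have "Suc a < Suc (Suc (a div b)) * b" using that dividend_less_div_times[of b a] by simp
      then have "Suc a div b = Suc (a div b)" using True that by (intro div_nat_eqI) (auto simp: algebra_simps)
      then show ?thesis using True by simp
    next
      case False
      have "a div b * b \<le> Suc a" by (rule order.trans[OF div_times_less_eq_dividend]) simp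
      then have "Suc a div b = a div b" using False that by (intro div_nat_eqI) (auto simp: algebra_simps)
      then show ?thesis using False by simp
    qed
    then show ?case using Suc by simp
  qed simp
  then show "f xs div g xs = (if g xs = 0 then 0 else rec_nat 0 (?s (g xs)) (f xs))" for xs by simp
qed

lemma computable_mod:
  assumes "computable m f" "computable m g"
  shows "computable m (\<lambda>xs. f xs mod g xs)"
proof (rule computable_cong)
  show "computable m (\<lambda>xs. f xs - g xs * (f xs div g xs))"
    using assms by (intro computable_minus computable_mult computable_div)
qed (simp add: minus_mult_div_eq_mod)

lemma computable_prod_encode:
  assumes "computable m f" "computable m g"
  shows "computable m (\<lambda>xs. prod_encode (f xs, g xs))"
  unfolding prod_encode_def triangle_def prod.case
  using assms by (intro computable_add computable_div computable_mult computable_Suc computable_const)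

text \<open>\<open>list_encode\<close> nests towards the end of the list, so the recursion builds
  the list from its end: stage \<open>k\<close> encodes the last \<open>k\<close> entries.\<close>

lemma computable_list_encode:
  assumes n: "computable m n" and g: "computable (Suc m) (\<lambda>ys. g (ys ! 0) (tl ys))"
  shows "computable m (\<lambda>xs. list_encode (map (\<lambda>i. g i xs) [0..<n xs]))"
proof (rule computable_cong)
  let ?s = "\<lambda>k r xs. Suc (prod_encode (g (n xs - Suc k) xs, r))"
  let ?gs = "(\<lambda>ys. n (drop 2 ys) - Suc (ys ! 0)) # map (\<lambda>i ys. ys ! (2 + i)) [0..<m]"
  have "computable (m + 2) (\<lambda>ys. n (drop 2 ys) - Suc (ys ! 0))"
    using n by (intro computable_minus computable_Suc computable_nth computable_drop) simp_all
  then have "computable (m + 2) (\<lambda>ys. (\<lambda>ys. g (ys ! 0) (tl ys)) (map (\<lambda>f. f ys) ?gs))"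
    using g by (intro computable_comp) (auto intro: computable_nth)
  then have "computable (m + 2) (\<lambda>ys. g (n (drop 2 ys) - Suc (ys ! 0)) (drop 2 ys))"
  proof (rule computable_cong[rotated])
    fix ys :: "nat list" assume "length ys = m + 2"
    then have "map (\<lambda>f. f ys) ?gs = (n (drop 2 ys) - Suc (ys ! 0)) # drop 2 ys"
      by (auto intro!: nth_equalityI)
    then show "g (n (drop 2 ys) - Suc (ys ! 0)) (drop 2 ys) = (\<lambda>ys. g (ys ! 0) (tl ys)) (map (\<lambda>f. f ys) ?gs)"
      by simp
  qed
  then show "computable m (\<lambda>xs. rec_nat 0 (\<lambda>k r. ?s k r xs) (n xs))"
    using n by (intro computable_rec computable_const computable_Suc computable_prod_encode computable_nth) simp_all
  fix xs
  have "list_encode (map h [N - k..<N]) = rec_nat 0 (\<lambda>k r. Suc (prod_encode (h (N - Suc k), r))) k"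
    if "k \<le> N" for k N and h :: "nat \<Rightarrow> nat"
    using that
  proof (induction k)
    case (Suc k)
    then have "[N - Suc k..<N] = (N - Suc k) # [N - k..<N]"
      using upt_conv_Cons[of "N - Suc k" N] by (simp add: Suc_diff_Suc)
    then show ?case using Suc by simp
  qed simp
  from this[of "n xs" "n xs"] show "list_encode (map (\<lambda>i. g i xs) [0..<n xs]) =
      rec_nat 0 (\<lambda>k r. ?s k r xs) (n xs)" by simp
qed

lemma decidable_set_decode:
  assumes "computable m f" "computable m g"
  shows "decidable m (\<lambda>xs. f xs \<in> set_decode (g xs))"
proof -
  have "x \<in> set_decode n \<longleftrightarrow> \<not> (n div 2 ^ x) mod 2 = 0" for x n
    by (simp add: set_decode_def even_iff_mod_2_eq_zero)
  then show ?thesis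
    using assms by (simp only:) (intro decidable_not decidable_eq computable_mod computable_div
      computable_pow2 computable_const)
qed

lemmas computable_intros = computable_const computable_Suc computable_add computable_minus computable_mult
  computable_if computable_div computable_mod computable_prod_encode
  decidable_eq decidable_less decidable_not decidable_conj decidable_disj decidable_set_decode

section \<open>Register programs\<close>

declare One_nat_def [simp]

datatype instr = Inc nat | Loop nat "instr list"

text \<open>\<open>Loop r C\<close> stands for: while register \<open>r\<close> is positive, decrement it and run \<open>C\<close>.\<close>

fun exec :: "instr list \<times> (nat \<Rightarrow> nat) \<Rightarrow> instr list \<times> (nat \<Rightarrow> nat)" where
  "exec ([], \<sigma>) = ([], \<sigma>)"
| "exec (Inc r # K, \<sigma>) = (K, \<sigma>(r := Suc (\<sigma> r)))"
| "exec (Loop r C # K, \<sigma>) = (if \<sigma> r = 0 then (K, \<sigma>) else (C @ Loop r C # K, \<sigma>(r := \<sigma> r - 1)))"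

text \<open>Quantifying over the rest \<open>K\<close> makes this notion compositional:
  \<open>P\<close> is executed in front of any rest and must leave precisely that rest.\<close>

definition runs :: "instr list \<Rightarrow> (nat \<Rightarrow> nat) \<Rightarrow> (nat \<Rightarrow> nat) \<Rightarrow> bool" where
  "runs P \<sigma> \<sigma>' \<longleftrightarrow> (\<forall>K. \<exists>n. (exec ^^ n) (P @ K, \<sigma>) = (K, \<sigma>'))"

lemma runs_Nil: "runs [] \<sigma> \<sigma>"
  unfolding runs_def by (auto intro: exI[of _ 0])

lemma runs_append:
  assumes "runs P \<sigma> \<sigma>1" "runs Q \<sigma>1 \<sigma>2"
  shows "runs (P @ Q) \<sigma> \<sigma>2"
  unfolding runs_def
proof
  fix K
  obtain m n where "(exec ^^ m) (P @ (Q @ K), \<sigma>) = (Q @ K, \<sigma>1)" "(exec ^^ n) (Q @ K, \<sigma>1) = (K, \<sigma>2)"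
    using assms unfolding runs_def by blast
  then have "(exec ^^ (n + m)) ((P @ Q) @ K, \<sigma>) = (K, \<sigma>2)" by (simp add: funpow_add)
  then show "\<exists>n. (exec ^^ n) ((P @ Q) @ K, \<sigma>) = (K, \<sigma>2)" by blast
qed

lemma runs_Inc: "runs [Inc r] \<sigma> (\<sigma>(r := Suc (\<sigma> r)))"
  unfolding runs_def by (auto intro: exI[of _ 1])

lemma runs_Loop_0: "\<sigma> r = 0 \<Longrightarrow> runs [Loop r C] \<sigma> \<sigma>"
  unfolding runs_def by (auto intro: exI[of _ 1])

lemma runs_Loop_Suc:
  assumes "\<sigma> r = Suc n" "runs C (\<sigma>(r := n)) \<sigma>1" "runs [Loop r C] \<sigma>1 \<sigma>2"
  shows "runs [Loop r C] \<sigma> \<sigma>2"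
  unfolding runs_def
proof
  fix K
  obtain i j where "(exec ^^ i) (C @ Loop r C # K, \<sigma>(r := n)) = (Loop r C # K, \<sigma>1)"
    "(exec ^^ j) (Loop r C # K, \<sigma>1) = (K, \<sigma>2)"
    using assms(2,3) unfolding runs_def by fastforce
  then have "(exec ^^ Suc i) ([Loop r C] @ K, \<sigma>) = (Loop r C # K, \<sigma>1)"
    "(exec ^^ j) (Loop r C # K, \<sigma>1) = (K, \<sigma>2)"
    using assms(1) by (simp_all add: funpow_Suc_right del: funpow.simps)
  then have "(exec ^^ (j + Suc i)) ([Loop r C] @ K, \<sigma>) = (K, \<sigma>2)"
    by (simp only: funpow_add comp_apply)
  then show "\<exists>n. (exec ^^ n) ([Loop r C] @ K, \<sigma>) = (K, \<sigma>2)" by blast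
qed

lemma runs_clear: "runs [Loop r []] \<sigma> (\<sigma>(r := 0))"
proof (induction "\<sigma> r" arbitrary: \<sigma>)
  case 0
  then show ?case using runs_Loop_0[of \<sigma> r "[]"] by (simp add: fun_upd_idem)
next
  case (Suc n)
  then have "runs [Loop r []] (\<sigma>(r := n)) (\<sigma>(r := 0))" using Suc(1)[of "\<sigma>(r := n)"] by simp
  then show ?case using Suc runs_Loop_Suc[OF _ runs_Nil] by metis
qed

lemma runs_add:
  assumes "a \<noteq> b"
  shows "runs [Loop a [Inc b]] \<sigma> (\<sigma>(a := 0, b := \<sigma> b + \<sigma> a))"
proof (induction "\<sigma> a" arbitrary: \<sigma>)
  case 0
  then have "\<sigma>(a := 0, b := \<sigma> b + \<sigma> a) = \<sigma>" by auto
  then show ?case using 0 runs_Loop_0[of \<sigma> a] by metis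
next
  case (Suc n)
  let ?\<sigma> = "\<sigma>(a := n, b := Suc (\<sigma> b))"
  have "runs [Loop a [Inc b]] ?\<sigma> (?\<sigma>(a := 0, b := ?\<sigma> b + ?\<sigma> a))" using Suc(1)[of ?\<sigma>] assms by simp
  moreover have "?\<sigma>(a := 0, b := ?\<sigma> b + ?\<sigma> a) = \<sigma>(a := 0, b := \<sigma> b + \<sigma> a)"
    using assms Suc(2) by (auto simp: fun_eq_iff)
  moreover have "runs [Inc b] (\<sigma>(a := n)) ?\<sigma>" using runs_Inc[of b "\<sigma>(a := n)"] assms by simp
  ultimately show ?case using runs_Loop_Suc[of \<sigma> a n] Suc(2) by metis
qed

lemma runs_dup:
  assumes "a \<noteq> b" "a \<noteq> c" "b \<noteq> c"
  shows "runs [Loop a [Inc b, Inc c]] \<sigma> (\<sigma>(a := 0, b := \<sigma> b + \<sigma> a, c := \<sigma> c + \<sigma> a))"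
proof (induction "\<sigma> a" arbitrary: \<sigma>)
  case 0
  then have "\<sigma>(a := 0, b := \<sigma> b + \<sigma> a, c := \<sigma> c + \<sigma> a) = \<sigma>" by auto
  then show ?case using 0 runs_Loop_0[of \<sigma> a] by metis
next
  case (Suc n)
  let ?\<sigma> = "\<sigma>(a := n, b := Suc (\<sigma> b), c := Suc (\<sigma> c))"
  have "runs [Loop a [Inc b, Inc c]] ?\<sigma> (?\<sigma>(a := 0, b := ?\<sigma> b + ?\<sigma> a, c := ?\<sigma> c + ?\<sigma> a))"
    using Suc(1)[of ?\<sigma>] assms by simp
  moreover have "?\<sigma>(a := 0, b := ?\<sigma> b + ?\<sigma> a, c := ?\<sigma> c + ?\<sigma> a) = \<sigma>(a := 0, b := \<sigma> b + \<sigma> a, c := \<sigma> c + \<sigma> a)"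
    using assms Suc(2) by (auto simp: fun_eq_iff)
  moreover have "runs ([Inc b] @ [Inc c]) (\<sigma>(a := n)) ?\<sigma>"
    using runs_append[OF runs_Inc[of b "\<sigma>(a := n)"] runs_Inc[of c]] assms by simp
  ultimately show ?case using runs_Loop_Suc[of \<sigma> a n] Suc(2) by (metis append_Cons append_Nil)
qed

lemma runs_move:
  assumes "a \<noteq> b"
  shows "runs ([Loop b []] @ [Loop a [Inc b]]) \<sigma> (\<sigma>(b := \<sigma> a, a := 0))"
proof -
  have "(\<sigma>(b := 0))(a := 0, b := (\<sigma>(b := 0)) b + (\<sigma>(b := 0)) a) = \<sigma>(b := \<sigma> a, a := 0)"
    using assms by (auto simp: fun_eq_iff)
  then show ?thesis using runs_append[OF runs_clear[of b \<sigma>] runs_add[OF assms, of "\<sigma>(b := 0)"]] by simp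
qed

lemma runs_copy:
  assumes "a \<noteq> b" "a \<noteq> t" "b \<noteq> t"
  shows "runs (([Loop b []] @ [Loop t []]) @ [Loop a [Inc b, Inc t]] @ [Loop t [Inc a]]) \<sigma> (\<sigma>(b := \<sigma> a, t := 0))"
proof -
  let ?\<sigma>1 = "\<sigma>(b := 0, t := 0)"
  let ?\<sigma>2 = "?\<sigma>1(a := 0, b := ?\<sigma>1 b + ?\<sigma>1 a, t := ?\<sigma>1 t + ?\<sigma>1 a)"
  have "?\<sigma>2(t := 0, a := ?\<sigma>2 a + ?\<sigma>2 t) = \<sigma>(b := \<sigma> a, t := 0)"
    using assms by (auto simp: fun_eq_iff)
  then show ?thesis
    using runs_append[OF runs_append[OF runs_clear[of b \<sigma>] runs_clear[of t]]
      runs_append[OF runs_dup[OF assms, of ?\<sigma>1] runs_add[OF assms(2)[symmetric], of ?\<sigma>2]]] by simp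
qed

text \<open>Registers from \<open>k\<close> on are scratch and may hold anything at the start, so
  nested calls can reuse them. Nothing is demanded where \<open>f\<close> is undefined.\<close>

definition implements :: "nat list \<Rightarrow> nat \<Rightarrow> nat \<Rightarrow> instr list \<Rightarrow> recf \<Rightarrow> bool" where
  "implements as r k P f \<longleftrightarrow> (\<forall>\<sigma> y. evaluates f (map \<sigma> as) y \<longrightarrow>
    (\<exists>\<sigma>'. runs P \<sigma> \<sigma>' \<and> \<sigma>' r = y \<and> (\<forall>j<k. j \<noteq> r \<longrightarrow> \<sigma>' j = \<sigma> j)))"

definition implementable :: "recf \<Rightarrow> bool" where
  "implementable f \<longleftrightarrow> (\<forall>as r k. set as \<subseteq> {..<k} \<longrightarrow> r < k \<longrightarrow> (\<exists>P. implements as r k P f))"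

lemma implementableD: "implementable f \<Longrightarrow> set as \<subseteq> {..<k} \<Longrightarrow> r < k \<Longrightarrow> \<exists>P. implements as r k P f"
  unfolding implementable_def by blast

lemma implementsD: "implements as r k P f \<Longrightarrow> evaluates f (map \<sigma> as) y \<Longrightarrow>
    \<exists>\<sigma>'. runs P \<sigma> \<sigma>' \<and> \<sigma>' r = y \<and> (\<forall>j<k. j \<noteq> r \<longrightarrow> \<sigma>' j = \<sigma> j)"
  unfolding implements_def by blast

lemma runs_copy_to:
  assumes "a < k" "r < k"
  shows "\<exists>P. \<forall>\<sigma>. \<exists>\<sigma>'. runs P \<sigma> \<sigma>' \<and> \<sigma>' r = \<sigma> a \<and> (\<forall>j<k. j \<noteq> r \<longrightarrow> \<sigma>' j = \<sigma> j)"
proof -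
  let ?P = "(([Loop k []] @ [Loop (k + 1) []]) @ [Loop a [Inc k, Inc (k + 1)]] @ [Loop (k + 1) [Inc a]]) @
    ([Loop r []] @ [Loop k [Inc r]])"
  have "runs ?P \<sigma> ((\<sigma>(k := \<sigma> a, k + 1 := 0))(r := (\<sigma>(k := \<sigma> a, k + 1 := 0)) k, k := 0))" for \<sigma>
    using assms by (intro runs_append[OF runs_copy runs_move]) auto
  then show ?thesis using assms by (intro exI[of _ ?P] allI) (fastforce simp: fun_eq_iff)
qed

lemma implementable_Zero: "implementable Zero"
  unfolding implementable_def implements_def
  using runs_clear by (fastforce elim: evaluates_ZeroE)

lemma implementable_Succ: "implementable Succ"
  unfolding implementable_def
proof (intro allI impI)
  fix as :: "nat list" and r k assume as: "set as \<subseteq> {..<k}" and r: "r < k"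
  show "\<exists>P. implements as r k P Succ"
  proof (cases "length as = 1")
    case True
    then obtain a where a: "as = [a]" by (auto simp: length_Suc_conv One_nat_def)
    then obtain P where P: "\<And>\<sigma>. \<exists>\<sigma>'. runs P \<sigma> \<sigma>' \<and> \<sigma>' r = \<sigma> a \<and> (\<forall>j<k. j \<noteq> r \<longrightarrow> \<sigma>' j = \<sigma> j)"
      using runs_copy_to[of a k r] as r by auto
    have "implements as r k (P @ [Inc r]) Succ" unfolding implements_def
    proof (intro allI impI)
      fix \<sigma> y assume "evaluates Succ (map \<sigma> as) y"
      then have y: "y = Suc (\<sigma> a)" by (rule evaluates_SuccE) (simp add: a)
      obtain \<sigma>' where "runs P \<sigma> \<sigma>'" "\<sigma>' r = \<sigma> a" "\<forall>j<k. j \<noteq> r \<longrightarrow> \<sigma>' j = \<sigma> j" using P by blast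
      then show "\<exists>\<sigma>'. runs (P @ [Inc r]) \<sigma> \<sigma>' \<and> \<sigma>' r = y \<and> (\<forall>j<k. j \<noteq> r \<longrightarrow> \<sigma>' j = \<sigma> j)"
        using runs_append[OF _ runs_Inc[of r \<sigma>'], of P \<sigma>] y
        by (intro exI[of _ "\<sigma>'(r := Suc (\<sigma>' r))"]) auto
    qed
    then show ?thesis by blast
  next
    case False
    then have "\<not> evaluates Succ (map \<sigma> as) y" for \<sigma> y by (auto elim: evaluates_SuccE)
    then show ?thesis by (auto simp: implements_def)
  qed
qed

lemma implementable_Proj: "implementable (Proj i)"
  unfolding implementable_def
proof (intro allI impI)
  fix as :: "nat list" and r k assume as: "set as \<subseteq> {..<k}" and r: "r < k"
  show "\<exists>P. implements as r k P (Proj i)"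
  proof (cases "i < length as")
    case True
    then have "as ! i < k" using as nth_mem by blast
    from runs_copy_to[OF this r] show ?thesis unfolding implements_def
      using True by (fastforce elim!: evaluates_ProjE)
  next
    case False
    then have "\<not> evaluates (Proj i) (map \<sigma> as) y" for \<sigma> y by (auto elim: evaluates_ProjE)
    then show ?thesis by (auto simp: implements_def)
  qed
qed

lemma implementable_args:
  assumes "\<And>g. g \<in> set gs \<Longrightarrow> implementable g" "set as \<subseteq> {..<k}"
  shows "\<exists>P. \<forall>\<sigma> ys. list_all2 (\<lambda>g y. evaluates g (map \<sigma> as) y) gs ys \<longrightarrow>
    (\<exists>\<sigma>'. runs P \<sigma> \<sigma>' \<and> map \<sigma>' [k..<k + length gs] = ys \<and> (\<forall>j<k. \<sigma>' j = \<sigma> j))"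
  using assms(1)
proof (induction gs rule: rev_induct)
  case Nil
  show ?case using runs_Nil by (intro exI[of _ "[]"]) auto
next
  case (snoc g gs)
  let ?n = "k + length gs"
  obtain P where P: "\<And>\<sigma> ys. list_all2 (\<lambda>g y. evaluates g (map \<sigma> as) y) gs ys \<Longrightarrow>
    \<exists>\<sigma>'. runs P \<sigma> \<sigma>' \<and> map \<sigma>' [k..<?n] = ys \<and> (\<forall>j<k. \<sigma>' j = \<sigma> j)"
    using snoc by auto
  obtain Q where Q: "implements as ?n (Suc ?n) Q g"
    using implementableD[of g as "Suc ?n" ?n] snoc.prems assms(2) by fastforce
  show ?case
  proof (intro exI[of _ "P @ Q"] allI impI)
    fix \<sigma> zs assume "list_all2 (\<lambda>g y. evaluates g (map \<sigma> as) y) (gs @ [g]) zs"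
    then obtain ys y where zs: "zs = ys @ [y]"
      "list_all2 (\<lambda>g y. evaluates g (map \<sigma> as) y) gs ys" "evaluates g (map \<sigma> as) y"
      by (auto simp: list_all2_append1 list_all2_Cons1)
    obtain \<sigma>1 where \<sigma>1: "runs P \<sigma> \<sigma>1" "map \<sigma>1 [k..<?n] = ys" "\<forall>j<k. \<sigma>1 j = \<sigma> j"
      using P[OF zs(2)] by blast
    have "map \<sigma>1 as = map \<sigma> as" using \<sigma>1(3) assms(2) by auto
    then have "evaluates g (map \<sigma>1 as) y" using zs(3) by (simp only:)
    from implementsD[OF Q this] obtain \<sigma>2 where
      \<sigma>2: "runs Q \<sigma>1 \<sigma>2" "\<sigma>2 ?n = y" "\<forall>j<Suc ?n. j \<noteq> ?n \<longrightarrow> \<sigma>2 j = \<sigma>1 j" by blast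
    have "map \<sigma>2 [k..<?n] = map \<sigma>1 [k..<?n]" using \<sigma>2(3) by auto
    then have "map \<sigma>2 [k..<k + length (gs @ [g])] = zs" using \<sigma>1(2) \<sigma>2(2) zs(1) by simp
    moreover have "\<forall>j<k. \<sigma>2 j = \<sigma> j" using \<sigma>1(3) \<sigma>2(3) by simp
    ultimately show "\<exists>\<sigma>'. runs (P @ Q) \<sigma> \<sigma>' \<and> map \<sigma>' [k..<k + length (gs @ [g])] = zs \<and> (\<forall>j<k. \<sigma>' j = \<sigma> j)"
      using runs_append[OF \<sigma>1(1) \<sigma>2(1)] by blast
  qed
qed

lemma implementable_Comp:
  assumes "implementable f" "\<And>g. g \<in> set gs \<Longrightarrow> implementable g"
  shows "implementable (Comp f gs)"
  unfolding implementable_def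
proof (intro allI impI)
  fix as :: "nat list" and r k assume as: "set as \<subseteq> {..<k}" and r: "r < k"
  let ?n = "k + length gs"
  obtain P where P: "\<And>\<sigma> ys. list_all2 (\<lambda>g y. evaluates g (map \<sigma> as) y) gs ys \<Longrightarrow>
    \<exists>\<sigma>'. runs P \<sigma> \<sigma>' \<and> map \<sigma>' [k..<?n] = ys \<and> (\<forall>j<k. \<sigma>' j = \<sigma> j)"
    using implementable_args[OF assms(2) as] by blast
  obtain Q where Q: "implements [k..<?n] r ?n Q f"
    using implementableD[OF assms(1), of "[k..<?n]" ?n r] r by fastforce
  have "implements as r k (P @ Q) (Comp f gs)" unfolding implements_def
  proof (intro allI impI)
    fix \<sigma> y assume "evaluates (Comp f gs) (map \<sigma> as) y"
    then obtain ys where ys: "list_all2 (\<lambda>g y. evaluates g (map \<sigma> as) y) gs ys" "evaluates f ys y"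
      by (rule evaluates_CompE)
    obtain \<sigma>1 where \<sigma>1: "runs P \<sigma> \<sigma>1" "map \<sigma>1 [k..<?n] = ys" "\<forall>j<k. \<sigma>1 j = \<sigma> j"
      using P[OF ys(1)] by blast
    have "evaluates f (map \<sigma>1 [k..<?n]) y" using \<sigma>1(2) ys(2) by (simp only:)
    from implementsD[OF Q this] obtain \<sigma>2 where
      \<sigma>2: "runs Q \<sigma>1 \<sigma>2" "\<sigma>2 r = y" "\<forall>j<?n. j \<noteq> r \<longrightarrow> \<sigma>2 j = \<sigma>1 j" by blast
    show "\<exists>\<sigma>'. runs (P @ Q) \<sigma> \<sigma>' \<and> \<sigma>' r = y \<and> (\<forall>j<k. j \<noteq> r \<longrightarrow> \<sigma>' j = \<sigma> j)"
      using runs_append[OF \<sigma>1(1) \<sigma>2(1)] \<sigma>1(3) \<sigma>2(2,3) by (intro exI[of _ \<sigma>2]) auto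
  qed
  then show "\<exists>P. implements as r k P (Comp f gs)" by blast
qed

lemma evaluates_Prim_Rec_le:
  assumes "evaluates (Prim_Rec f g) (n # xs) y" "m \<le> n"
  shows "\<exists>r. evaluates (Prim_Rec f g) (m # xs) r"
  using assms
proof (induction n arbitrary: y)
  case (Suc n)
  show ?case
  proof (cases "m = Suc n")
    case True
    then show ?thesis using Suc.prems by blast
  next
    case False
    obtain r where "evaluates (Prim_Rec f g) (n # xs) r"
      using Suc.prems(1) by (rule evaluates_Prim_Rec_SucE)
    then show ?thesis using Suc.IH Suc.prems(2) False by simp
  qed
qed auto

text \<open>Register \<open>k\<close> counts down, \<open>k + 1\<close> counts up,
  \<open>k + 2\<close> holds the value of the recursion at \<open>k + 1\<close>, and
  \<open>k + 3\<close> receives the next value. The invariant of the loop is that the two counters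
  add up to the argument.\<close>

lemma implementable_Prim_Rec:
  assumes "implementable f" "implementable g"
  shows "implementable (Prim_Rec f g)"
  unfolding implementable_def
proof (intro allI impI)
  fix as :: "nat list" and r k assume as: "set as \<subseteq> {..<k}" and r: "r < k"
  show "\<exists>P. implements as r k P (Prim_Rec f g)"
  proof (cases as)
    case Nil
    then have "\<not> evaluates (Prim_Rec f g) (map \<sigma> as) y" for \<sigma> y
      by (auto elim: evaluates.cases)
    then show ?thesis by (auto simp: implements_def)
  next
    case (Cons a bs)
    then have a: "a < k" and bs: "set bs \<subseteq> {..<k}" using as by auto
    obtain P where P: "implements bs (k + 2) (k + 4) P f"
      using implementableD[OF assms(1), of bs "k + 4" "k + 2"] bs by fastforce
    obtain Q where Q: "implements ((k + 1) # (k + 2) # bs) (k + 3) (k + 4) Q g"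
      using implementableD[OF assms(2), of "(k + 1) # (k + 2) # bs" "k + 4" "k + 3"] bs by fastforce
    let ?body = "Q @ ([Loop (k + 2) []] @ [Loop (k + 3) [Inc (k + 2)]]) @ [Inc (k + 1)]"
    have loop: "\<exists>\<sigma>'. runs [Loop k ?body] \<sigma> \<sigma>' \<and> \<sigma>' (k + 2) = y \<and> (\<forall>j<k. \<sigma>' j = \<sigma> j)"
      if "\<sigma> k = c" "evaluates (Prim_Rec f g) (\<sigma> (k + 1) # map \<sigma> bs) (\<sigma> (k + 2))"
        "evaluates (Prim_Rec f g) ((\<sigma> (k + 1) + c) # map \<sigma> bs) y" for \<sigma> c y
      using that
    proof (induction c arbitrary: \<sigma>)
      case 0
      then have "\<sigma> (k + 2) = y" using evaluates_deterministic by simp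
      then show ?case using runs_Loop_0[of \<sigma> k] 0 by blast
    next
      case (Suc c)
      let ?i = "\<sigma> (k + 1)" and ?xs = "map \<sigma> bs"
      obtain v where v: "evaluates (Prim_Rec f g) (Suc ?i # ?xs) v"
        using evaluates_Prim_Rec_le[OF Suc.prems(3), of "Suc ?i"] by auto
      then obtain u where u: "evaluates (Prim_Rec f g) (?i # ?xs) u" "evaluates g (?i # u # ?xs) v"
        by (rule evaluates_Prim_Rec_SucE)
      have [simp]: "u = \<sigma> (k + 2)" using evaluates_deterministic[OF u(1) Suc.prems(2)] .
      define \<sigma>0 where "\<sigma>0 = \<sigma>(k := c)"
      have bs0: "map \<sigma>0 bs = ?xs" using bs by (auto simp: \<sigma>0_def)
      have "map \<sigma>0 ((k + 1) # (k + 2) # bs) = ?i # u # ?xs"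
        unfolding list.map bs0 by (simp add: \<sigma>0_def)
      then have "evaluates g (map \<sigma>0 ((k + 1) # (k + 2) # bs)) v" using u(2) by (simp only:)
      from implementsD[OF Q this] obtain \<sigma>1 where \<sigma>1: "runs Q \<sigma>0 \<sigma>1" "\<sigma>1 (k + 3) = v"
        "\<forall>j<k + 4. j \<noteq> k + 3 \<longrightarrow> \<sigma>1 j = \<sigma>0 j" by blast
      define \<sigma>2 where "\<sigma>2 = \<sigma>1(k + 2 := \<sigma>1 (k + 3), k + 3 := 0)"
      define \<sigma>3 where "\<sigma>3 = \<sigma>2(k + 1 := Suc (\<sigma>2 (k + 1)))"
      have body: "runs ?body \<sigma>0 \<sigma>3"
        unfolding \<sigma>3_def \<sigma>2_def
        by (intro runs_append[OF \<sigma>1(1) runs_append[OF runs_move runs_Inc]]) simp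
      have 3: "\<sigma>3 k = c" "\<sigma>3 (k + 1) = Suc ?i" "\<sigma>3 (k + 2) = v" "\<forall>j<k. \<sigma>3 j = \<sigma> j"
        using \<sigma>1(2,3) by (auto simp: \<sigma>3_def \<sigma>2_def \<sigma>0_def)
      have bs3: "map \<sigma>3 bs = ?xs" using bs 3(4) by auto
      have "evaluates (Prim_Rec f g) (\<sigma>3 (k + 1) # map \<sigma>3 bs) (\<sigma>3 (k + 2))"
        using v unfolding bs3 3(2,3) .
      moreover have "\<sigma>3 (k + 1) + c = ?i + Suc c" unfolding 3(2) by simp
      then have "evaluates (Prim_Rec f g) ((\<sigma>3 (k + 1) + c) # map \<sigma>3 bs) y"
        using Suc.prems(3) unfolding bs3 by (simp only:)
      ultimately obtain \<sigma>' where \<sigma>': "runs [Loop k ?body] \<sigma>3 \<sigma>'" "\<sigma>' (k + 2) = y" "\<forall>j<k. \<sigma>' j = \<sigma>3 j"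
        using Suc.IH[of \<sigma>3] 3(1) by blast
      have "runs [Loop k ?body] \<sigma> \<sigma>'"
        using runs_Loop_Suc[of \<sigma> k c ?body \<sigma>3 \<sigma>'] Suc.prems(1) \<sigma>'(1) body[unfolded \<sigma>0_def] by blast
      then show ?case using \<sigma>'(2,3) 3(4) by auto
    qed
    let ?C = "([Loop k []] @ [Loop (k + 3) []]) @ [Loop a [Inc k, Inc (k + 3)]] @ [Loop (k + 3) [Inc a]]"
    let ?P = "(?C @ [Loop (k + 1) []]) @ P @ [Loop k ?body] @ ([Loop r []] @ [Loop (k + 2) [Inc r]])"
    have "implements as r k ?P (Prim_Rec f g)" unfolding implements_def
    proof (intro allI impI)
      fix \<sigma> y assume y: "evaluates (Prim_Rec f g) (map \<sigma> as) y"
      define \<sigma>1 where "\<sigma>1 = (\<sigma>(k := \<sigma> a, k + 3 := 0))(k + 1 := 0)"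
      have C: "runs (?C @ [Loop (k + 1) []]) \<sigma> \<sigma>1"
        unfolding \<sigma>1_def using a by (intro runs_append[OF runs_copy runs_clear]) auto
      have bs1: "map \<sigma>1 bs = map \<sigma> bs" using bs by (auto simp: \<sigma>1_def)
      obtain v where v: "evaluates (Prim_Rec f g) (0 # map \<sigma> bs) v"
        using evaluates_Prim_Rec_le[of f g "\<sigma> a" "map \<sigma> bs" y 0] y Cons by auto
      then have "evaluates f (map \<sigma>1 bs) v" unfolding bs1 by (rule evaluates_Prim_Rec_0E)
      from implementsD[OF P this] obtain \<sigma>2 where \<sigma>2: "runs P \<sigma>1 \<sigma>2" "\<sigma>2 (k + 2) = v"
        "\<forall>j<k + 4. j \<noteq> k + 2 \<longrightarrow> \<sigma>2 j = \<sigma>1 j" by blast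
      have 2: "\<sigma>2 k = \<sigma> a" "\<sigma>2 (k + 1) = 0" "\<forall>j<k. \<sigma>2 j = \<sigma> j" using \<sigma>2(3) by (auto simp: \<sigma>1_def)
      have bs2: "map \<sigma>2 bs = map \<sigma> bs" using bs 2(3) by auto
      have "evaluates (Prim_Rec f g) (\<sigma>2 (k + 1) # map \<sigma>2 bs) (\<sigma>2 (k + 2))"
        using v unfolding bs2 2(2) \<sigma>2(2) .
      moreover have "evaluates (Prim_Rec f g) ((\<sigma>2 (k + 1) + \<sigma> a) # map \<sigma>2 bs) y"
        using y unfolding bs2 2(2) Cons by simp
      ultimately obtain \<sigma>3 where \<sigma>3: "runs [Loop k ?body] \<sigma>2 \<sigma>3" "\<sigma>3 (k + 2) = y" "\<forall>j<k. \<sigma>3 j = \<sigma>2 j"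
        using loop[of \<sigma>2 "\<sigma> a" y] 2(1) by blast
      define \<sigma>4 where "\<sigma>4 = \<sigma>3(r := \<sigma>3 (k + 2), k + 2 := 0)"
      have "runs ?P \<sigma> \<sigma>4" unfolding \<sigma>4_def
        using r by (intro runs_append[OF C runs_append[OF \<sigma>2(1) runs_append[OF \<sigma>3(1) runs_move]]]) simp
      moreover have "\<sigma>4 r = y" "\<forall>j<k. j \<noteq> r \<longrightarrow> \<sigma>4 j = \<sigma> j"
        using \<sigma>3(2,3) 2(3) r by (auto simp: \<sigma>4_def)
      ultimately show "\<exists>\<sigma>'. runs ?P \<sigma> \<sigma>' \<and> \<sigma>' r = y \<and> (\<forall>j<k. j \<noteq> r \<longrightarrow> \<sigma>' j = \<sigma> j)" by blast
    qed
    then show ?thesis by blast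
  qed
qed

text \<open>Register \<open>k\<close> holds the candidate and \<open>k + 1\<close> the value of
  \<open>f\<close> there, which controls the loop. The loop decrements that value only once, so the
  body clears the rest before trying the next candidate.\<close>

lemma implementable_Mu:
  assumes "implementable f"
  shows "implementable (Mu f)"
  unfolding implementable_def
proof (intro allI impI)
  fix as :: "nat list" and r k assume as: "set as \<subseteq> {..<k}" and r: "r < k"
  obtain P where P: "implements (k # as) (k + 1) (k + 2) P f"
    using implementableD[OF assms, of "k # as" "k + 2" "k + 1"] as by fastforce
  let ?body = "([Loop (k + 1) []] @ [Inc k]) @ P"
  let ?P = "[Loop k []] @ P @ [Loop (k + 1) ?body] @ ([Loop r []] @ [Loop k [Inc r]])"
  have "implements as r k ?P (Mu f)" unfolding implements_def
  proof (intro allI impI)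
    fix \<sigma> n assume "evaluates (Mu f) (map \<sigma> as) n"
    then have n: "evaluates f (n # map \<sigma> as) 0" "\<forall>i<n. \<exists>y. evaluates f (i # map \<sigma> as) (Suc y)"
      by (auto elim: evaluates_MuE)
    then have ex: "\<exists>v. evaluates f (i # map \<sigma> as) v" if "i \<le> n" for i
      using that by (cases "i = n") (blast, metis le_neq_implies_less)
    have loop: "\<exists>\<tau>'. runs [Loop (k + 1) ?body] \<tau> \<tau>' \<and> \<tau>' k = n \<and> (\<forall>j<k. \<tau>' j = \<sigma> j)"
      if "\<tau> k + d = n" "evaluates f (\<tau> k # map \<sigma> as) (\<tau> (k + 1))" "\<forall>j<k. \<tau> j = \<sigma> j" for \<tau> d
      using that
    proof (induction d arbitrary: \<tau>)
      case 0
      then have "\<tau> (k + 1) = 0" using evaluates_deterministic n(1) by simp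
      then show ?case using runs_Loop_0[of \<tau> "k + 1"] 0 by auto
    next
      case (Suc d)
      then obtain y where "evaluates f (\<tau> k # map \<sigma> as) (Suc y)" using n(2) by force
      then have y: "\<tau> (k + 1) = Suc y" using evaluates_deterministic Suc.prems(2) by blast
      obtain v where v: "evaluates f (Suc (\<tau> k) # map \<sigma> as) v" using ex[of "Suc (\<tau> k)"] Suc.prems(1) by auto
      define \<tau>0 where "\<tau>0 = (\<tau>(k + 1 := y))(k + 1 := 0)"
      define \<tau>1 where "\<tau>1 = \<tau>0(k := Suc (\<tau>0 k))"
      have r1: "runs ([Loop (k + 1) []] @ [Inc k]) (\<tau>(k + 1 := y)) \<tau>1"
        unfolding \<tau>1_def \<tau>0_def by (rule runs_append[OF runs_clear runs_Inc])
      have 1: "\<tau>1 k = Suc (\<tau> k)" "\<forall>j<k. \<tau>1 j = \<sigma> j" using Suc.prems(3) by (auto simp: \<tau>1_def \<tau>0_def)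
      have "map \<tau>1 as = map \<sigma> as" using 1(2) as by auto
      then have "evaluates f (map \<tau>1 (k # as)) v" using v 1(1) by (simp only: list.map)
      from implementsD[OF P this] obtain \<tau>2 where
        \<tau>2: "runs P \<tau>1 \<tau>2" "\<tau>2 (k + 1) = v" "\<forall>j<k + 2. j \<noteq> k + 1 \<longrightarrow> \<tau>2 j = \<tau>1 j" by blast
      have 2: "\<tau>2 k = Suc (\<tau> k)" "\<forall>j<k. \<tau>2 j = \<sigma> j" using 1 \<tau>2(3) by auto
      obtain \<tau>' where \<tau>': "runs [Loop (k + 1) ?body] \<tau>2 \<tau>'" "\<tau>' k = n" "\<forall>j<k. \<tau>' j = \<sigma> j"
        using Suc.IH[of \<tau>2] Suc.prems(1) 2 v \<tau>2(2) by auto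
      then show ?case
        using runs_Loop_Suc[of \<tau> "k + 1" y ?body \<tau>2 \<tau>'] y runs_append[OF r1 \<tau>2(1)] \<tau>'(1) by blast
    qed
    define \<sigma>1 where "\<sigma>1 = \<sigma>(k := 0)"
    obtain v where v: "evaluates f (0 # map \<sigma> as) v" using ex[of 0] by auto
    have "map \<sigma>1 as = map \<sigma> as" using as by (auto simp: \<sigma>1_def)
    moreover have "\<sigma>1 k = 0" by (simp add: \<sigma>1_def)
    ultimately have "evaluates f (map \<sigma>1 (k # as)) v" using v by (simp only: list.map)
    from implementsD[OF P this] obtain \<sigma>2 where
      \<sigma>2: "runs P \<sigma>1 \<sigma>2" "\<sigma>2 (k + 1) = v" "\<forall>j<k + 2. j \<noteq> k + 1 \<longrightarrow> \<sigma>2 j = \<sigma>1 j" by blast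
    have 2: "\<sigma>2 k = 0" "\<forall>j<k. \<sigma>2 j = \<sigma> j" using \<sigma>2(3) by (auto simp: \<sigma>1_def)
    obtain \<sigma>3 where \<sigma>3: "runs [Loop (k + 1) ?body] \<sigma>2 \<sigma>3" "\<sigma>3 k = n" "\<forall>j<k. \<sigma>3 j = \<sigma> j"
      using loop[of \<sigma>2 n] 2 v \<sigma>2(2) by auto
    define \<sigma>4 where "\<sigma>4 = \<sigma>3(r := \<sigma>3 k, k := 0)"
    have "runs ?P \<sigma> \<sigma>4" unfolding \<sigma>4_def using r \<sigma>2(1)
      by (intro runs_append[OF runs_clear runs_append[OF _ runs_append[OF \<sigma>3(1) runs_move]]]) (simp_all add: \<sigma>1_def)
    moreover have "\<sigma>4 r = n" "\<forall>j<k. j \<noteq> r \<longrightarrow> \<sigma>4 j = \<sigma> j"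
      using \<sigma>3(2,3) r by (auto simp: \<sigma>4_def)
    ultimately show "\<exists>\<sigma>'. runs ?P \<sigma> \<sigma>' \<and> \<sigma>' r = n \<and> (\<forall>j<k. j \<noteq> r \<longrightarrow> \<sigma>' j = \<sigma> j)" by blast
  qed
  then show "\<exists>P. implements as r k P (Mu f)" by blast
qed

theorem implementable: "implementable f"
  by (induction f) (simp_all add: implementable_Zero implementable_Succ implementable_Proj
    implementable_Comp implementable_Prim_Rec implementable_Mu)

section \<open>Machines that read their own code\<close>

definition digit :: "nat \<Rightarrow> nat \<Rightarrow> nat \<Rightarrow> nat \<Rightarrow> bool" where
  "digit e k x y \<longleftrightarrow> prod_encode (k, prod_encode (x, y)) \<in> set_decode e"

text \<open>A number \<open>e\<close> is read as a machine whose labels each carry one operation on a multiset of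
  registers and a set of possible next labels. The labels below \<open>e\<close> put \<open>e\<close> copies of register 0
  into the multiset, so that the machine is run on its own code; the operations and successors of the
  labels from \<open>e\<close> on are given by the binary digits of \<open>e\<close>.\<close>

definition inc :: "nat \<Rightarrow> nat \<Rightarrow> nat \<Rightarrow> bool" where
  "inc e t r \<longleftrightarrow> t < e \<and> r = 0 \<or> \<not> t < e \<and> digit e 0 (t - e) r"

definition dec :: "nat \<Rightarrow> nat \<Rightarrow> nat \<Rightarrow> bool" where
  "dec e t r \<longleftrightarrow> \<not> t < e \<and> digit e 1 (t - e) r"

definition zero :: "nat \<Rightarrow> nat \<Rightarrow> nat \<Rightarrow> bool" where
  "zero e t r \<longleftrightarrow> \<not> t < e \<and> digit e 2 (t - e) r"

definition isz :: "nat \<Rightarrow> nat \<Rightarrow> bool" where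
  "isz e t \<longleftrightarrow> \<not> t < e \<and> digit e 4 (t - e) 0"

definition fol :: "nat \<Rightarrow> nat \<Rightarrow> nat \<Rightarrow> bool" where
  "fol e t t' \<longleftrightarrow> t < e \<and> t' = Suc t \<or> \<not> t < e \<and> \<not> t' < e \<and> digit e 3 (t - e) (t' - e)"

definition mstep :: "nat \<Rightarrow> nat \<Rightarrow> nat multiset \<Rightarrow> nat multiset \<Rightarrow> bool" where
  "mstep e t c c' \<longleftrightarrow> (\<exists>r. inc e t r \<and> c' = add_mset r c) \<or> (\<exists>r. dec e t r \<and> c = add_mset r c') \<or>
    isz e t \<and> c' = c \<and> (\<forall>x \<in># c. \<not> zero e t x)"

definition trace :: "nat \<Rightarrow> nat \<Rightarrow> (nat \<Rightarrow> nat) \<Rightarrow> (nat \<Rightarrow> nat multiset) \<Rightarrow> bool" where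
  "trace e n t c \<longleftrightarrow> t 0 = 0 \<and> c 0 = {#} \<and> (\<forall>i<n. mstep e (t i) (c i) (c (Suc i)) \<and> fol e (t i) (t (Suc i)))"

text \<open>The state transitions of the tree automaton below only simulate labels with a single kind of
  operation faithfully.\<close>

definition pure :: "nat \<Rightarrow> nat \<Rightarrow> bool" where
  "pure e t \<longleftrightarrow> (\<forall>x. inc e t x \<longrightarrow> \<not> isz e t) \<and> (\<forall>x y. inc e t x \<longrightarrow> \<not> dec e t y) \<and>
    (\<forall>x y. inc e t x \<or> dec e t x \<longrightarrow> \<not> zero e t y) \<and> (\<forall>x. dec e t x \<longrightarrow> \<not> isz e t)"

text \<open>Chosen for codes of programs: prelude labels are below \<open>e\<close>, all other
  labels are \<open>e + num l\<close> with \<open>num l < e\<close>, and the registers are below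
  \<open>e\<close> or equal to 0.\<close>

definition width :: "nat \<Rightarrow> nat" where
  "width e = 2 * e + 1"

section \<open>Compiling a register program into a code\<close>

fun conts :: "instr list \<Rightarrow> instr list set" where
  "conts [] = {[]}"
| "conts (Inc r # K) = insert (Inc r # K) (conts K)"
| "conts (Loop r C # K) = insert (Loop r C # K) (conts K \<union> (\<lambda>X. X @ Loop r C # K) ` conts C)"

fun next_cont :: "instr list \<times> bool \<Rightarrow> instr list" where
  "next_cont ([], b) = []"
| "next_cont (Inc r # K, b) = K"
| "next_cont (Loop r C # K, b) = (if b then C @ Loop r C # K else K)"

lemma finite_conts: "finite (conts P)"
  by (induction P rule: conts.induct) auto

lemma self_in_conts: "P \<in> conts P"
  by (induction P rule: conts.induct) auto

lemma next_cont_append: "X \<noteq> [] \<Longrightarrow> next_cont (X @ L, b) = next_cont (X, b) @ L"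
  by (cases "(X, b)" rule: next_cont.cases) auto

lemma next_cont_in_conts: "K \<in> conts P \<Longrightarrow> next_cont (K, b) \<in> conts P"
proof (induction P arbitrary: K rule: conts.induct)
  case 1
  then show ?case by simp
next
  case (2 r P)
  then show ?case using self_in_conts[of P] by auto
next
  case (3 r C P)
  consider "K = Loop r C # P" | "K \<in> conts P" | X where "X \<in> conts C" "X \<noteq> []" "K = X @ Loop r C # P"
    using 3(3) by (auto; metis append_Nil)
  then show ?case
  proof cases
    case 1
    then show ?thesis using self_in_conts[of P] self_in_conts[of C] by auto
  next
    case 2
    then show ?thesis using 3(1) by simp
  next
    case (3 X)
    then show ?thesis using "3.IH"(2)[OF 3(1)] by (simp add: next_cont_append)
  qed
qed

definition branch :: "instr list \<times> (nat \<Rightarrow> nat) \<Rightarrow> bool" where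
  "branch z = (case fst z of Loop r C # K \<Rightarrow> snd z r \<noteq> 0 | _ \<Rightarrow> False)"

lemma fst_exec: "fst (exec z) = next_cont (fst z, branch z)"
  by (cases z rule: exec.cases) (auto simp: branch_def)

locale program =
  fixes P :: "instr list"
  assumes P: "\<exists>r K. P = Inc r # K"
begin

text \<open>A label carries a single operation, either a decrement or a zero test. So it includes a
  guess \<open>b\<close> of the outcome of the loop test at its head; a wrong guess admits no step.
  The empty continuation is no label, hence a halted program blocks the machine.\<close>

definition labels :: "(instr list \<times> bool) set" where
  "labels = {(K, b). K \<in> conts P \<and> K \<noteq> [] \<and> (b \<longrightarrow> (\<exists>r C K'. K = Loop r C # K'))}"

lemma finite_labels: "finite labels"
proof (rule finite_subset)
  show "labels \<subseteq> conts P \<times> UNIV" by (auto simp: labels_def)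
qed (simp add: finite_conts)

lemma start_label: "(P, False) \<in> labels"
  using P by (auto simp: labels_def self_in_conts)

text \<open>\<open>entry l k y\<close> lists the digits describing the label \<open>l\<close>, up to the numbering of labels.\<close>

definition num :: "instr list \<times> bool \<Rightarrow> nat" where
  "num = (SOME f. inj_on f labels \<and> f (P, False) = 0)"

text \<open>The start label gets number 0 because the prelude ends in label \<open>e - 1\<close>,
  whose successor is \<open>e + 0\<close>.\<close>

lemma num: "inj_on num labels" "num (P, False) = 0"
proof -
  obtain f :: "instr list \<times> bool \<Rightarrow> nat" where f: "inj_on f labels"
    using finite_imp_inj_to_nat_seg[OF finite_labels] by blast
  have "inj_on (\<lambda>l. if l = (P, False) then 0 else Suc (f l)) labels"
    using f by (auto simp: inj_on_def)
  then have "\<exists>f :: instr list \<times> bool \<Rightarrow> nat. inj_on f labels \<and> f (P, False) = 0"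
    by (intro exI[of _ "\<lambda>l. if l = (P, False) then 0 else Suc (f l)"]) simp
  then show "inj_on num labels" "num (P, False) = 0"
    unfolding num_def by (rule someI2_ex, blast)+
qed

definition entry :: "instr list \<times> bool \<Rightarrow> (nat \<times> nat) set" where
  "entry l = (case l of (Inc r # K, b) \<Rightarrow> {(0, r)} | (Loop r C # K, b) \<Rightarrow>
    if b then {(1, r)} else {(2, r), (4, 0)} | _ \<Rightarrow> {}) \<union> {(3, num l') | l'. l' \<in> labels \<and> fst l' = next_cont l}"

definition digits :: "nat set" where
  "digits = (\<Union>l \<in> labels. (\<lambda>(k, y). prod_encode (k, prod_encode (num l, y))) ` entry l)"

definition regs :: "nat set" where
  "regs = {r. \<exists>l \<in> labels. (0, r) \<in> entry l}"

lemma finite_entry: "finite (entry l)"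
proof -
  have "{(3 :: nat, num l') | l'. l' \<in> labels \<and> fst l' = next_cont l} \<subseteq> (\<lambda>l'. (3, num l')) ` labels" by auto
  then have "finite {(3 :: nat, num l') | l'. l' \<in> labels \<and> fst l' = next_cont l}"
    using finite_labels finite_subset by blast
  then show ?thesis unfolding entry_def by (auto split: list.splits instr.splits prod.splits)
qed

lemma finite_digits: "finite digits"
  unfolding digits_def using finite_labels finite_entry by blast

lemma finite_regs: "finite regs"
proof (rule finite_subset)
  show "regs \<subseteq> snd ` (\<Union>l \<in> labels. entry l)" by (force simp: regs_def)
qed (use finite_labels finite_entry in blast)

definition bound :: nat where
  "bound = Suc (Max (insert 0 (num ` labels \<union> regs)))"

text \<open>The digit with first component 5 is unused; it only makes the code large.\<close>

definition code :: nat where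
  "code = set_encode (insert (prod_encode (5, prod_encode (bound, bound))) digits)"

lemma bound_le_code: "bound \<le> code"
proof -
  let ?b = "prod_encode (5, prod_encode (bound, bound))"
  have "bound \<le> ?b" by (meson le_prod_encode_2 order_trans)
  also have "?b \<le> 2 ^ ?b" by (simp add: less_imp_le)
  also have "\<dots> \<le> code" unfolding code_def set_encode_def
    by (rule member_le_sum) (auto simp: finite_digits)
  finally show ?thesis .
qed

lemma less_code: "x \<in> num ` labels \<union> regs \<Longrightarrow> x < code"
proof -
  assume x: "x \<in> num ` labels \<union> regs"
  have "finite (insert 0 (num ` labels \<union> regs))" using finite_labels finite_regs by simp
  then have "x \<le> Max (insert 0 (num ` labels \<union> regs))" using x by (intro Max_ge) auto
  then show ?thesis using bound_le_code unfolding bound_def by simp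
qed

lemma num_less: "l \<in> labels \<Longrightarrow> num l < code"
  using less_code by blast

lemma regs_less: "r \<in> regs \<Longrightarrow> r < code"
  using less_code by blast

lemma digit_code: "l \<in> labels \<Longrightarrow> k < 5 \<Longrightarrow> digit code k (num l) y \<longleftrightarrow> (k, y) \<in> entry l"
  using num(1) finite_digits unfolding digit_def code_def digits_def
  by (auto simp: set_encode_inverse prod_encode_eq inj_on_def)

lemma bits_of_label:
  assumes l: "(K, b) \<in> labels"
  shows "inc code (code + num (K, b)) r \<longleftrightarrow> (\<exists>K'. K = Inc r # K')"
    and "dec code (code + num (K, b)) r \<longleftrightarrow> (\<exists>C K'. K = Loop r C # K' \<and> b)"
    and "zero code (code + num (K, b)) r \<longleftrightarrow> (\<exists>C K'. K = Loop r C # K' \<and> \<not> b)"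
    and "isz code (code + num (K, b)) \<longleftrightarrow> (\<exists>r C K'. K = Loop r C # K' \<and> \<not> b)"
    and "fol code (code + num (K, b)) t' \<longleftrightarrow>
      (\<exists>l' \<in> labels. t' = code + num l' \<and> fst l' = next_cont (K, b))"
proof -
  have K: "K \<noteq> []" using l by (simp add: labels_def)
  have e: "digit code k (num (K, b)) y \<longleftrightarrow> (k, y) \<in> entry (K, b)" if "k < 5" for k y
    using digit_code[OF l that] .
  show "inc code (code + num (K, b)) r \<longleftrightarrow> (\<exists>K'. K = Inc r # K')"
    and "dec code (code + num (K, b)) r \<longleftrightarrow> (\<exists>C K'. K = Loop r C # K' \<and> b)"
    and "zero code (code + num (K, b)) r \<longleftrightarrow> (\<exists>C K'. K = Loop r C # K' \<and> \<not> b)"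
    and "isz code (code + num (K, b)) \<longleftrightarrow> (\<exists>r C K'. K = Loop r C # K' \<and> \<not> b)"
    unfolding inc_def dec_def zero_def isz_def using e[of 0] e[of 1] e[of 2] e[of 4] K
    by (auto simp: entry_def split: list.splits instr.splits if_splits)
  have "digit code 3 (num (K, b)) y \<longleftrightarrow> (\<exists>l' \<in> labels. y = num l' \<and> fst l' = next_cont (K, b))" for y
    using e[of 3] by (auto simp: entry_def split: list.splits instr.splits if_splits)
  then show "fol code (code + num (K, b)) t' \<longleftrightarrow>
      (\<exists>l' \<in> labels. t' = code + num l' \<and> fst l' = next_cont (K, b))"
  proof -
    assume *: "\<And>y. digit code 3 (num (K, b)) y \<longleftrightarrow> (\<exists>l' \<in> labels. y = num l' \<and> fst l' = next_cont (K, b))"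
    have "t' = code + x \<longleftrightarrow> \<not> t' < code \<and> t' - code = x" for x by auto
    then show ?thesis unfolding fol_def using * by auto
  qed
qed

lemma mstep_label:
  assumes l: "(K, b) \<in> labels" and c: "count c = \<sigma>"
  shows "mstep code (code + num (K, b)) c c' \<longleftrightarrow> b = branch (K, \<sigma>) \<and> count c' = snd (exec (K, \<sigma>))"
proof -
  have "K \<noteq> []" using l by (simp add: labels_def)
  then obtain i K' where K: "K = i # K'" by (cases K) auto
  note bits = bits_of_label(1-4)[OF l]
  show ?thesis
  proof (cases i)
    case (Inc r)
    then have "\<not> b" using l K by (auto simp: labels_def)
    then show ?thesis unfolding mstep_def bits using K Inc c
      by (auto simp: branch_def multiset_eq_iff fun_eq_iff)
  next
    case (Loop r C)
    have "c = add_mset r c' \<longleftrightarrow> \<sigma> r \<noteq> 0 \<and> count c' = \<sigma>(r := \<sigma> r - 1)"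
    proof
      assume "c = add_mset r c'"
      then show "\<sigma> r \<noteq> 0 \<and> count c' = \<sigma>(r := \<sigma> r - 1)" unfolding c[symmetric] by (auto simp: fun_eq_iff)
    next
      assume a: "\<sigma> r \<noteq> 0 \<and> count c' = \<sigma>(r := \<sigma> r - 1)"
      then show "c = add_mset r c'" using c by (intro multiset_eqI) auto
    qed
    moreover have "r \<notin># c \<longleftrightarrow> \<sigma> r = 0" unfolding c[symmetric] by (rule not_in_iff)
    moreover have "c' = c \<longleftrightarrow> count c' = \<sigma>" using c by (auto simp: multiset_eq_iff)
    ultimately show ?thesis unfolding mstep_def bits using K Loop
      by (cases b) (auto simp: branch_def)
  qed
qed

definition cfg :: "nat \<Rightarrow> instr list \<times> (nat \<Rightarrow> nat)" where
  "cfg j = (exec ^^ j) (P, (\<lambda>_. 0)(0 := code))"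

lemma cfg_Suc: "cfg (Suc j) = exec (cfg j)"
  by (simp add: cfg_def)

lemma mstep_prelude: "t < code \<Longrightarrow> mstep code t c c' \<longleftrightarrow> c' = add_mset 0 c"
  by (auto simp: mstep_def inc_def dec_def isz_def)

text \<open>After \<open>code\<close> prelude steps the trace has no choice but to follow
  \<open>cfg\<close>. At index \<open>code + T\<close> it would need a label for the empty
  continuation.\<close>

lemma trace_halts:
  assumes T: "fst (cfg T) = []" and tr: "trace code n t c"
  shows "n < code + T"
proof (rule ccontr)
  assume "\<not> n < code + T"
  then have n: "code + T \<le> n" by simp
  have tr_step: "mstep code (t i) (c i) (c (Suc i))" "fol code (t i) (t (Suc i))" if "i < n" for i
    using tr that by (auto simp: trace_def)
  have pre: "t i = i \<and> c i = replicate_mset i 0" if "i \<le> code" for i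
    using that
  proof (induction i)
    case 0
    then show ?case using tr by (simp add: trace_def)
  next
    case (Suc i)
    then have "mstep code i (replicate_mset i 0) (c (Suc i))" "fol code i (t (Suc i))"
      using tr_step[of i] n by simp_all
    then show ?case using Suc.prems by (simp add: mstep_prelude fol_def)
  qed
  have "\<exists>b. (fst (cfg j), b) \<in> labels \<and> t (code + j) = code + num (fst (cfg j), b) \<and>
      count (c (code + j)) = snd (cfg j)" if "j \<le> T" for j
    using that
  proof (induction j)
    case 0
    then show ?case using pre[of code] start_label num(2)
      by (auto simp: cfg_def fun_eq_iff intro!: exI[of _ False])
  next
    case (Suc j)
    then obtain b where b: "(fst (cfg j), b) \<in> labels" "t (code + j) = code + num (fst (cfg j), b)"
      "count (c (code + j)) = snd (cfg j)" by auto
    have m: "mstep code (t (code + j)) (c (code + j)) (c (code + Suc j))"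
      "fol code (t (code + j)) (t (code + Suc j))"
      using tr_step[of "code + j"] n Suc.prems by simp_all
    then have 1: "b = branch (cfg j)" "count (c (code + Suc j)) = snd (cfg (Suc j))"
      using mstep_label[OF b(1,3)] b(2) by (auto simp: cfg_Suc)
    obtain l' where "l' \<in> labels" "t (code + Suc j) = code + num l'" "fst l' = fst (cfg (Suc j))"
      using m(2) bits_of_label(5)[OF b(1)] b(2) 1(1) by (auto simp: cfg_Suc fst_exec)
    then show ?case using 1(2) by (metis prod.collapse)
  qed
  from this[of T] show False using T by (auto simp: labels_def)
qed

lemma trace_diverges:
  assumes run: "\<And>j. fst (cfg j) \<noteq> []"
  shows "\<exists>t c. (\<forall>n. trace code n t c) \<and> (\<forall>i. t i < width code \<and> pure code (t i) \<and> set_mset (c i) \<subseteq> {..<width code})"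
proof -
  \<comment> \<open>The labels of the trace carry the true outcomes of the loop tests as
    guesses.\<close>
  define b where "b = (\<lambda>j. branch (cfg j))"
  define L where "L = (\<lambda>j. (fst (cfg j), b j))"
  have L: "L j \<in> labels" for j
  proof -
    have "fst (cfg j) \<in> conts P"
      by (induction j) (auto simp: cfg_def self_in_conts fst_exec next_cont_in_conts)
    then show ?thesis using run[of j]
      by (auto simp: L_def labels_def b_def branch_def split: list.splits instr.splits)
  qed
  have "\<exists>M. count M = snd (cfg j)" for j
  proof (induction j)
    case 0
    show ?case by (intro exI[of _ "replicate_mset code 0"]) (auto simp: cfg_def fun_eq_iff)
  next
    case (Suc j)
    then obtain M where M: "count M = snd (cfg j)" by blast
    obtain K \<sigma> where K: "cfg j = (K, \<sigma>)" by (cases "cfg j")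
    have "\<exists>M'. count M' = snd (exec (K, \<sigma>))"
    proof (cases "(K, \<sigma>)" rule: exec.cases)
      case (2 r K' \<sigma>')
      then show ?thesis using M K by (intro exI[of _ "add_mset r M"]) auto
    next
      case (3 r C K' \<sigma>')
      show ?thesis
      proof (cases "\<sigma> r = 0")
        case False
        then show ?thesis using M K 3 by (intro exI[of _ "M - {#r#}"]) (auto simp: fun_eq_iff)
      qed (use M K 3 in auto)
    qed (use M K in auto)
    then show ?case by (simp add: cfg_Suc K)
  qed
  then obtain M where M: "\<And>j. count (M j) = snd (cfg j)" by metis
  define t where "t = (\<lambda>i. if i < code then i else code + num (L (i - code)))"
  define c where "c = (\<lambda>i. if i < code then replicate_mset i 0 else M (i - code))"
  have c0: "c i = replicate_mset i 0" if "i \<le> code" for i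
  proof (cases "i < code")
    case False
    then have "i = code" using that by simp
    moreover have "M 0 = replicate_mset code 0" by (rule multiset_eqI) (simp add: M cfg_def)
    ultimately show ?thesis by (simp add: c_def)
  qed (simp add: c_def)
  have t0: "t i = i" if "i \<le> code" for i
  proof (cases "i < code")
    case False
    then have "i = code" using that by simp
    moreover have "\<not> b 0" using P by (auto simp: b_def branch_def cfg_def)
    ultimately show ?thesis using num(2) by (simp add: t_def L_def cfg_def)
  qed (simp add: t_def)
  have step: "mstep code (t i) (c i) (c (Suc i)) \<and> fol code (t i) (t (Suc i))" for i
  proof (cases "i < code")
    case True
    then show ?thesis using t0[of i] t0[of "Suc i"] c0[of i] c0[of "Suc i"]
      by (simp add: mstep_prelude fol_def)
  next
    case False
    define j where "j = i - code"
    have i: "i = code + j" using False by (simp add: j_def)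
    have l: "(fst (cfg j), b j) \<in> labels" using L[of j] by (simp add: L_def)
    have "mstep code (t i) (c i) (c (Suc i))"
      using mstep_label[OF l M] M by (simp add: i t_def c_def L_def Suc_diff_le b_def cfg_Suc)
    moreover have "fol code (t i) (t (Suc i))"
      using bits_of_label(5)[OF l] L[of "Suc j"]
      by (auto simp: i t_def L_def Suc_diff_le b_def cfg_Suc fst_exec intro!: bexI[OF _ L[of "Suc j", unfolded L_def b_def cfg_Suc fst_exec]])
    ultimately show ?thesis by simp
  qed
  have "trace code n t c" for n
    using step t0[of 0] c0[of 0] by (simp add: trace_def)
  moreover have "t i < width code" for i
    using num_less[OF L[of "i - code"]] by (simp add: t_def width_def)
  moreover have "pure code (t i)" for i
  proof (cases "i < code")
    case True
    then show ?thesis using t0[of i] by (simp add: pure_def inc_def dec_def isz_def zero_def)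
  next
    case False
    have "(fst (cfg (i - code)), b (i - code)) \<in> labels" using L[of "i - code"] by (simp add: L_def)
    from bits_of_label(1-4)[OF this] show ?thesis using False by (auto simp: pure_def t_def L_def)
  qed
  moreover have "set_mset (c i) \<subseteq> {..<width code}" for i
  proof (induction i)
    case 0
    then show ?case using c0[of 0] by simp
  next
    case (Suc i)
    have "r < width code" if r: "inc code (t i) r" for r
    proof (cases "i < code")
      case True
      then show ?thesis using r t0[of i] by (simp add: inc_def width_def)
    next
      case False
      let ?K = "fst (cfg (i - code))"
      have l: "(?K, b (i - code)) \<in> labels" using L[of "i - code"] by (simp add: L_def)
      obtain K' where "?K = Inc r # K'"
        using r bits_of_label(1)[OF l] False by (auto simp: t_def L_def)
      then have "(0, r) \<in> entry (?K, b (i - code))" by (simp add: entry_def)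
      then have "r \<in> regs" using l unfolding regs_def by blast
      then show ?thesis using regs_less by (force simp: width_def)
    qed
    moreover have "mstep code (t i) (c i) (c (Suc i))" using step by blast
    ultimately show ?case using Suc unfolding mstep_def by auto
  qed
  ultimately show ?thesis by blast
qed

end

text \<open>The prelude puts the code itself into register 0, a program for \<open>h\<close>
  computes the value in register 1, and a last loop diverges on 1 and halts on 0.\<close>

theorem ex_code:
  "\<exists>e. (evaluates h [e] 0 \<longrightarrow> (\<exists>T. \<forall>n t c. trace e n t c \<longrightarrow> n < T)) \<and>
    (evaluates h [e] 1 \<longrightarrow> (\<exists>t c. (\<forall>n. trace e n t c) \<and>
      (\<forall>i. t i < width e \<and> pure e (t i) \<and> set_mset (c i) \<subseteq> {..<width e})))"
proof -
  obtain Q where Q: "implements [0] 1 2 Q h"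
    using implementableD[OF implementable, of "[0]" 2 1 h] by auto
  \<comment> \<open>The leading \<open>Inc\<close> makes \<open>(P, False)\<close> the only label of
    \<open>P\<close>; its effect is harmless, as \<open>Q\<close> overwrites register 1.\<close>
  define P where "P = Inc 1 # Q @ [Loop 1 [Inc 1]]"
  interpret program P by unfold_locales (auto simp: P_def)
  define \<sigma>0 :: "nat \<Rightarrow> nat" where "\<sigma>0 = ((\<lambda>_. 0)(0 := code))(1 := Suc 0)"
  have reach: "\<exists>n \<sigma>. cfg n = ([Loop 1 [Inc 1]], \<sigma>) \<and> \<sigma> 1 = v" if "evaluates h [code] v" for v
  proof -
    have "evaluates h (map \<sigma>0 [0]) v" using that by (simp add: \<sigma>0_def)
    from implementsD[OF Q this] obtain \<sigma> where \<sigma>: "runs Q \<sigma>0 \<sigma>" "\<sigma> 1 = v" by blast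
    then obtain n where "(exec ^^ n) (Q @ [Loop 1 [Inc 1]], \<sigma>0) = ([Loop 1 [Inc 1]], \<sigma>)"
      unfolding runs_def by blast
    moreover have "exec (P, (\<lambda>_. 0)(0 := code)) = (Q @ [Loop 1 [Inc 1]], \<sigma>0)"
      by (simp add: P_def \<sigma>0_def One_nat_def)
    ultimately have "cfg (Suc n) = ([Loop 1 [Inc 1]], \<sigma>)"
      unfolding cfg_def funpow_Suc_right comp_apply by simp
    then show ?thesis using \<sigma>(2) by blast
  qed
  have "\<exists>T. \<forall>n t c. trace code n t c \<longrightarrow> n < T" if "evaluates h [code] 0"
  proof -
    obtain n \<sigma> where n: "cfg n = ([Loop 1 [Inc 1]], \<sigma>)" "\<sigma> 1 = 0" using reach[OF \<open>evaluates h [code] 0\<close>] by blast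
    then have "fst (cfg (Suc n)) = []" by (simp add: cfg_Suc)
    then show ?thesis using trace_halts by blast
  qed
  moreover have "\<exists>t c. (\<forall>n. trace code n t c) \<and> (\<forall>i. t i < width code \<and> pure code (t i) \<and> set_mset (c i) \<subseteq> {..<width code})"
    if one: "evaluates h [code] 1"
  proof (rule trace_diverges)
    obtain n \<sigma> where n: "cfg n = ([Loop 1 [Inc 1]], \<sigma>)" "\<sigma> 1 = 1" using reach[OF one] by blast
    have cyc: "cfg (n + 2 * m) = ([Loop 1 [Inc 1]], \<sigma>)" for m
    proof (induction m)
      case (Suc m)
      have "cfg (n + 2 * Suc m) = exec (exec (cfg (n + 2 * m)))" by (simp add: cfg_Suc)
      also have "\<dots> = ([Loop 1 [Inc 1]], \<sigma>)" using Suc n(2) by (auto simp: fun_eq_iff One_nat_def)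
      finally show ?case .
    qed (use n in simp)
    have stop: "fst (cfg (j + i)) = []" if nil: "fst (cfg j) = []" for i j
    proof (induction i)
      case (Suc i)
      then show ?case by (cases "cfg (j + i)") (simp add: cfg_Suc)
    qed (use nil in simp)
    fix j show "fst (cfg j) \<noteq> []"
    proof
      assume "fst (cfg j) = []"
      then have "fst (cfg (j + (n + j))) = []" by (rule stop)
      moreover have "j + (n + j) = n + 2 * j" by simp
      ultimately show False using cyc[of j] by (metis fst_conv list.distinct(1))
    qed
  qed
  ultimately show ?thesis by blast
qed

section \<open>Words of configurations\<close>

text \<open>A state is a triple of class, label and register, packed in base \<open>width e\<close>:
  the tables of the instance need an initial segment of the numbers as states, and arithmetic that
  is evidently computable.\<close>

definition mk :: "nat \<Rightarrow> nat \<Rightarrow> nat \<Rightarrow> nat \<Rightarrow> nat" where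
  "mk e c t x = (c * width e + t) * width e + x"

definition cls :: "nat \<Rightarrow> nat \<Rightarrow> nat" where
  "cls e s = s div width e div width e"

definition tag :: "nat \<Rightarrow> nat \<Rightarrow> nat" where
  "tag e s = s div width e mod width e"

definition arg :: "nat \<Rightarrow> nat \<Rightarrow> nat" where
  "arg e s = s mod width e"

lemma width_pos: "0 < width e"
  by (simp add: width_def)

lemma tag_less: "tag e s < width e" and arg_less: "arg e s < width e"
  by (simp_all add: tag_def arg_def width_pos)

lemma mk_sel:
  assumes "t < width e" "x < width e"
  shows "cls e (mk e c t x) = c" "tag e (mk e c t x) = t" "arg e (mk e c t x) = x"
  using assms by (simp_all add: mk_def cls_def tag_def arg_def)

definition nstates :: "nat \<Rightarrow> nat" where
  "nstates e = 17 * width e * width e"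

lemma digits_less:
  assumes "c < n" "t < k"
  shows "c * k + t < n * (k :: nat)"
proof -
  have "c * k + t < Suc c * k" using assms(2) by simp
  also have "\<dots> \<le> n * k" using assms(1) by (intro mult_le_mono1) simp
  finally show ?thesis .
qed

lemma mk_less: "c < 17 \<Longrightarrow> t < width e \<Longrightarrow> x < width e \<Longrightarrow> mk e c t x < nstates e"
  unfolding mk_def nstates_def by (intro digits_less)

abbreviation st :: "nat \<Rightarrow> nat \<Rightarrow> nat" where
  "st e c \<equiv> mk e c 0 0"

text \<open>The classes of states are: 0 failure, 1 blank, 2 the letter \<open>a\<close>, 3 a register letter, 4 a label
  letter, 5 and 6 a label between matched registers before and after its operation was seen, 7 and 8 the
  same with an unmatched register on the right, 9 two linked configurations, 10 and 11 words of the
  first language with one \<open>a\<close> missing and complete, 12, 13 and 14 the same for the second language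
  with one, none and two \<open>a\<close> missing, 15 and 16 such a word followed by registers, and finally by
  a label.\<close>

definition mul :: "nat \<Rightarrow> nat \<Rightarrow> nat \<Rightarrow> nat" where
  "mul e s s' = (
    if s = st e 1 then s' else if s' = st e 1 then s
    else if cls e s = 3 then
      (if cls e s' = 4 \<or> cls e s' = 5 then (if dec e (tag e s') (arg e s) then mk e 6 (tag e s') 0 else 0)
       else if cls e s' = 7 \<and> arg e s = arg e s' then mk e 5 (tag e s') 0
       else if cls e s' = 8 \<and> arg e s = arg e s' then mk e 6 (tag e s') 0 else 0)
    else if cls e s' = 3 then
      (if cls e s = 5 \<or> cls e s = 4 \<and> \<not> isz e (tag e s) then
         (if inc e (tag e s) (arg e s') then mk e 6 (tag e s) 0 else mk e 7 (tag e s) (arg e s'))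
       else if cls e s = 6 \<or> cls e s = 4 then
         (if zero e (tag e s) (arg e s') then 0 else mk e 8 (tag e s) (arg e s'))
       else if cls e s = 13 \<or> cls e s = 15 then st e 15 else 0)
    else if cls e s' = 4 then
      (if (cls e s = 6 \<or> cls e s = 4 \<and> isz e (tag e s)) \<and> fol e (tag e s) (tag e s') then st e 9
       else if cls e s = 13 \<or> cls e s = 15 then st e 16 else 0)
    else if cls e s' = 9 then
      (if cls e s = 4 \<and> tag e s = 0 \<or> cls e s = 11 then st e 10
       else if cls e s = 2 then st e 12 else if cls e s = 13 then st e 14 else 0)
    else if cls e s = 2 then
      (if cls e s' = 10 then st e 11 else if cls e s' = 12 then st e 13
       else if cls e s' = 14 then st e 12 else 0)
    else 0)"

lemma mul_blank: "mul e (st e 1) s = s" "mul e s (st e 1) = s"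
proof -
  show 1: "mul e (st e 1) s = s" for s unfolding mul_def by (rule if_P) simp
  show "mul e s (st e 1) = s"
  proof (cases "s = st e 1")
    case False
    then show ?thesis unfolding mul_def by (simp only: if_False if_True refl cong: if_weak_cong)
  qed (simp only: 1)
qed

text \<open>Letter 1 is blank and 2 is \<open>a\<close>; then come \<open>width e\<close> register
  letters and \<open>width e\<close> label letters. Letter 0 is the binary node.\<close>

definition leaf_state :: "nat \<Rightarrow> nat \<Rightarrow> nat" where
  "leaf_state e a = (if a = 1 then st e 1 else if a = 2 then st e 2 else
    if a < 3 + width e then mk e 3 0 (a - 3) else mk e 4 (a - 3 - width e) 0)"

definition max_letter :: "nat \<Rightarrow> nat" where
  "max_letter e = 2 + 2 * width e"

lemma mul_less:
  assumes "s < nstates e" "s' < nstates e"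
  shows "mul e s s' < nstates e"
proof -
  have pos: "0 < nstates e" using width_pos by (simp add: nstates_def)
  have if_less: "a < n \<Longrightarrow> b < n \<Longrightarrow> (if Q then a else b) < n" for Q and a b n :: nat by simp
  show ?thesis unfolding mul_def
    by (intro if_less mk_less tag_less arg_less width_pos assms pos) simp_all
qed

lemma leaf_state_less: "1 \<le> a \<Longrightarrow> a \<le> max_letter e \<Longrightarrow> leaf_state e a < nstates e"
  using width_pos[of e] by (auto simp: leaf_state_def max_letter_def intro!: mk_less)

section \<open>The languages behind the states\<close>

definition word :: "nat \<Rightarrow> (nat list \<times> nat) list \<Rightarrow> nat list" where
  "word e ps = concat (map (\<lambda>(u, t). map (\<lambda>r. 3 + r) u @ [3 + width e + t]) ps)"

abbreviation bounded :: "nat \<Rightarrow> nat list \<Rightarrow> bool" where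
  "bounded e u \<equiv> set u \<subseteq> {..<width e}"

definition link :: "nat \<Rightarrow> nat list \<times> nat \<Rightarrow> nat list \<times> nat \<Rightarrow> bool" where
  "link e p q \<longleftrightarrow> bounded e (fst p) \<and> bounded e (fst q) \<and> mstep e (snd p) (mset (fst p)) (mset (fst q)) \<and> fol e (snd p) (snd q)"

definition flatten :: "('a \<times> 'a) list \<Rightarrow> 'a list" where
  "flatten qs = concat (map (\<lambda>(p, q). [p, q]) qs)"

definition linked :: "nat \<Rightarrow> ((nat list \<times> nat) \<times> (nat list \<times> nat)) list \<Rightarrow> bool" where
  "linked e qs \<longleftrightarrow> (\<forall>(p, q) \<in> set qs. link e p q)"

definition around :: "nat \<Rightarrow> nat list \<Rightarrow> nat \<Rightarrow> nat list \<Rightarrow> nat list" where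
  "around e u t v = map (\<lambda>r. 3 + r) u @ (3 + width e + t) # map (\<lambda>r. 3 + r) v"

text \<open>The numbers of letters \<open>a\<close> and of pairs are separate parameters, since
  within a tree they are out of balance by one or two until the missing letters are read.\<close>

definition lang1 :: "nat \<Rightarrow> nat \<Rightarrow> nat \<Rightarrow> nat list \<Rightarrow> bool" where
  "lang1 e m n w \<longleftrightarrow> (\<exists>qs. length qs = n \<and> linked e qs \<and> w = replicate m 2 @ word e (([], 0) # flatten qs))"

definition lang2 :: "nat \<Rightarrow> nat \<Rightarrow> nat \<Rightarrow> nat list \<Rightarrow> nat list \<Rightarrow> bool" where
  "lang2 e m n v w \<longleftrightarrow> (\<exists>qs. length qs = n \<and> linked e qs \<and> w = replicate m 2 @ word e (flatten qs) @ v)"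

text \<open>Only a necessary condition on the words that lead to a state; failure, class 0, imposes
  none. Not every word of the described form has to reach the state.\<close>

definition describes :: "nat \<Rightarrow> nat \<Rightarrow> nat \<Rightarrow> nat \<Rightarrow> nat list \<Rightarrow> bool" where
  "describes e c t x w \<longleftrightarrow>
    (c = 1 \<longrightarrow> w = []) \<and> (c = 2 \<longrightarrow> w = [2]) \<and> (c = 3 \<longrightarrow> w = [3 + x]) \<and> (c = 4 \<longrightarrow> w = [3 + width e + t]) \<and>
    (c = 5 \<longrightarrow> (\<exists>u v. w = around e u t v \<and> bounded e u \<and> bounded e v \<and> mset u = mset v)) \<and>
    (c = 6 \<longrightarrow> (\<exists>u v. w = around e u t v \<and> bounded e u \<and> bounded e v \<and> mstep e t (mset u) (mset v))) \<and>
    (c = 7 \<longrightarrow> (\<exists>u v. w = around e u t v @ [3 + x] \<and> bounded e u \<and> bounded e v \<and> mset u = mset v)) \<and>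
    (c = 8 \<longrightarrow> (\<exists>u v. w = around e u t v @ [3 + x] \<and> bounded e u \<and> bounded e v \<and> mstep e t (mset u) (mset v) \<and> \<not> zero e t x)) \<and>
    (c = 9 \<longrightarrow> (\<exists>p q. w = word e [p, q] \<and> link e p q)) \<and>
    (c = 10 \<longrightarrow> (\<exists>m. lang1 e m (Suc m) w)) \<and>
    (c = 11 \<longrightarrow> (\<exists>m. lang1 e m m w)) \<and>
    (c = 12 \<longrightarrow> (\<exists>m. lang2 e (2 * m + 1) (Suc m) [] w)) \<and>
    (c = 13 \<longrightarrow> (\<exists>m > 0. lang2 e (2 * m) m [] w)) \<and>
    (c = 14 \<longrightarrow> (\<exists>m. lang2 e (2 * m) (Suc m) [] w)) \<and>
    (c = 15 \<longrightarrow> (\<exists>m > 0. \<exists>u. bounded e u \<and> lang2 e (2 * m) m (map (\<lambda>r. 3 + r) u) w)) \<and>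
    (c = 16 \<longrightarrow> (\<exists>m > 0. \<exists>p. bounded e (fst p) \<and> lang2 e (2 * m) m (word e [p]) w))"

definition state_describes :: "nat \<Rightarrow> nat \<Rightarrow> nat list \<Rightarrow> bool" where
  "state_describes e s w = describes e (cls e s) (tag e s) (arg e s) w"

lemma state_describes_mk:
  "t < width e \<Longrightarrow> x < width e \<Longrightarrow> state_describes e (mk e c t x) w = describes e c t x w"
  by (simp add: state_describes_def mk_sel)

lemma state_describes_0: "state_describes e 0 w"
  by (simp add: state_describes_def describes_def cls_def)

lemma mstep_add: "mstep e t c c' \<Longrightarrow> \<not> zero e t x \<Longrightarrow> mstep e t (add_mset x c) (add_mset x c')"
  unfolding mstep_def by (auto simp: add_mset_commute)

lemma around_simps:
  "[3 + x] @ around e u t v @ w = around e (x # u) t v @ w"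
  "around e u t v @ [3 + x] = around e u t (v @ [x])"
  "[3 + width e + t] = around e [] t []"
  by (simp_all add: around_def)

lemma describes_simps:
  "describes e 0 t x w"
  "describes e 1 t x w \<longleftrightarrow> w = []"
  "describes e 2 t x w \<longleftrightarrow> w = [2]"
  "describes e 3 t x w \<longleftrightarrow> w = [3 + x]"
  "describes e 4 t x w \<longleftrightarrow> w = [3 + width e + t]"
  "describes e 5 t x w \<longleftrightarrow> (\<exists>u v. w = around e u t v \<and> bounded e u \<and> bounded e v \<and> mset u = mset v)"
  "describes e 6 t x w \<longleftrightarrow> (\<exists>u v. w = around e u t v \<and> bounded e u \<and> bounded e v \<and> mstep e t (mset u) (mset v))"
  "describes e 7 t x w \<longleftrightarrow> (\<exists>u v. w = around e u t v @ [3 + x] \<and> bounded e u \<and> bounded e v \<and> mset u = mset v)"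
  "describes e 8 t x w \<longleftrightarrow> (\<exists>u v. w = around e u t v @ [3 + x] \<and> bounded e u \<and> bounded e v \<and> mstep e t (mset u) (mset v) \<and> \<not> zero e t x)"
  "describes e 9 t x w \<longleftrightarrow> (\<exists>p q. w = word e [p, q] \<and> link e p q)"
  "describes e 10 t x w \<longleftrightarrow> (\<exists>m. lang1 e m (Suc m) w)"
  "describes e 11 t x w \<longleftrightarrow> (\<exists>m. lang1 e m m w)"
  "describes e 12 t x w \<longleftrightarrow> (\<exists>m. lang2 e (2 * m + 1) (Suc m) [] w)"
  "describes e 13 t x w \<longleftrightarrow> (\<exists>m > 0. lang2 e (2 * m) m [] w)"
  "describes e 14 t x w \<longleftrightarrow> (\<exists>m. lang2 e (2 * m) (Suc m) [] w)"
  "describes e 15 t x w \<longleftrightarrow> (\<exists>m > 0. \<exists>u. bounded e u \<and> lang2 e (2 * m) m (map (\<lambda>r. 3 + r) u) w)"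
  "describes e 16 t x w \<longleftrightarrow> (\<exists>m > 0. \<exists>p. bounded e (fst p) \<and> lang2 e (2 * m) m (word e [p]) w)"
  by (simp_all add: describes_def)

lemma word_append: "word e (ps @ qs) = word e ps @ word e qs"
  by (simp add: word_def)

lemma lang1_block:
  assumes "lang1 e m n w" "link e p q"
  shows "lang1 e m (Suc n) (w @ word e [p, q])"
proof -
  obtain qs where "length qs = n" "linked e qs" "w = replicate m 2 @ word e (([], 0) # flatten qs)"
    using assms(1) by (auto simp: lang1_def)
  then show ?thesis using assms(2) unfolding lang1_def
    by (intro exI[of _ "qs @ [(p, q)]"]) (auto simp: linked_def flatten_def word_def)
qed

lemma lang2_block:
  assumes "lang2 e m n [] w" "link e p q"
  shows "lang2 e m (Suc n) [] (w @ word e [p, q])"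
proof -
  obtain qs where "length qs = n" "linked e qs" "w = replicate m 2 @ word e (flatten qs)"
    using assms(1) by (auto simp: lang2_def)
  then show ?thesis using assms(2) unfolding lang2_def
    by (intro exI[of _ "qs @ [(p, q)]"]) (auto simp: linked_def flatten_def word_def)
qed

lemma lang1_a: "lang1 e m n w \<Longrightarrow> lang1 e (Suc m) n ([2] @ w)"
  by (auto simp: lang1_def)

lemma lang2_a: "lang2 e m n v w \<Longrightarrow> lang2 e (Suc m) n v ([2] @ w)"
  by (auto simp: lang2_def)

lemma lang2_end: "lang2 e m n v w \<Longrightarrow> lang2 e m n (v @ v') (w @ v')"
  by (auto simp: lang2_def)

text \<open>A pair is assembled from its first label outwards. A register on the right stays pending
  (classes 7 and 8) until the same register comes from the left, which preserves equality of
  multisets before the operation and \<open>mstep\<close> after it; the incremented or decremented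
  register is the one left without a partner.\<close>

theorem mul_describes:
  assumes "state_describes e s w" "state_describes e s' w'"
  shows "state_describes e (mul e s s') (w @ w')"
proof -
  define c t x c' t' x' where defs: "c = cls e s" "t = tag e s" "x = arg e s"
    "c' = cls e s'" "t' = tag e s'" "x' = arg e s'"
  have D: "describes e c t x w" "describes e c' t' x' w'"
    using assms by (simp_all add: state_describes_def defs)
  have less: "t < width e" "x < width e" "t' < width e" "x' < width e"
    by (simp_all add: defs tag_less arg_less)
  note mk = state_describes_mk[OF less(1) width_pos] state_describes_mk[OF less(1) less(4)]
    state_describes_mk[OF less(3) width_pos] state_describes_mk[OF width_pos width_pos]
  have 36: "describes e 6 t' 0 (w @ w')" if c: "c = 3" "c' = 4 \<or> c' = 5" "dec e t' x"
  proof -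
    obtain u v where uv: "w' = around e u t' v" "bounded e u" "bounded e v" "mset u = mset v"
      using D(2) c(2) around_simps(3) unfolding describes_simps by (auto simp: describes_simps)
    have "mstep e t' (mset (x # u)) (mset v)" using uv(4) c(3) by (auto simp: mstep_def)
    moreover have "bounded e (x # u)" using uv(2) less(2) by simp
    moreover have "w @ w' = around e (x # u) t' v"
      using D(1) c(1) uv(1) around_simps(1)[of x e u t' v "[]"] by (simp add: describes_simps)
    ultimately show ?thesis using uv(3) unfolding describes_simps by blast
  qed
  have 37: "describes e 5 t' 0 (w @ w')" if c: "c = 3" "c' = 7" "x = x'"
  proof -
    obtain u v where uv: "w' = around e u t' v @ [3 + x]" "bounded e u" "bounded e v" "mset u = mset v"
      using D(2) c by (auto simp: describes_simps)
    then have "w @ w' = around e (x # u) t' (v @ [x])" "mset (x # u) = mset (v @ [x])"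
      "bounded e (x # u)" "bounded e (v @ [x])"
      using D(1) c(1) less(2) by (simp_all add: describes_simps around_def)
    then show ?thesis unfolding describes_simps by blast
  qed
  have 38: "describes e 6 t' 0 (w @ w')" if c: "c = 3" "c' = 8" "x = x'"
  proof -
    obtain u v where uv: "w' = around e u t' v @ [3 + x]" "bounded e u" "bounded e v" "mstep e t' (mset u) (mset v)" "\<not> zero e t' x"
      using D(2) c by (auto simp: describes_simps)
    then have "w @ w' = around e (x # u) t' (v @ [x])" "mstep e t' (mset (x # u)) (mset (v @ [x]))"
      "bounded e (x # u)" "bounded e (v @ [x])"
      using D(1) c(1) mstep_add less(2) by (simp_all add: describes_simps around_def)
    then show ?thesis unfolding describes_simps by blast
  qed
  have 4: "\<exists>u v. w = around e u t v \<and> bounded e u \<and> bounded e v \<and> mset u = mset v" if c: "c = 5 \<or> c = 4"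
  proof (cases "c = 5")
    case False
    then have "w = around e [] t []" "bounded e []" "mset [] = mset []"
      using D(1) c by (auto simp: describes_simps around_def)
    then show ?thesis by blast
  qed (use D(1) in \<open>simp add: describes_simps\<close>)
  have 63: "describes e 6 t 0 (w @ w')" if c: "c = 5 \<or> c = 4" "c' = 3" "inc e t x'"
  proof -
    obtain u v where uv: "w = around e u t v" "bounded e u" "bounded e v" "mset u = mset v" using 4[OF c(1)] by blast
    then have "w @ w' = around e u t (v @ [x'])" "mstep e t (mset u) (mset (v @ [x']))" "bounded e (v @ [x'])"
      using D(2) c(2,3) less(4) by (auto simp: describes_simps around_def mstep_def)
    then show ?thesis using uv(2) unfolding describes_simps by blast
  qed
  have 73: "describes e 7 t x' (w @ w')" if c: "c = 5 \<or> c = 4" "c' = 3"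
    using 4[OF c(1)] D(2) c(2) by (auto simp: describes_simps)
  have 6: "\<exists>u v. w = around e u t v \<and> bounded e u \<and> bounded e v \<and> mstep e t (mset u) (mset v)" if c: "c = 6 \<or> c = 4 \<and> isz e t"
  proof (cases "c = 6")
    case False
    then have "w = around e [] t []" "mstep e t (mset []) (mset [])" "bounded e []"
      using c D(1) by (auto simp: describes_simps around_def mstep_def)
    then show ?thesis by blast
  qed (use D(1) in \<open>simp add: describes_simps\<close>)
  have 83: "describes e 8 t x' (w @ w')" if c: "c = 6 \<or> c = 4 \<and> isz e t" "c' = 3" "\<not> zero e t x'"
    using 6[OF c(1)] D(2) c(2,3) by (auto simp: describes_simps)
  have 94: "describes e 9 0 0 (w @ w')" if c: "c = 6 \<or> c = 4 \<and> isz e t" "c' = 4" "fol e t t'"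
  proof -
    obtain u v where uv: "w = around e u t v" "bounded e u" "bounded e v" "mstep e t (mset u) (mset v)" using 6[OF c(1)] by blast
    then have "w @ w' = word e [(u, t), (v, t')]" "link e (u, t) (v, t')"
      using D(2) c(2,3) by (auto simp: describes_simps around_def word_def link_def)
    then show ?thesis unfolding describes_simps by blast
  qed
  have 153: "describes e 15 0 0 (w @ w')" if c: "c = 13 \<or> c = 15" "c' = 3"
  proof -
    obtain m u where "0 < m" "bounded e u" "lang2 e (2 * m) m (map (\<lambda>r. 3 + r) u) w"
      using D(1) c(1) by (auto simp: describes_simps) (metis list.map(1) empty_subsetI list.set(1))+
    moreover have "map (\<lambda>r. 3 + r) u @ w' = map (\<lambda>r. 3 + r) (u @ [x'])"
      using D(2) c(2) by (simp add: describes_simps)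
    moreover have "bounded e (u @ [x'])" using \<open>bounded e u\<close> less(4) by simp
    ultimately show ?thesis using lang2_end unfolding describes_simps by metis
  qed
  have 164: "describes e 16 0 0 (w @ w')" if c: "c = 13 \<or> c = 15" "c' = 4"
  proof -
    obtain m u where "0 < m" "bounded e u" "lang2 e (2 * m) m (map (\<lambda>r. 3 + r) u) w"
      using D(1) c(1) by (auto simp: describes_simps) (metis list.map(1) empty_subsetI list.set(1))+
    moreover have "map (\<lambda>r. 3 + r) u @ w' = word e [(u, t')]"
      using D(2) c(2) by (simp add: describes_simps word_def)
    moreover have "bounded e (fst (u, t'))" using \<open>bounded e u\<close> by simp
    ultimately show ?thesis using lang2_end unfolding describes_simps by metis
  qed
  have 109: "describes e 10 0 0 (w @ w')" if c: "c = 4 \<and> t = 0 \<or> c = 11" "c' = 9"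
  proof -
    obtain p q where pq: "w' = word e [p, q]" "link e p q" using D(2) c(2) by (auto simp: describes_simps)
    have "\<exists>m. lang1 e m m w"
    proof (cases "c = 11")
      case False
      then have "lang1 e 0 0 w" using D(1) c(1) by (auto simp: describes_simps lang1_def linked_def flatten_def word_def)
      then show ?thesis by blast
    qed (use D(1) in \<open>simp add: describes_simps\<close>)
    then show ?thesis using lang1_block[OF _ pq(2)] unfolding describes_simps pq(1) by blast
  qed
  have 129: "describes e 12 0 0 (w @ w')" if c: "c = 2" "c' = 9"
  proof -
    obtain p q where pq: "w' = word e [p, q]" "link e p q" using D(2) c(2) by (auto simp: describes_simps)
    then have "lang2 e (2 * 0 + 1) (Suc 0) [] (w @ w')" using D(1) c(1) unfolding lang2_def
      by (intro exI[of _ "[(p, q)]"]) (auto simp: describes_simps linked_def flatten_def)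
    then show ?thesis unfolding describes_simps by blast
  qed
  have 149: "describes e 14 0 0 (w @ w')" if c: "c = 13" "c' = 9"
    using D c lang2_block unfolding describes_simps by (auto simp: describes_simps) blast
  have 211: "describes e 11 0 0 (w @ w')" if c: "c = 2" "c' = 10"
  proof -
    obtain m where "lang1 e m (Suc m) w'" using D(2) c(2) by (auto simp: describes_simps)
    from lang1_a[OF this] have "lang1 e (Suc m) (Suc m) (w @ w')"
      using D(1) c(1) by (simp add: describes_simps)
    then show ?thesis unfolding describes_simps by blast
  qed
  have 213: "describes e 13 0 0 (w @ w')" if c: "c = 2" "c' = 12"
  proof -
    obtain m where "lang2 e (2 * m + 1) (Suc m) [] w'" using D(2) c(2) by (auto simp: describes_simps)
    from lang2_a[OF this] have "lang2 e (2 * Suc m) (Suc m) [] (w @ w')"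
      using D(1) c(1) by (simp add: describes_simps)
    then show ?thesis unfolding describes_simps by blast
  qed
  have 212: "describes e 12 0 0 (w @ w')" if c: "c = 2" "c' = 14"
  proof -
    obtain m where "lang2 e (2 * m) (Suc m) [] w'" using D(2) c(2) by (auto simp: describes_simps)
    from lang2_a[OF this] have "lang2 e (2 * m + 1) (Suc m) [] (w @ w')"
      using D(1) c(1) by (simp add: describes_simps)
    then show ?thesis unfolding describes_simps by blast
  qed
  have E: "state_describes e (st e 1) v \<longleftrightarrow> v = []" for v
    using mk(4) by (simp only: describes_simps)
  show ?thesis
  proof (cases "s = st e 1 \<or> s' = st e 1")
    case True
    then show ?thesis
    proof
      assume s: "s = st e 1"
      then have "w = []" using assms(1) E by blast
      then show ?thesis using assms(2) s by (simp only: mul_blank append_Nil)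
    next
      assume s: "s' = st e 1"
      then have "w' = []" using assms(2) E by blast
      then show ?thesis using assms(1) s by (simp only: mul_blank append_Nil2)
    qed
  next
    case False
    have if_split: "state_describes e (if Q then a else b) v"
      if "Q \<Longrightarrow> state_describes e a v" "\<not> Q \<Longrightarrow> state_describes e b v" for Q a b v
      using that by simp
    show ?thesis unfolding mul_def defs(1-6)[symmetric]
      by (intro if_split; (simp only: mk state_describes_0)?;
        (rule 36 37 38 63 73 83 94 153 164 109 129 149 211 213 212; blast)?; (use False in blast)?)
  qed
qed

section \<open>Computability of the instance\<close>

text \<open>One index runs through the whole table, first the leaves and then all pairs of states by
  division with remainder, which is the form that \<open>computable_list_encode\<close>
  handles.\<close>

definition rule :: "nat \<Rightarrow> nat \<Rightarrow> nat \<times> nat list \<times> nat" where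
  "rule e i = (if i < max_letter e then (Suc i, [], leaf_state e (Suc i))
    else (0, [(i - max_letter e) div nstates e, (i - max_letter e) mod nstates e],
      mul e ((i - max_letter e) div nstates e) ((i - max_letter e) mod nstates e)))"

definition rules :: "nat \<Rightarrow> (nat \<times> nat list \<times> nat) list" where
  "rules e = map (rule e) [0..<max_letter e + nstates e * nstates e]"

definition table :: "nat \<Rightarrow> nat \<Rightarrow> dbta_table" where
  "table e c = (nstates e, [st e c], rules e)"

definition input :: "nat \<Rightarrow> separation_input" where
  "input e = (2 # replicate (max_letter e) 0, table e 11, table e 16)"

lemma nstates_pos: "0 < nstates e"
  using width_pos by (simp add: nstates_def)

lemma rules_iff:
  "(a, qs, q) \<in> set (rules e) \<longleftrightarrow>
    1 \<le> a \<and> a \<le> max_letter e \<and> qs = [] \<and> q = leaf_state e a \<or>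
    a = 0 \<and> (\<exists>s < nstates e. \<exists>s' < nstates e. qs = [s, s'] \<and> q = mul e s s')"
proof
  assume "(a, qs, q) \<in> set (rules e)"
  then obtain i where i: "i < max_letter e + nstates e * nstates e" "(a, qs, q) = rule e i"
    by (auto simp: rules_def)
  show "1 \<le> a \<and> a \<le> max_letter e \<and> qs = [] \<and> q = leaf_state e a \<or>
    a = 0 \<and> (\<exists>s < nstates e. \<exists>s' < nstates e. qs = [s, s'] \<and> q = mul e s s')"
  proof (cases "i < max_letter e")
    case False
    then have "(i - max_letter e) div nstates e < nstates e"
      using i(1) by (intro less_mult_imp_div_less) auto
    moreover have "(i - max_letter e) mod nstates e < nstates e" using nstates_pos by simp
    ultimately show ?thesis using False i(2) by (auto simp: rule_def)
  qed (use i in \<open>auto simp: rule_def\<close>)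
next
  assume "1 \<le> a \<and> a \<le> max_letter e \<and> qs = [] \<and> q = leaf_state e a \<or>
    a = 0 \<and> (\<exists>s < nstates e. \<exists>s' < nstates e. qs = [s, s'] \<and> q = mul e s s')"
  then show "(a, qs, q) \<in> set (rules e)"
  proof (elim disjE conjE exE)
    assume a: "1 \<le> a" "a \<le> max_letter e" "qs = []" "q = leaf_state e a"
    then have "(a, qs, q) = rule e (a - 1)" by (auto simp: rule_def)
    then show ?thesis using a unfolding rules_def by auto
  next
    fix s s' assume s: "a = 0" "s < nstates e" "s' < nstates e" "qs = [s, s']" "q = mul e s s'"
    let ?i = "max_letter e + (s * nstates e + s')"
    have "(a, qs, q) = rule e ?i" using s by (simp add: rule_def)
    moreover have "?i < max_letter e + nstates e * nstates e"
      using digits_less[OF s(2,3)] by simp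
    ultimately show ?thesis unfolding rules_def by auto
  qed
qed

lemma tuples_2: "qs \<in> tuples Q 2 \<longleftrightarrow> (\<exists>s \<in> Q. \<exists>s' \<in> Q. qs = [s, s'])"
  by (auto simp: tuples_def length_Suc_conv numeral_2_eq_2)

lemma tuples_0: "qs \<in> tuples Q 0 \<longleftrightarrow> qs = []"
  by (auto simp: tuples_def)

lemma valid_table:
  assumes "c < 17"
  shows "valid_dbta_table (bin_alphabet (max_letter e)) (table e c)"
proof -
  let ?\<Sigma> = "bin_alphabet (max_letter e)"
  have "st e c < nstates e" using assms width_pos by (intro mk_less)
  moreover have "a \<in> letters ?\<Sigma> \<and> qs \<in> tuples {..<nstates e} (arity ?\<Sigma> a) \<and> q < nstates e"
    if "(a, qs, q) \<in> set (rules e)" for a qs q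
  proof -
    have a: "a \<in> letters ?\<Sigma>" using that unfolding rules_iff by (auto simp: letters_bin_alphabet)
    show ?thesis using that a unfolding rules_iff arity_bin_alphabet[OF a]
      by (auto simp: tuples_0 tuples_2 leaf_state_less mul_less)
  qed
  moreover have "\<exists>!q. (a, qs, q) \<in> set (rules e)"
    if a: "a \<in> letters ?\<Sigma>" and qs: "qs \<in> tuples {..<nstates e} (arity ?\<Sigma> a)" for a qs
  proof (cases "a = 0")
    case True
    then show ?thesis using qs unfolding rules_iff arity_bin_alphabet[OF a] by (auto simp: tuples_2)
  next
    case False
    then show ?thesis using qs a unfolding rules_iff arity_bin_alphabet[OF a]
      by (auto simp: tuples_0 letters_bin_alphabet)
  qed
  ultimately show ?thesis unfolding valid_dbta_table_def table_def prod.case by auto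
qed

lemma input_in: "input e \<in> separation_inputs"
  using valid_table by (simp add: separation_inputs_def input_def)

lemma delta_leaf:
  "1 \<le> a \<Longrightarrow> a \<le> max_letter e \<Longrightarrow> dbta_delta (dbta_of (table e c)) a [] = leaf_state e a"
  by (simp add: dbta_of_def table_def rules_iff)

lemma delta_node:
  "s < nstates e \<Longrightarrow> s' < nstates e \<Longrightarrow> dbta_delta (dbta_of (table e c)) 0 [s, s'] = mul e s s'"
  by (simp add: dbta_of_def table_def rules_iff)

lemma computable_width: "computable m e \<Longrightarrow> computable m (\<lambda>xs. width (e xs))"
  unfolding width_def by (intro computable_intros)

lemma computable_mk:
  "computable m e \<Longrightarrow> computable m c \<Longrightarrow> computable m t \<Longrightarrow> computable m x \<Longrightarrow>
    computable m (\<lambda>xs. mk (e xs) (c xs) (t xs) (x xs))"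
  unfolding mk_def by (intro computable_intros computable_width)

lemma computable_cls: "computable m e \<Longrightarrow> computable m s \<Longrightarrow> computable m (\<lambda>xs. cls (e xs) (s xs))"
  and computable_tag: "computable m e \<Longrightarrow> computable m s \<Longrightarrow> computable m (\<lambda>xs. tag (e xs) (s xs))"
  and computable_arg: "computable m e \<Longrightarrow> computable m s \<Longrightarrow> computable m (\<lambda>xs. arg (e xs) (s xs))"
  and computable_nstates: "computable m e \<Longrightarrow> computable m (\<lambda>xs. nstates (e xs))"
  and computable_max_letter: "computable m e \<Longrightarrow> computable m (\<lambda>xs. max_letter (e xs))"
  unfolding cls_def tag_def arg_def nstates_def max_letter_def
  by (intro computable_intros computable_width; assumption)+

lemma decidable_digit:
  "computable m e \<Longrightarrow> computable m t \<Longrightarrow> computable m r \<Longrightarrow> decidable m (\<lambda>xs. digit (e xs) k (t xs) (r xs))"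
  unfolding digit_def by (intro computable_intros)

lemma decidable_operations:
  "computable m e \<Longrightarrow> computable m t \<Longrightarrow> computable m r \<Longrightarrow> decidable m (\<lambda>xs. inc (e xs) (t xs) (r xs))"
  "computable m e \<Longrightarrow> computable m t \<Longrightarrow> computable m r \<Longrightarrow> decidable m (\<lambda>xs. dec (e xs) (t xs) (r xs))"
  "computable m e \<Longrightarrow> computable m t \<Longrightarrow> computable m r \<Longrightarrow> decidable m (\<lambda>xs. zero (e xs) (t xs) (r xs))"
  "computable m e \<Longrightarrow> computable m t \<Longrightarrow> decidable m (\<lambda>xs. isz (e xs) (t xs))"
  "computable m e \<Longrightarrow> computable m t \<Longrightarrow> computable m r \<Longrightarrow> decidable m (\<lambda>xs. fol (e xs) (t xs) (r xs))"
  unfolding inc_def dec_def zero_def isz_def fol_def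
  by (intro computable_intros decidable_digit; assumption)+

lemma computable_mul:
  "computable m e \<Longrightarrow> computable m s \<Longrightarrow> computable m s' \<Longrightarrow> computable m (\<lambda>xs. mul (e xs) (s xs) (s' xs))"
  unfolding mul_def
  by (intro computable_intros computable_mk computable_cls computable_tag computable_arg
    decidable_operations; assumption)

lemma computable_leaf_state:
  "computable m e \<Longrightarrow> computable m a \<Longrightarrow> computable m (\<lambda>xs. leaf_state (e xs) (a xs))"
  unfolding leaf_state_def
  by (intro computable_intros computable_mk computable_width; assumption)

lemma computable_tl_nth: "Suc i < m \<Longrightarrow> computable m (\<lambda>ys. tl ys ! i)"
  by (rule computable_cong[OF _ computable_nth[of "Suc i"]]) (simp_all add: nth_tl)

lemma encode_rule_rule: "encode_rule (rule e i) = (if i < max_letter e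
    then prod_encode (Suc i, prod_encode (0, leaf_state e (Suc i)))
    else prod_encode (0, prod_encode (Suc (prod_encode ((i - max_letter e) div nstates e,
      Suc (prod_encode ((i - max_letter e) mod nstates e, 0)))),
      mul e ((i - max_letter e) div nstates e) ((i - max_letter e) mod nstates e))))"
  by (simp add: encode_rule_def rule_def)

lemma computable_table: "computable 1 (\<lambda>xs. encode_table (table (xs ! 0) c))"
proof -
  have e: "computable 2 (\<lambda>ys. tl ys ! 0)" "computable 2 (\<lambda>ys. ys ! 0)" "computable 1 (\<lambda>xs. xs ! 0)"
    by (auto intro: computable_tl_nth computable_nth)
  have "computable (Suc 1) (\<lambda>ys. encode_rule (rule (tl ys ! 0) (ys ! 0)))"
    unfolding encode_rule_rule using e(1,2)
    by (simp add: numeral_2_eq_2 flip: numeral_2_eq_2)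
      (intro computable_intros computable_max_letter computable_nstates computable_mul computable_leaf_state; assumption)
  then have "computable 1 (\<lambda>xs. list_encode (map (\<lambda>i. encode_rule (rule (xs ! 0) i))
      [0..<max_letter (xs ! 0) + nstates (xs ! 0) * nstates (xs ! 0)]))"
    using e(3) by (intro computable_list_encode computable_intros computable_max_letter computable_nstates)
  then have "computable 1 (\<lambda>xs. list_encode (map encode_rule (rules (xs ! 0))))"
    by (simp add: rules_def comp_def)
  then show ?thesis unfolding encode_table_def table_def prod.case list_encode.simps
    using e(3) by (intro computable_intros computable_nstates computable_mk)
qed

theorem computable_input: "computable 1 (\<lambda>xs. encode_input (input (xs ! 0)))"
proof -
  have ars: "2 # replicate k 0 = map (\<lambda>i. if i = 0 then 2 else 0) [0..<Suc k]" for k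
    by (rule nth_equalityI) (auto simp: nth_Cons' simp del: upt_Suc)
  have "computable (Suc 1) (\<lambda>ys. if ys ! 0 = 0 then 2 else 0)"
    by (intro computable_intros computable_nth) simp
  then have "computable 1 (\<lambda>xs. list_encode (map (\<lambda>i. if i = 0 then 2 else 0) [0..<Suc (max_letter (xs ! 0))]))"
    by (intro computable_list_encode computable_intros computable_max_letter computable_nth) simp_all
  then show ?thesis unfolding encode_input_def input_def prod.case ars[symmetric]
    by (intro computable_intros computable_table)
qed

section \<open>Diverging machines are not separable\<close>

declare One_nat_def [simp del]

primrec yield :: "nat tree \<Rightarrow> nat list" where
  "yield (Node a ts) = (if a = 0 then concat (map yield ts) else if a = 1 then [] else [a])"

abbreviation \<Sigma> :: "nat \<Rightarrow> nat ranked_alphabet" where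
  "\<Sigma> e \<equiv> bin_alphabet (max_letter e)"

abbreviation state_of :: "nat \<Rightarrow> nat \<Rightarrow> nat tree \<Rightarrow> nat" where
  "state_of e c \<equiv> dbta_state_of (dbta_of (table e c))"

abbreviation language :: "nat \<Rightarrow> nat \<Rightarrow> nat tree set" where
  "language e c \<equiv> dbta_language (\<Sigma> e) (dbta_of (table e c))"

lemma language_iff: "t \<in> language e c \<longleftrightarrow> t \<in> trees (\<Sigma> e) \<and> state_of e c t = st e c"
  by (auto simp: dbta_language_def dbta_of_def table_def)

lemma bin_trees_cases:
  assumes "t \<in> trees (bin_alphabet k)"
  obtains a where "1 \<le> a" "a \<le> k" "t = Node a []"
    | t1 t2 where "t = Node 0 [t1, t2]" "t1 \<in> trees (bin_alphabet k)" "t2 \<in> trees (bin_alphabet k)"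
  using assms
proof cases
  case (1 a ts)
  show thesis
  proof (cases "a = 0")
    case True
    then have "length ts = 2" using 1(2,3) arity_bin_alphabet[OF 1(2)] by simp
    then obtain t1 t2 where "ts = [t1, t2]"
      by (cases ts; cases "tl ts"; cases "tl (tl ts)") auto
    then show thesis using that(2) 1 True by auto
  next
    case False
    then have "ts = []" "a \<le> k" using 1(2,3) arity_bin_alphabet[OF 1(2)] by (auto simp: letters_bin_alphabet)
    then show thesis using that(1) 1(1) False by simp
  qed
qed

lemma bin_trees_induct [consumes 1, case_names leaf node]:
  assumes "t \<in> trees (bin_alphabet k)"
    and leaf: "\<And>a. 1 \<le> a \<Longrightarrow> a \<le> k \<Longrightarrow> P (Node a [])"
    and node: "\<And>t1 t2. t1 \<in> trees (bin_alphabet k) \<Longrightarrow> t2 \<in> trees (bin_alphabet k) \<Longrightarrow>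
      P t1 \<Longrightarrow> P t2 \<Longrightarrow> P (Node 0 [t1, t2])"
  shows "P t"
  using assms(1)
proof (induction t rule: tree.induct)
  case (Node a ts)
  from Node.prems show ?case
  proof (cases rule: bin_trees_cases)
    case (1 b)
    then show ?thesis using leaf by simp
  next
    case (2 t1 t2)
    then show ?thesis using node Node.IH by simp
  qed
qed

lemma leaf_describes:
  assumes "1 \<le> a" "a \<le> max_letter e"
  shows "state_describes e (leaf_state e a) (if a = 1 then [] else [a])"
proof -
  have "a - 3 < width e" if "a < 3 + width e" using that width_pos[of e] by linarith
  moreover have "a - 3 - width e < width e" using assms(2) width_pos[of e] by (simp add: max_letter_def)
  moreover have "a = 1 \<or> a = 2 \<or> 3 \<le> a" using assms(1) by linarith
  ultimately show ?thesis using width_pos[of e]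
    by (auto simp: leaf_state_def state_describes_mk describes_simps)
qed

lemma state_sound:
  assumes "t \<in> trees (\<Sigma> e)"
  shows "state_of e c t < nstates e \<and> state_describes e (state_of e c t) (yield t)"
  using assms
proof (induction rule: bin_trees_induct)
  case (leaf a)
  then show ?case using leaf_describes leaf_state_less by (auto simp: delta_leaf)
next
  case (node t1 t2)
  then show ?case using mul_describes[of e "state_of e c t1" "yield t1" "state_of e c t2" "yield t2"]
    by (simp add: delta_node mul_less)
qed

lemma language_11_sound: "t \<in> language e 11 \<Longrightarrow> \<exists>m. lang1 e m m (yield t)"
  using state_sound[of t e 11] width_pos
  by (auto simp: language_iff state_describes_mk describes_simps)

lemma language_16_sound: "t \<in> language e 16 \<Longrightarrow> \<exists>m > 0. \<exists>p. bounded e (fst p) \<and> lang2 e (2 * m) m (word e [p]) (yield t)"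
  using state_sound[of t e 16] width_pos
  by (auto simp: language_iff state_describes_mk describes_simps)

section \<open>States of trees built from a computation\<close>

primrec ev :: "nat \<Rightarrow> pat \<Rightarrow> nat" where
  "ev e (Hole h) = 0"
| "ev e (Leaf a) = leaf_state e a"
| "ev e (Bin p q) = mul e (ev e p) (ev e q)"

lemma tr_in_trees:
  assumes "hl p = []" "set (leaves p) \<subseteq> {1..k}"
  shows "tr p \<in> trees (bin_alphabet k)"
  using assms
proof (induction p)
  case (Leaf a)
  then have "a \<in> letters (bin_alphabet k)" by (simp add: letters_bin_alphabet)
  then show ?case using Leaf arity_bin_alphabet[of a k] by (auto intro!: trees.intros)
next
  case (Bin p q)
  have "0 \<in> letters (bin_alphabet k)" by (simp add: letters_bin_alphabet)
  then show ?case using Bin arity_bin_alphabet[of 0 k] by (auto intro!: trees.intros)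
qed simp

lemma state_of_tr:
  assumes "hl p = []" "set (leaves p) \<subseteq> {1..max_letter e}"
  shows "state_of e c (tr p) = ev e p"
proof -
  have "state_of e c (tr p) = ev e p \<and> ev e p < nstates e"
    using assms
    by (induction p) (auto simp: delta_leaf delta_node mul_less leaf_state_less)
  then show ?thesis ..
qed

text \<open>The blank state is neutral for \<open>mul\<close>, but \<open>mul\<close> need not be
  associative. With at most two holes there is at most one product, so the shape of the pattern does
  not matter.\<close>

lemma ev_subst_blank:
  assumes "blank p" "length (hl p) \<le> 2"
  shows "ev e (subst \<sigma> p) = (case hl p of [] \<Rightarrow> st e 1 | [h] \<Rightarrow> ev e (\<sigma> h)
    | h # h' # _ \<Rightarrow> mul e (ev e (\<sigma> h)) (ev e (\<sigma> h')))"
  using assms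
proof (induction p)
  case (Leaf a)
  then show ?case by (simp add: leaf_state_def)
next
  case (Bin p q)
  then have IH: "ev e (subst \<sigma> p) = (case hl p of [] \<Rightarrow> st e 1 | [h] \<Rightarrow> ev e (\<sigma> h)
      | h # h' # _ \<Rightarrow> mul e (ev e (\<sigma> h)) (ev e (\<sigma> h')))"
    "ev e (subst \<sigma> q) = (case hl q of [] \<Rightarrow> st e 1 | [h] \<Rightarrow> ev e (\<sigma> h)
      | h # h' # _ \<Rightarrow> mul e (ev e (\<sigma> h)) (ev e (\<sigma> h')))" by auto
  consider "hl p = []" | "hl q = []" | h h' where "hl p = [h]" "hl q = [h']"
    using Bin.prems(2) by (cases "hl p"; cases "hl q"; cases "tl (hl p)"; cases "tl (hl q)") auto
  then show ?case using IH by cases (simp_all only: subst.simps ev.simps hl.simps append_Nil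
    append_Nil2 list.case mul_blank append_Cons)
qed simp

lemma ev_expand: "D \<in> pats [1, 2] \<Longrightarrow> hl p = [] \<Longrightarrow> ev e (expand D p) = ev e p"
proof (induction p)
  case (Bin p q)
  then show ?case
    using ev_subst_blank[of D e "\<lambda>h. if h = 1 then expand D p else expand D q"]
    by (simp add: plug_def pats_def)
qed simp_all

definition reg :: "nat \<Rightarrow> pat" where
  "reg r = Leaf (3 + r)"

definition lab :: "nat \<Rightarrow> nat \<Rightarrow> pat" where
  "lab e t = Leaf (3 + width e + t)"

text \<open>The right copy of each register is attached before the left one, because
  \<open>mul\<close> keeps pending registers on the right.\<close>

primrec wrap :: "nat list \<Rightarrow> pat \<Rightarrow> pat" where
  "wrap [] p = p"
| "wrap (x # u) p = Bin (reg x) (Bin (wrap u p) (reg x))"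

lemma ev_reg: "r < width e \<Longrightarrow> ev e (reg r) = mk e 3 0 r"
  by (simp add: reg_def leaf_state_def)

lemma ev_lab: "ev e (lab e t) = mk e 4 t 0"
  using width_pos[of e] by (simp add: lab_def leaf_state_def)

lemma hl_wrap: "hl (wrap u p) = hl p"
  by (induction u) (simp_all add: reg_def)

lemma leaves_wrap: "leaves (wrap u p) = map (\<lambda>r. 3 + r) u @ leaves p @ map (\<lambda>r. 3 + r) (rev u)"
  by (induction u) (simp_all add: reg_def)

lemma mk_neq_blank: "c \<noteq> 1 \<Longrightarrow> t < width e \<Longrightarrow> x < width e \<Longrightarrow> mk e c t x \<noteq> st e 1"
  using mk_sel(1)[of t e x c] mk_sel(1)[of 0 e 0 1] width_pos by metis

lemma mul_mk:
  assumes "c \<noteq> 1" "c' \<noteq> 1" "t < width e" "x < width e" "t' < width e" "x' < width e"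
  shows "mul e (mk e c t x) (mk e c' t' x') = (
    if c = 3 then
      (if c' = 4 \<or> c' = 5 then (if dec e t' x then mk e 6 t' 0 else 0)
       else if c' = 7 \<and> x = x' then mk e 5 t' 0
       else if c' = 8 \<and> x = x' then mk e 6 t' 0 else 0)
    else if c' = 3 then
      (if c = 5 \<or> c = 4 \<and> \<not> isz e t then
         (if inc e t x' then mk e 6 t 0 else mk e 7 t x')
       else if c = 6 \<or> c = 4 then (if zero e t x' then 0 else mk e 8 t x')
       else if c = 13 \<or> c = 15 then st e 15 else 0)
    else if c' = 4 then
      (if (c = 6 \<or> c = 4 \<and> isz e t) \<and> fol e t t' then st e 9
       else if c = 13 \<or> c = 15 then st e 16 else 0)
    else if c' = 9 then
      (if c = 4 \<and> t = 0 \<or> c = 11 then st e 10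
       else if c = 2 then st e 12 else if c = 13 then st e 14 else 0)
    else if c = 2 then
      (if c' = 10 then st e 11 else if c' = 12 then st e 13
       else if c' = 14 then st e 12 else 0)
    else 0)"
  unfolding mul_def mk_sel[OF assms(3,4)] mk_sel[OF assms(5,6)]
    if_not_P[OF mk_neq_blank[OF assms(1,3,4)]] if_not_P[OF mk_neq_blank[OF assms(2,5,6)]]
  by (rule refl)

lemma ev_wrap_before:
  assumes "t < width e" "\<not> isz e t" "\<And>x. \<not> inc e t x" "set u \<subseteq> {..<width e}"
  shows "\<exists>c \<in> {4, 5}. ev e (wrap u (lab e t)) = mk e c t 0"
  using assms(4)
proof (induction u)
  case (Cons x u)
  then obtain c where c: "c \<in> {4, 5}" "ev e (wrap u (lab e t)) = mk e c t 0" by auto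
  have "mul e (mk e c t 0) (mk e 3 0 x) = mk e 7 t x"
    using c(1) Cons.prems assms(1-3) width_pos[of e] by (auto simp: mul_mk)
  moreover have "mul e (mk e 3 0 x) (mk e 7 t x) = mk e 5 t 0"
    using Cons.prems assms(1) width_pos[of e] by (simp add: mul_mk)
  ultimately show ?case using Cons.prems c(2) by (simp add: ev_reg)
qed (simp add: ev_lab)

text \<open>A zero test is regarded as performed as soon as its label is seen, which is why class 4
  may take the place of class 6.\<close>

lemma ev_wrap_after:
  assumes "t < width e" "\<And>x. x \<in> set u \<Longrightarrow> \<not> zero e t x" "set u \<subseteq> {..<width e}"
    and p: "ev e p = mk e 6 t 0 \<or> isz e t \<and> ev e p = mk e 4 t 0"
  shows "ev e (wrap u p) = mk e 6 t 0 \<or> isz e t \<and> ev e (wrap u p) = mk e 4 t 0"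
  using assms(2,3)
proof (induction u)
  case (Cons x u)
  then have IH: "ev e (wrap u p) = mk e 6 t 0 \<or> isz e t \<and> ev e (wrap u p) = mk e 4 t 0" by simp
  have "mul e (ev e (wrap u p)) (mk e 3 0 x) = mk e 8 t x"
    using IH Cons.prems assms(1) width_pos[of e] by (auto simp: mul_mk)
  moreover have "mul e (mk e 3 0 x) (mk e 8 t x) = mk e 6 t 0"
    using Cons.prems assms(1) width_pos[of e] by (simp add: mul_mk)
  ultimately show ?case using Cons.prems by (simp add: ev_reg)
qed (use p in simp)

definition is_block :: "nat \<Rightarrow> nat list \<times> nat \<Rightarrow> nat list \<times> nat \<Rightarrow> pat \<Rightarrow> bool" where
  "is_block e p q b \<longleftrightarrow> hl b = [] \<and> leaves b = word e [p, q] \<and> ev e b = st e 9"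

text \<open>Nesting reverses the order of the matched registers. So the list \<open>v\<close> of the
  next configuration cannot be prescribed, only its multiset, and the blocks of a computation have
  to be chosen one after the other.\<close>

lemma ex_block:
  assumes t: "t < width e" "t' < width e" and pure: "pure e t" and u: "set u \<subseteq> {..<width e}"
    and step: "mstep e t (mset u) c'" and c': "set_mset c' \<subseteq> {..<width e}" and fol: "fol e t t'"
  shows "\<exists>v b. mset v = c' \<and> is_block e (u, t) (v, t') b"
proof -
  have "\<exists>v p. mset v = c' \<and> hl p = [] \<and> leaves p = around e u t v \<and>
      (ev e p = mk e 6 t 0 \<or> isz e t \<and> ev e p = mk e 4 t 0)"
    using step unfolding mstep_def
  proof (elim disjE exE conjE)
    fix r assume r: "inc e t r" "c' = add_mset r (mset u)"
    then have r': "r < width e" using c' by simp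
    let ?p = "wrap u (Bin (lab e t) (reg r))"
    have "\<not> isz e t" "\<And>x. \<not> zero e t x" using pure r(1) unfolding pure_def by blast+
    moreover have "ev e (Bin (lab e t) (reg r)) = mk e 6 t 0"
      using calculation(1) r(1) r' t(1) width_pos[of e] by (simp add: ev_lab ev_reg mul_mk)
    ultimately have "ev e ?p = mk e 6 t 0" using ev_wrap_after[OF t(1) _ u] by blast
    moreover have "leaves ?p = around e u t (r # rev u)"
      by (simp add: leaves_wrap around_def lab_def reg_def)
    moreover have "hl ?p = []" by (simp add: hl_wrap lab_def reg_def)
    moreover have "mset (r # rev u) = c'" using r(2) by simp
    ultimately show ?thesis by blast
  next
    fix r assume r: "dec e t r" "mset u = add_mset r c'"
    then have "r \<in> set u" by (metis set_mset_mset union_single_eq_member)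
    then obtain u1 u2 where u12: "u = u1 @ r # u2" by (meson split_list)
    \<comment> \<open>The decremented register stays unmatched at its place in \<open>u\<close>:
      registers inside it are matched before the operation, those outside it afterwards.\<close>
    let ?p = "wrap u1 (Bin (reg r) (wrap u2 (lab e t)))"
    have pure': "\<not> isz e t" "\<And>x. \<not> inc e t x" "\<And>x. \<not> zero e t x" using pure r(1) unfolding pure_def by blast+
    obtain c where "c \<in> {4, 5}" "ev e (wrap u2 (lab e t)) = mk e c t 0"
      using ev_wrap_before[OF t(1) pure'(1,2), of u2] u u12 by auto
    then have "ev e (Bin (reg r) (wrap u2 (lab e t))) = mk e 6 t 0"
      using r(1) u u12 t(1) width_pos[of e] by (auto simp: ev_reg mul_mk)
    then have "ev e ?p = mk e 6 t 0" using ev_wrap_after[OF t(1), of u1] pure' u u12 by auto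
    moreover have "leaves ?p = around e u t (rev u2 @ rev u1)"
      by (simp add: leaves_wrap around_def lab_def reg_def u12)
    moreover have "hl ?p = []" by (simp add: hl_wrap lab_def reg_def)
    moreover have "mset (rev u2 @ rev u1) = c'" using r(2) by (simp add: u12 add.commute)
    ultimately show ?thesis by blast
  next
    assume z: "isz e t" "c' = mset u" "\<forall>x \<in># mset u. \<not> zero e t x"
    let ?p = "wrap u (lab e t)"
    have "ev e ?p = mk e 6 t 0 \<or> isz e t \<and> ev e ?p = mk e 4 t 0"
      using z by (intro ev_wrap_after[OF t(1) _ u]) (auto simp: ev_lab)
    moreover have "leaves ?p = around e u t (rev u)"
      by (simp add: leaves_wrap around_def lab_def)
    moreover have "hl ?p = []" by (simp add: hl_wrap lab_def)
    moreover have "mset (rev u) = c'" using z(2) by simp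
    ultimately show ?thesis by blast
  qed
  then obtain v p where p: "mset v = c'" "hl p = []" "leaves p = around e u t v"
    "ev e p = mk e 6 t 0 \<or> isz e t \<and> ev e p = mk e 4 t 0" by blast
  have "ev e (Bin p (lab e t')) = st e 9"
    using p(4) fol t width_pos[of e] by (auto simp: ev_lab mul_mk)
  moreover have "leaves (Bin p (lab e t')) = word e [(u, t), (v, t')]"
    using p(3) by (simp add: word_def around_def lab_def)
  ultimately have "is_block e (u, t) (v, t') (Bin p (lab e t'))"
    using p(2) by (simp add: is_block_def lab_def)
  then show ?thesis using p(1) by blast
qed

context
  fixes e :: nat and p :: "nat \<Rightarrow> nat list \<times> nat" and b :: "nat \<Rightarrow> pat"
  assumes b: "\<And>i. is_block e (p i) (p (Suc i)) (b i)"
    and p0: "p 0 = ([], 0)"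
    and bounds: "\<And>i. snd (p i) < width e" "\<And>i. set (fst (p i)) \<subseteq> {..<width e}"
begin

primrec tree1 :: "nat \<Rightarrow> pat" where
  "tree1 0 = lab e 0"
| "tree1 (Suc m) = Bin (Leaf 2) (Bin (tree1 m) (b (2 * m + 1)))"

text \<open>It contains \<open>Suc m\<close> blocks, those with even index, because class 13
  requires at least one pair; \<open>tree1\<close> takes the blocks with odd index.\<close>

primrec tree2 :: "nat \<Rightarrow> pat" where
  "tree2 0 = Bin (Leaf 2) (Bin (Leaf 2) (b 0))"
| "tree2 (Suc m) = Bin (Leaf 2) (Bin (Leaf 2) (Bin (tree2 m) (b (2 * m + 2))))"

definition tree2_end :: "nat \<Rightarrow> pat" where
  "tree2_end m = Bin (foldl Bin (tree2 m) (map reg (fst (p (2 * m + 2))))) (lab e (snd (p (2 * m + 2))))"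

lemma leaves_b: "leaves (b i) = word e [p i, p (Suc i)]" and hl_b: "hl (b i) = []"
  and ev_b: "ev e (b i) = st e 9"
  using b by (simp_all add: is_block_def)

lemma ev_a: "ev e (Leaf 2) = st e 2"
  by (simp add: leaf_state_def)

lemma hl_tree1: "hl (tree1 m) = []"
  by (induction m) (simp_all add: hl_b lab_def)

lemma hl_tree2_end: "hl (tree2_end m) = []"
proof -
  have "hl (foldl Bin q (map reg u)) = hl q" for q u
    by (induction u arbitrary: q) (simp_all add: reg_def)
  moreover have "hl (tree2 m) = []" by (induction m) (simp_all add: hl_b)
  ultimately show ?thesis by (simp add: tree2_end_def lab_def)
qed

lemma leaves_tree1: "leaves (tree1 m) = replicate m 2 @ word e (map p [0..<2 * m + 1])"
proof (induction m)
  case 0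
  have "[0..<2 * 0 + 1] = [0 :: nat]" by (simp add: upt_rec)
  then show ?case by (simp add: lab_def word_def p0)
next
  case (Suc m)
  have "[0..<2 * Suc m + 1] = [0..<2 * m + 1] @ [2 * m + 1, Suc (2 * m + 1)]" by (simp add: One_nat_def)
  then show ?case using Suc by (simp add: leaves_b word_append[symmetric] del: upt_Suc)
qed

lemma leaves_tree2: "leaves (tree2 m) = replicate (2 * Suc m) 2 @ word e (map p [0..<2 * m + 2])"
proof (induction m)
  case 0
  have "[0..<2 * 0 + 2] = [0, Suc 0]" by (simp add: upt_rec)
  then show ?case by (simp add: leaves_b numeral_2_eq_2)
next
  case (Suc m)
  have "[0..<2 * Suc m + 2] = [0..<2 * m + 2] @ [2 * m + 2, Suc (2 * m + 2)]" by (simp add: One_nat_def)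
  then show ?case using Suc by (simp add: leaves_b word_append[symmetric] del: upt_Suc)
qed

lemma leaves_tree2_end: "leaves (tree2_end m) = replicate (2 * Suc m) 2 @ word e (map p [0..<2 * Suc m + 1])"
proof -
  have "leaves (foldl Bin q (map reg u)) = leaves q @ map (\<lambda>r. 3 + r) u" for q u
    by (induction u arbitrary: q) (simp_all add: reg_def)
  then have "leaves (tree2_end m) = leaves (tree2 m) @ word e [p (2 * m + 2)]"
    by (simp add: tree2_end_def lab_def word_def case_prod_beta)
  moreover have "[0..<2 * Suc m + 1] = [0..<2 * m + 2] @ [2 * m + 2]" by (simp add: One_nat_def)
  ultimately show ?thesis by (simp add: leaves_tree2 word_append del: upt_Suc)
qed

lemma ev_tree1: "ev e (tree1 (Suc m)) = st e 11"
proof -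
  have "\<exists>c \<in> {4, 11}. ev e (tree1 m) = st e c"
    by (induction m) (use width_pos[of e] in \<open>auto simp: ev_lab ev_a ev_b mul_mk simp del: ev.simps(2)\<close>)
  then show ?thesis using width_pos[of e] by (auto simp: ev_a ev_b mul_mk simp del: ev.simps(2))
qed

lemma ev_tree2: "ev e (tree2 m) = st e 13"
  by (induction m) (use width_pos[of e] in \<open>auto simp: ev_a ev_b mul_mk simp del: ev.simps(2)\<close>)

lemma ev_tree2_end: "ev e (tree2_end m) = st e 16"
proof -
  have "\<exists>c \<in> {13, 15}. ev e (foldl Bin q (map reg u)) = st e c"
    if "\<exists>c \<in> {13, 15}. ev e q = st e c" "set u \<subseteq> {..<width e}" for q u
    using that
  proof (induction u arbitrary: q)
    case (Cons x u)
    have "ev e (Bin q (reg x)) = st e 15"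
      using Cons.prems width_pos[of e] by (auto simp: ev_reg mul_mk)
    then show ?case using Cons by simp
  qed simp
  then obtain c where "c \<in> {13, 15}" "ev e (foldl Bin (tree2 m) (map reg (fst (p (2 * m + 2))))) = st e c"
    using ev_tree2 bounds(2) by blast
  then show ?thesis using bounds(1) width_pos[of e] by (auto simp: tree2_end_def ev_lab mul_mk)
qed

lemma not_separable: "\<not> separation_problem (input e)"
proof
  assume "separation_problem (input e)"
  then obtain M :: "(nat, nat) dtwa" where M: "dtwa (\<Sigma> e) M" "language e 11 \<subseteq> dtwa_language (\<Sigma> e) M"
    "dtwa_language (\<Sigma> e) M \<inter> language e 16 = {}"
    by (auto simp: separation_problem_def input_def dtwa_separable_def)
  have k: "1 \<le> max_letter e" by (simp add: max_letter_def)
  obtain D m where D: "D \<in> pats [1, 2]" "0 < m"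
    "\<forall>s t w. hl s = [] \<longrightarrow> hl t = [] \<longrightarrow> leaves s = replicate m 2 @ w \<longrightarrow>
      leaves t = replicate (2 * m) 2 @ w \<longrightarrow> set (leaves s) \<subseteq> {1..max_letter e} \<longrightarrow>
      dtwa_accepts M (tr (Bin (expand D s) (Leaf 1))) = dtwa_accepts M (tr (Bin (expand D t) (Leaf 1)))"
    using dtwa_confused[OF M(1) k, of 2] by blast
  obtain n where n: "m = Suc n" using D(2) by (cases m) auto
  \<comment> \<open>Since \<open>m = Suc n\<close>, both trees carry the same
    \<open>2 * m + 1\<close> configurations, behind \<open>m\<close> and \<open>2 * m\<close>
    letters \<open>a\<close>.\<close>
  let ?s = "tree1 m" and ?t = "tree2_end n"
  have word_letters: "set (word e (map p is)) \<subseteq> {1..max_letter e}" for "is"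
  proof
    fix x assume "x \<in> set (word e (map p is))"
    then obtain i where "(\<exists>r \<in> set (fst (p i)). x = 3 + r) \<or> x = 3 + width e + snd (p i)"
      by (auto simp: word_def case_prod_beta)
    then show "x \<in> {1..max_letter e}"
    proof
      assume "\<exists>r \<in> set (fst (p i)). x = 3 + r"
      then obtain r where "r \<in> set (fst (p i))" "x = 3 + r" by blast
      moreover have "r < width e" using bounds(2)[of i] calculation(1) by auto
      ultimately show ?thesis by (simp add: max_letter_def)
    next
      assume "x = 3 + width e + snd (p i)"
      then show ?thesis using bounds(1)[of i] by (simp add: max_letter_def)
    qed
  qed
  have letters: "set (leaves ?s) \<subseteq> {1..max_letter e}" "set (leaves ?t) \<subseteq> {1..max_letter e}"
    using word_letters by (auto simp: leaves_tree1 leaves_tree2_end max_letter_def simp del: upt_Suc)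
  have l2: "leaves ?t = replicate (2 * m) 2 @ word e (map p [0..<2 * m + 1])"
    unfolding n by (rule leaves_tree2_end)
  have eq: "dtwa_accepts M (tr (Bin (expand D ?s) (Leaf 1))) = dtwa_accepts M (tr (Bin (expand D ?t) (Leaf 1)))"
    by (rule D(3)[rule_format, OF hl_tree1 hl_tree2_end leaves_tree1 l2 letters(1)])
  have expand: "tr (Bin (expand D q) (Leaf 1)) \<in> trees (\<Sigma> e) \<and>
      state_of e c (tr (Bin (expand D q) (Leaf 1))) = ev e q"
    if q: "hl q = []" "set (leaves q) \<subseteq> {1..max_letter e}" for q c
  proof -
    let ?q = "Bin (expand D q) (Leaf 1)"
    have *: "hl ?q = []" "set (leaves ?q) \<subseteq> {1..max_letter e}"
      using hl_expand[OF D(1) q(1)] leaves_expand[OF D(1) q(1)] q(2) k by auto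
    have "ev e ?q = ev e q" using ev_expand[OF D(1) q(1)] by (simp add: leaf_state_def mul_blank[simplified])
    then show ?thesis using tr_in_trees[OF *] state_of_tr[OF *] by simp
  qed
  have "tr (Bin (expand D ?s) (Leaf 1)) \<in> language e 11"
    using expand[OF hl_tree1 letters(1)] ev_tree1[of n] n by (simp add: language_iff)
  then have "dtwa_accepts M (tr (Bin (expand D ?s) (Leaf 1)))" using M(2) by (auto simp: dtwa_language_def)
  then have "tr (Bin (expand D ?t) (Leaf 1)) \<in> dtwa_language (\<Sigma> e) M"
    using eq expand[OF hl_tree2_end letters(2)] by (simp add: dtwa_language_def)
  moreover have "tr (Bin (expand D ?t) (Leaf 1)) \<in> language e 16"
    using expand[OF hl_tree2_end letters(2)] ev_tree2_end[of n] by (simp add: language_iff)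
  ultimately show False using M(3) by blast
qed

end

theorem diverging_not_separable:
  assumes tr: "\<And>n. trace e n t c"
    and bounds: "\<And>i. t i < width e" "\<And>i. pure e (t i)" "\<And>i. set_mset (c i) \<subseteq> {..<width e}"
  shows "\<not> separation_problem (input e)"
proof -
  have step: "mstep e (t i) (c i) (c (Suc i))" "fol e (t i) (t (Suc i))" for i
    using tr[of "Suc i"] by (auto simp: trace_def)
  have "\<exists>f. \<forall>n. (mset (f n) = c n \<and> (n = 0 \<longrightarrow> f n = [])) \<and>
      (\<exists>b. is_block e (f n, t n) (f (Suc n), t (Suc n)) b)"
  proof (rule dependent_nat_choice)
    show "\<exists>x. mset x = c 0 \<and> (0 = 0 \<longrightarrow> x = [])" using tr[of 0] by (simp add: trace_def)
  next
    fix u n assume u: "mset u = c n \<and> (n = 0 \<longrightarrow> u = [])"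
    then have "set u \<subseteq> {..<width e}" using bounds(3)[of n] by (metis set_mset_mset)
    with ex_block[OF bounds(1) bounds(1) bounds(2) this, of n "c (Suc n)" "Suc n"] step[of n] u bounds(3)
    show "\<exists>v. (mset v = c (Suc n) \<and> (Suc n = 0 \<longrightarrow> v = [])) \<and>
        (\<exists>b. is_block e (u, t n) (v, t (Suc n)) b)" by auto
  qed
  then obtain f where f: "\<And>n. mset (f n) = c n" "f 0 = []"
    "\<And>n. \<exists>b. is_block e (f n, t n) (f (Suc n), t (Suc n)) b" by blast
  then obtain b where b: "\<And>n. is_block e (f n, t n) (f (Suc n), t (Suc n)) (b n)" by metis
  show ?thesis
  proof (rule not_separable[of e "\<lambda>n. (f n, t n)" b])
    show "set (fst (f i, t i)) \<subseteq> {..<width e}" for i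
      using bounds(3)[of i] f(1)[of i] by (metis fst_conv set_mset_mset)
  qed (use b bounds(1) f(2) tr[of 0] in \<open>simp_all add: trace_def\<close>)
qed

section \<open>Halting machines are separable\<close>

lemma dtwa_step_functional: "dtwa_step M t c c1 \<Longrightarrow> dtwa_step M t c c2 \<Longrightarrow> c1 = c2"
  by (auto elim!: dtwa_step.cases)

lemma dtwa_steps_final:
  assumes "(dtwa_step M t)\<^sup>*\<^sup>* c c1" "(dtwa_step M t)\<^sup>*\<^sup>* c c2"
    and "\<And>d. \<not> dtwa_step M t c1 d" "\<And>d. \<not> dtwa_step M t c2 d"
  shows "c1 = c2"
  using assms(1,2)
proof (induction rule: converse_rtranclp_induct)
  case base
  then show ?case using assms(3) by (metis converse_rtranclpE)
next
  case (step c d)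
  from step.prems show ?case
  proof (cases rule: converse_rtranclpE)
    case base
    then show ?thesis using step.hyps(1) assms(4) by blast
  next
    case (step y)
    then show ?thesis using step.IH step.hyps(1) dtwa_step_functional by metis
  qed
qed

text \<open>The states \<open>3 * v\<close>, \<open>3 * v + 1\<close> and \<open>3 * v + 2\<close> mean that the value of the word of leaves
  seen so far is \<open>v\<close> and that the current node is entered from above, from its first child and from its
  second child.\<close>

locale depth_first =
  fixes k :: nat and g :: "nat list \<Rightarrow> nat" and G :: "nat set"
  assumes fin: "finite (g ` {w. set w \<subseteq> {1..k}})"
    and congruence: "g u = g v \<Longrightarrow> g (u @ [x]) = g (v @ [x])"
begin

text \<open>By \<open>congruence\<close> any word with value \<open>v\<close> can serve as
  representative; blanks are skipped.\<close>

definition nx :: "nat \<Rightarrow> nat \<Rightarrow> nat" where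
  "nx v x = (if x = 1 then v else g ((SOME w. set w \<subseteq> {1..k} \<and> g w = v) @ [x]))"

definition finish :: "nat \<Rightarrow> child_number \<Rightarrow> nat command" where
  "finish v c = (case c of Root \<Rightarrow> if v \<in> G then Accept else Reject
    | Child i \<Rightarrow> Move (3 * v + (if i = 1 then 1 else 2)) Parent)"

definition search :: "(nat, nat) dtwa" where
  "search = \<lparr>dtwa_states = {3 * v + j | v j. v \<in> g ` {w. set w \<subseteq> {1..k}} \<and> j < 3}, dtwa_init = 3 * g [],
    dtwa_delta = (\<lambda>a q c. if a = 0 then (if q mod 3 = 0 then Move (3 * (q div 3)) (To_Child 1)
        else if q mod 3 = 1 then Move (3 * (q div 3)) (To_Child 2) else finish (q div 3) c)
      else finish (nx (q div 3) a) c)\<rparr>"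

lemma nx: "set w \<subseteq> {1..k} \<Longrightarrow> nx (g w) x = g (if x = 1 then w else w @ [x])"
proof -
  assume w: "set w \<subseteq> {1..k}"
  let ?u = "SOME u. set u \<subseteq> {1..k} \<and> g u = g w"
  have "set ?u \<subseteq> {1..k} \<and> g ?u = g w"
    by (rule someI[of _ w]) (use w in simp)
  then have "g (?u @ [x]) = g (w @ [x])" by (intro congruence) (rule conjunct2)
  then show ?thesis by (simp only: nx_def split: if_split) blast
qed

lemma finish_in:
  assumes "v \<in> g ` {w. set w \<subseteq> {1..k}}"
  shows "finish v c \<in> commands (dtwa_states search) n"
proof -
  have j: "3 * v + j \<in> dtwa_states search" if "j < 3" for j
    unfolding search_def dtwa.simps using assms that by blast
  show ?thesis
  proof (cases c)
    case Root
    then show ?thesis by (simp add: finish_def commands_def)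
  next
    case (Child i)
    have "3 * v + (if i = 1 then 1 else 2) \<in> dtwa_states search" by (rule j) simp
    then show ?thesis unfolding finish_def Child child_number.case commands_def by blast
  qed
qed

lemma dtwa_search: "dtwa (bin_alphabet k) search"
  unfolding dtwa_def
proof (intro conjI ballI)
  let ?V = "g ` {w. set w \<subseteq> {1..k}}"
  have "dtwa_states search \<subseteq> (\<lambda>(v, j). 3 * v + j) ` (?V \<times> {..<3})"
    by (auto simp: search_def)
  then show "finite (dtwa_states search)" using fin by (auto intro: finite_subset)
  have start: "3 * v \<in> dtwa_states search" if "v \<in> ?V" for v
  proof -
    have "3 * v = 3 * v + 0 \<and> v \<in> ?V \<and> (0 :: nat) < 3" using that by simp
    then show ?thesis unfolding search_def dtwa.simps by blast
  qed
  show "dtwa_init search \<in> dtwa_states search"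
  proof -
    have "g [] \<in> ?V" by (rule imageI) simp
    then show ?thesis using start by (simp add: search_def)
  qed
  fix a q c assume a: "a \<in> letters (bin_alphabet k)" and q: "q \<in> dtwa_states search"
  have v: "q div 3 \<in> ?V" using q by (auto simp: search_def)
  show "dtwa_delta search a q c \<in> commands (dtwa_states search) (arity (bin_alphabet k) a)"
  proof (cases "a = 0")
    case True
    then have "arity (bin_alphabet k) a = 2" using arity_bin_alphabet[OF a] by simp
    then show ?thesis using True finish_in[OF v] start[OF v]
      by (auto simp: search_def[THEN arg_cong[where f = dtwa_delta]] commands_def)
  next
    case False
    obtain w where w: "set w \<subseteq> {1..k}" "q div 3 = g w" using v by blast
    have "nx (q div 3) a \<in> ?V" unfolding w(2) nx[OF w(1)]
      using w(1) a False by (intro imageI) (auto simp: letters_bin_alphabet)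
    then show ?thesis using False finish_in
      by (simp add: search_def[THEN arg_cong[where f = dtwa_delta]])
  qed
qed

lemma search_steps:
  assumes "s \<in> trees (bin_alphabet k)" "subtree_at t v = s" "set w \<subseteq> {1..k}"
  shows "\<exists>q. (dtwa_step search t)\<^sup>*\<^sup>* (3 * g w, v) (q, v) \<and>
    dtwa_command search t (q, v) = finish (g (w @ yield s)) (child_number_of v) \<and>
    set (yield s) \<subseteq> {1..k}"
  using assms
proof (induction arbitrary: v w rule: bin_trees_induct)
  case (leaf a)
  then show ?case
    by (intro exI[of _ "3 * g w"])
      (auto simp: dtwa_command_def label_at_def search_def nx)
next
  case (node t1 t2)
  have cmd: "dtwa_command search t (q, v) = (if q mod 3 = 0 then Move (3 * (q div 3)) (To_Child 1)
      else if q mod 3 = 1 then Move (3 * (q div 3)) (To_Child 2) else finish (q div 3) (child_number_of v))" for q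
    using node.prems(1) by (simp add: dtwa_command_def label_at_def search_def)
  have cn: "child_number_of (v @ [i]) = Child i" for i by (simp add: child_number_of_def)
  have down1: "dtwa_step search t (3 * x, v) (3 * x, v @ [1])" for x
    by (rule to_child) (simp add: cmd)
  have down2: "dtwa_step search t (3 * x + 1, v) (3 * x, v @ [2])" for x
    by (rule to_child) (simp add: cmd)
  have sub: "subtree_at t (v @ [1]) = t1" "subtree_at t (v @ [2]) = t2"
    using node.prems(1) by (simp_all add: subtree_at_append)
  obtain q1 where q1: "(dtwa_step search t)\<^sup>*\<^sup>* (3 * g w, v @ [1]) (q1, v @ [1])"
    "dtwa_command search t (q1, v @ [1]) = finish (g (w @ yield t1)) (Child 1)" "set (yield t1) \<subseteq> {1..k}"
    using node.IH(1)[OF sub(1) node.prems(2)] unfolding cn by blast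
  let ?w1 = "w @ yield t1"
  have w1: "set ?w1 \<subseteq> {1..k}" using q1(3) node.prems(2) by simp
  obtain q2 where q2: "(dtwa_step search t)\<^sup>*\<^sup>* (3 * g ?w1, v @ [2]) (q2, v @ [2])"
    "dtwa_command search t (q2, v @ [2]) = finish (g (?w1 @ yield t2)) (Child 2)" "set (yield t2) \<subseteq> {1..k}"
    using node.IH(2)[OF sub(2) w1] unfolding cn by blast
  have up1: "dtwa_step search t (q1, v @ [1]) (3 * g ?w1 + 1, v)"
    using to_parent[of search t q1 "v @ [1]" "3 * g ?w1 + 1"] q1(2) by (simp add: finish_def)
  have up2: "dtwa_step search t (q2, v @ [2]) (3 * g (?w1 @ yield t2) + 2, v)"
    using to_parent[of search t q2 "v @ [2]" "3 * g (?w1 @ yield t2) + 2"] q2(2) by (simp add: finish_def)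
  have "(dtwa_step search t)\<^sup>*\<^sup>* (3 * g w, v) (3 * g ?w1 + 1, v)"
    using converse_rtranclp_into_rtranclp[OF down1 rtranclp.rtrancl_into_rtrancl[OF q1(1) up1]] .
  moreover have "(dtwa_step search t)\<^sup>*\<^sup>* (3 * g ?w1 + 1, v) (3 * g (?w1 @ yield t2) + 2, v)"
    using converse_rtranclp_into_rtranclp[OF down2 rtranclp.rtrancl_into_rtrancl[OF q2(1) up2]] .
  ultimately have "(dtwa_step search t)\<^sup>*\<^sup>* (3 * g w, v) (3 * g (?w1 @ yield t2) + 2, v)"
    by (rule rtranclp_trans)
  moreover have "(3 * x + 2) mod 3 = 2" "(3 * x + 2) div 3 = x" for x :: nat by presburger+
  then have "dtwa_command search t (3 * g (?w1 @ yield t2) + 2, v) =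
      finish (g (w @ yield (Node 0 [t1, t2]))) (child_number_of v)"
    by (simp only: cmd) simp
  ultimately show ?case using q1(3) q2(3) by auto
qed

theorem language_search: "dtwa_language (bin_alphabet k) search = {t \<in> trees (bin_alphabet k). g (yield t) \<in> G}"
proof -
  have "dtwa_accepts search t \<longleftrightarrow> g (yield t) \<in> G" if t: "t \<in> trees (bin_alphabet k)" for t
  proof -
    obtain q where q: "(dtwa_step search t)\<^sup>*\<^sup>* (dtwa_init search, []) (q, [])"
      "dtwa_command search t (q, []) = (if g (yield t) \<in> G then Accept else Reject)"
      using search_steps[OF t, of t "[]" "[]"] by (auto simp: search_def finish_def child_number_of_def)
    have stop: "\<not> dtwa_step search t c d" if "dtwa_command search t c \<in> {Accept, Reject}" for c d
      using that by (auto elim!: dtwa_step.cases)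
    show ?thesis
    proof
      assume "dtwa_accepts search t"
      then obtain c where c: "(dtwa_step search t)\<^sup>*\<^sup>* (dtwa_init search, []) c"
        "dtwa_command search t c = Accept" unfolding dtwa_accepts_def by blast
      have "(q, []) = c" using q(2) c(2)
        by (intro dtwa_steps_final[OF q(1) c(1)] stop) auto
      then show "g (yield t) \<in> G" using q(2) c(2) by (auto split: if_splits)
    next
      assume "g (yield t) \<in> G"
      then show "dtwa_accepts search t" using q unfolding dtwa_accepts_def by auto
    qed
  qed
  then show ?thesis by (auto simp: dtwa_language_def)
qed

end

section \<open>Separating by a bounded prefix\<close>

definition summary :: "nat \<Rightarrow> nat list \<Rightarrow> nat" where
  "summary K w = prod_encode (min K (length (takeWhile ((=) 2) w)), list_encode (take K (dropWhile ((=) 2) w)))"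

lemma summary_eq_iff: "summary K u = summary K v \<longleftrightarrow>
    min K (length (takeWhile ((=) 2) u)) = min K (length (takeWhile ((=) 2) v)) \<and>
    take K (dropWhile ((=) 2) u) = take K (dropWhile ((=) 2) v)"
  by (simp add: summary_def prod_encode_eq list_encode_eq)

text \<open>As \<open>K\<close> is positive, the summary shows whether some letter other than
  \<open>a\<close> has occurred. If not, both words are powers of \<open>a\<close> and the capped
  counts decide; otherwise the counts are frozen and the new letter only extends the visible
  prefix.\<close>

lemma summary_congruence:
  assumes "summary K u = summary K v" "0 < K"
  shows "summary K (u @ [x]) = summary K (v @ [x])"
proof -
  have eq: "dropWhile ((=) 2) u = [] \<longleftrightarrow> dropWhile ((=) 2) v = []"
    using assms by (metis summary_eq_iff take_eq_Nil less_irrefl)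
  have snoc: "take K (a @ [x]) = take K (take K a @ [x])" for a :: "nat list"
    by (cases "length a < K") (simp_all add: take_Cons')
  show ?thesis
  proof (cases "dropWhile ((=) 2) u = []")
    case True
    then have all: "\<forall>y \<in> set u. 2 = y" "\<forall>y \<in> set v. 2 = y"
      using eq by (simp_all add: dropWhile_eq_Nil_conv)
    then have "takeWhile ((=) 2) u = u" "takeWhile ((=) 2) v = v"
      by (simp_all only: takeWhile_eq_all_conv)
    then have "min K (length u) = min K (length v)" using assms(1) unfolding summary_eq_iff by metis
    then show ?thesis unfolding summary_eq_iff
      using all by (simp add: takeWhile_append2 dropWhile_append2 takeWhile_append dropWhile_append)
  next
    case False
    have "dropWhile ((=) 2) v \<noteq> []" using False unfolding eq .
    then obtain y z where "y \<in> set u" "2 \<noteq> y" "z \<in> set v" "2 \<noteq> z"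
      using False unfolding dropWhile_eq_Nil_conv by blast
    then have *: "takeWhile ((=) 2) (u @ [x]) = takeWhile ((=) 2) u" "takeWhile ((=) 2) (v @ [x]) = takeWhile ((=) 2) v"
      "dropWhile ((=) 2) (u @ [x]) = dropWhile ((=) 2) u @ [x]" "dropWhile ((=) 2) (v @ [x]) = dropWhile ((=) 2) v @ [x]"
      by (simp_all add: takeWhile_append1 dropWhile_append1)
    then show ?thesis unfolding summary_eq_iff *
      using assms(1) snoc[of "dropWhile ((=) 2) u"] snoc[of "dropWhile ((=) 2) v"]
      by (simp add: summary_eq_iff)
  qed
qed

lemma finite_summary: "finite (summary K ` {w. set w \<subseteq> {1..k}})"
proof (rule finite_subset)
  let ?L = "{l. set l \<subseteq> {1..k} \<and> length l \<le> K}"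
  show "summary K ` {w. set w \<subseteq> {1..k}} \<subseteq> (\<lambda>(n, l). prod_encode (n, list_encode l)) ` ({..K} \<times> ?L)"
  proof
    fix y assume "y \<in> summary K ` {w. set w \<subseteq> {1..k}}"
    then obtain w where w: "set w \<subseteq> {1..k}" "y = summary K w" by blast
    have "take K (dropWhile ((=) 2) w) \<in> ?L"
      using w(1) set_take_subset[of K "dropWhile ((=) 2) w"] set_dropWhileD[of _ "(=) 2" w] by fastforce
    then show "y \<in> (\<lambda>(n, l). prod_encode (n, list_encode l)) ` ({..K} \<times> ?L)"
      unfolding w(2) summary_def
      by (intro image_eqI[of _ _ "(min K (length (takeWhile ((=) 2) w)), take K (dropWhile ((=) 2) w))"]) auto
  qed
  show "finite ((\<lambda>(n, l). prod_encode (n, list_encode l)) ` ({..K} \<times> ?L))"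
    using finite_lists_length_le[of "{1..k}" K] by simp
qed

lemma word_Cons: "word e ((u, t) # ps) = map (\<lambda>r. 3 + r) u @ (3 + width e + t) # word e ps"
  by (simp add: word_def)

text \<open>Each configuration ends with its label letter, which exceeds all register letters; thus
  configurations form a prefix code.\<close>

lemma word_prefix:
  assumes "word e ys = word e xs @ zs" "\<forall>p \<in> set xs \<union> set ys. bounded e (fst p)"
  shows "\<exists>ys'. ys = xs @ ys'"
  using assms
proof (induction xs arbitrary: ys)
  case (Cons x xs)
  obtain u t where x: "x = (u, t)" by (cases x)
  have "ys \<noteq> []" using Cons.prems(1) by (auto simp: x word_def)
  then obtain u' t' ys1 where ys: "ys = (u', t') # ys1" by (cases ys) auto
  let ?P = "\<lambda>x. x < 3 + width e"
  have eq: "map (\<lambda>r. 3 + r) u' @ (3 + width e + t') # word e ys1 =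
      map (\<lambda>r. 3 + r) u @ (3 + width e + t) # (word e xs @ zs)"
    using Cons.prems(1) by (simp add: x ys word_Cons)
  have P: "\<forall>x \<in> set (map (\<lambda>r. 3 + r) v). ?P x" if "bounded e v" for v using that by auto
  have b: "bounded e u" "bounded e u'" using Cons.prems(2) by (auto simp: x ys)
  have tw: "takeWhile ?P (map (\<lambda>r. 3 + r) v @ (3 + width e + s) # l) = map (\<lambda>r. 3 + r) v" if "bounded e v" for v s l
    using P[OF that] by (subst takeWhile_append2) auto
  have "map (\<lambda>r. 3 + r) u' = map (\<lambda>r. 3 + r) u"
    using arg_cong[OF eq, of "takeWhile ?P"] tw b by simp
  moreover from this have "t' = t" "word e ys1 = word e xs @ zs" using eq by simp_all
  moreover have "inj ((+) (3 :: nat))" by simp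
  ultimately have "u' = u" using inj_map_eq_map by metis
  moreover obtain ys' where "ys1 = xs @ ys'"
    using Cons.IH[of ys1] \<open>word e ys1 = word e xs @ zs\<close> Cons.prems(2) by (auto simp: ys)
  ultimately show ?case using \<open>t' = t\<close> by (simp add: x ys)
qed simp

lemma length_flatten: "length (flatten qs) = 2 * length qs"
  by (induction qs) (auto simp: flatten_def)

lemma linked_flatten:
  "linked e qs \<Longrightarrow> even i \<Longrightarrow> Suc i < length (flatten qs) \<Longrightarrow> link e (flatten qs ! i) (flatten qs ! Suc i)"
proof (induction qs arbitrary: i)
  case (Cons q qs)
  obtain p p' where q: "q = (p, p')" by (cases q)
  have flatten: "flatten (q # qs) = p # p' # flatten qs" by (simp add: flatten_def q)
  show ?case
  proof (cases i)
    case i: 0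
    have "link e p p'" using Cons.prems(1) by (simp add: linked_def q)
    then show ?thesis unfolding flatten i by simp
  next
    case (Suc j)
    then obtain l where "i = Suc (Suc l)" using Cons.prems(2) by (cases j) auto
    then show ?thesis using Cons by (simp add: flatten linked_def)
  qed
qed (simp add: flatten_def)

lemma bounded_flatten: "linked e qs \<Longrightarrow> \<forall>p \<in> set (flatten qs). bounded e (fst p)"
  by (induction qs) (fastforce simp: linked_def flatten_def link_def)+

lemma mstep_size: "mstep e t c c' \<Longrightarrow> size c' \<le> Suc (size c)"
  by (auto simp: mstep_def)

definition chain :: "nat \<Rightarrow> (nat list \<times> nat) list \<Rightarrow> bool" where
  "chain e ps \<longleftrightarrow> ps \<noteq> [] \<and> ps ! 0 = ([], 0) \<and> (\<forall>i. Suc i < length ps \<longrightarrow> link e (ps ! i) (ps ! Suc i))"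

text \<open>A step adds at most one register, so configuration \<open>i\<close> has at most
  \<open>i\<close> of them. Each of the at most \<open>T\<close> configurations then takes at most
  \<open>T\<close> letters, label included.\<close>

lemma chain_bounds:
  assumes "chain e ps" and T: "\<forall>n t c. trace e n t c \<longrightarrow> n < T"
  shows "length ps \<le> T" "length (word e ps) \<le> T * T"
proof -
  have "trace e (length ps - 1) (\<lambda>i. snd (ps ! i)) (\<lambda>i. mset (fst (ps ! i)))"
    using assms(1) by (auto simp: trace_def chain_def link_def)
  then show len: "length ps \<le> T" using T assms(1) by (fastforce simp: chain_def)
  have "length (fst (ps ! i)) \<le> i" if "i < length ps" for i
    using that
  proof (induction i)
    case (Suc i)
    then show ?case using assms(1) mstep_size[of e "snd (ps ! i)" "mset (fst (ps ! i))" "mset (fst (ps ! Suc i))"]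
      by (fastforce simp: chain_def link_def)
  qed (use assms(1) in \<open>simp add: chain_def\<close>)
  then have "length (fst p) + 1 \<le> T" if "p \<in> set ps" for p
    using that len by (fastforce simp: in_set_conv_nth)
  then have "length (word e ps) \<le> length ps * T"
    by (induction ps) (auto simp: word_def case_prod_beta, fastforce)
  then show "length (word e ps) \<le> T * T" using len by (meson mult_le_mono1 order_trans)
qed

lemma chain_take_Suc:
  assumes "chain e (take n ps)" "0 < n" "n < length ps" "link e (ps ! (n - 1)) (ps ! n)"
  shows "chain e (take (Suc n) ps)"
  unfolding chain_def
proof (intro conjI allI impI)
  show "take (Suc n) ps \<noteq> []" "take (Suc n) ps ! 0 = ([], 0)"
    using assms(1-3) by (auto simp: chain_def)
  fix i assume i: "Suc i < length (take (Suc n) ps)"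
  show "link e (take (Suc n) ps ! i) (take (Suc n) ps ! Suc i)"
  proof (cases "Suc i = n")
    case True
    then show ?thesis using assms(3,4) by auto
  next
    case False
    then show ?thesis using assms(1,3) i by (simp add: chain_def)
  qed
qed

text \<open>A chain takes fewer than \<open>K\<close> letters and is therefore completely visible in
  the truncated word. If it exhausts \<open>xs\<close>, the end of the word is visible as well, so
  \<open>ys\<close> ends there too.\<close>

lemma common_prefix:
  assumes K: "T * T < K" and T: "\<forall>n t c. trace e n t c \<longrightarrow> n < T"
    and eq: "take K (word e xs) = take K (word e ys)"
    and b: "\<forall>p \<in> set xs \<union> set ys. bounded e (fst p)"
    and ch: "chain e (take n xs)" and n: "n \<le> length xs"
  shows "take n xs = take n ys \<and> n \<le> length ys \<and> (n = length xs \<longrightarrow> ys = xs)"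
proof -
  let ?w = "word e (take n xs)"
  have len: "length ?w < K" using chain_bounds(2)[OF ch T] K by simp
  have "take (length ?w) (word e xs) = ?w"
    using word_append[of e "take n xs" "drop n xs"] by simp
  then have "take (length ?w) (word e ys) = ?w"
    using arg_cong[OF eq, of "take (length ?w)"] len by (simp add: min_def)
  then have "word e ys = ?w @ drop (length ?w) (word e ys)" by (metis append_take_drop_id)
  moreover have "\<forall>p \<in> set (take n xs) \<union> set ys. bounded e (fst p)" using b in_set_takeD by fast
  ultimately obtain ys' where ys': "ys = take n xs @ ys'" using word_prefix by blast
  have "ys = xs" if "n = length xs"
  proof -
    have "word e ys = word e xs @ word e ys'" using ys' that by (simp add: word_append)
    moreover have "length (word e xs) < K" using len that by simp
    ultimately have "take (K - length (word e xs)) (word e ys') = []" using eq by simp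
    then have "word e ys' = []" using \<open>length (word e xs) < K\<close> by simp
    then have "ys' = []" by (cases ys') (auto simp: word_def)
    then show ?thesis using ys' that by simp
  qed
  then show ?thesis using ys' n by auto
qed

text \<open>Equal summaries let a common chain grow: steps from odd positions are guaranteed by the
  first word, those from even positions by the second, and \<open>common_prefix\<close> carries each
  new configuration over to the other word. The chain uses up the shorter word, so the words of
  configurations are equal and \<open>m = m'\<close>, against the visible numbers \<open>m\<close>
  and \<open>2 * m'\<close> of letters \<open>a\<close>.\<close>

theorem halting_disjoint:
  assumes T: "\<forall>n t c. trace e n t c \<longrightarrow> n < T" and K: "T * T + 2 * T + 2 \<le> K"
    and w: "lang1 e m m w" and w': "lang2 e (2 * m') m' (word e [p]) w'" "0 < m'" "bounded e (fst p)"
  shows "summary K w \<noteq> summary K w'"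
proof
  assume eq: "summary K w = summary K w'"
  obtain qs where qs: "length qs = m" "linked e qs" "w = replicate m 2 @ word e (([], 0) # flatten qs)"
    using w by (auto simp: lang1_def)
  obtain qs' where qs': "length qs' = m'" "linked e qs'" "w' = replicate (2 * m') 2 @ word e (flatten qs') @ word e [p]"
    using w'(1) by (auto simp: lang2_def)
  define xs where "xs = ([], 0 :: nat) # flatten qs"
  define ys where "ys = flatten qs' @ [p]"
  have w_eq: "w = replicate m 2 @ word e xs" "w' = replicate (2 * m') 2 @ word e ys"
    using qs(3) qs'(3) by (simp_all add: xs_def ys_def word_append)
  have no2: "word e zs = [] \<or> hd (word e zs) \<noteq> 2" for zs
    by (cases zs) (auto simp: word_def hd_append case_prod_beta hd_map)
  have tw: "takeWhile ((=) 2) (replicate i 2 @ word e zs) = replicate i 2"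
    "dropWhile ((=) 2) (replicate i 2 @ word e zs) = word e zs" for i zs
    using no2[of zs] by (induction i) (cases "word e zs"; auto)+
  have eq1: "min K m = min K (2 * m')" and eq2: "take K (word e xs) = take K (word e ys)"
    using eq unfolding summary_eq_iff w_eq tw by simp_all
  have b: "\<forall>p \<in> set xs \<union> set ys. bounded e (fst p)"
    using bounded_flatten[OF qs(2)] bounded_flatten[OF qs'(2)] w'(3) by (auto simp: xs_def ys_def)
  have len: "length xs = 2 * m + 1" "length ys = 2 * m' + 1"
    using qs(1) qs'(1) by (simp_all add: xs_def ys_def length_flatten)
  have lx: "link e (xs ! i) (xs ! Suc i)" if "odd i" "Suc i < length xs" for i
    using linked_flatten[OF qs(2), of "i - 1"] that odd_pos[OF that(1)] by (simp add: xs_def nth_Cons')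
  have ly: "link e (ys ! i) (ys ! Suc i)" if "even i" "Suc i < length ys" for i
  proof -
    have "Suc i < length (flatten qs')"
      using that len(2) qs'(1) by (auto simp: length_flatten elim!: evenE) presburger?
    then show ?thesis using linked_flatten[OF qs'(2) that(1)] by (simp add: ys_def nth_append)
  qed
  have TK: "T * T < K" using K by simp
  have main: "chain e (take (Suc n) xs) \<and> take (Suc n) xs = take (Suc n) ys"
    if "Suc n \<le> length xs" "Suc n \<le> length ys" for n
    using that
  proof (induction n)
    case 0
    have "chain e (take (Suc 0) xs)" by (simp add: chain_def xs_def)
    then show ?case using common_prefix[OF TK T eq2 b] 0 by simp
  next
    case (Suc n)
    then have IH: "chain e (take (Suc n) xs)" "take (Suc n) xs = take (Suc n) ys" by linarith+
    show ?case
    proof (cases "odd n")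
      case True
      then have "chain e (take (Suc (Suc n)) xs)"
        using chain_take_Suc[OF IH(1)] lx[of n] Suc.prems by simp
      then show ?thesis using common_prefix[OF TK T eq2 b] Suc.prems by simp
    next
      case False
      then have c: "chain e (take (Suc (Suc n)) ys)"
        using chain_take_Suc[of e "Suc n" ys] IH(1) ly[of n] Suc.prems unfolding IH(2) by simp
      have "\<forall>p \<in> set ys \<union> set xs. bounded e (fst p)" using b by blast
      then have "take (Suc (Suc n)) ys = take (Suc (Suc n)) xs"
        using common_prefix[OF TK T eq2[symmetric] _ c] Suc.prems by simp
      then show ?thesis using c by simp
    qed
  qed
  have "xs = ys \<and> chain e xs"
  proof (cases "length xs \<le> length ys")
    case True
    moreover have "length xs = Suc (2 * m)" using len by simp
    ultimately have c: "chain e (take (length xs) xs)" using main[of "2 * m"] by (metis order_refl)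
    then show ?thesis using common_prefix[OF TK T eq2 b c] by simp
  next
    case False
    moreover have "length ys = Suc (2 * m')" using len by simp
    ultimately have c: "chain e (take (length ys) ys)" using main[of "2 * m'"] by (metis linear order_refl)
    have "\<forall>p \<in> set ys \<union> set xs. bounded e (fst p)" using b by blast
    then show ?thesis using common_prefix[OF TK T eq2[symmetric] _ c] c by simp
  qed
  then have "m = m'" and ch: "chain e xs" using len by auto
  have "length xs \<le> T" by (rule chain_bounds(1)[OF ch T])
  \<comment> \<open>\<open>2 * m + 1 \<le> T\<close> keeps \<open>m\<close> and \<open>2 * m\<close>
    below the cap \<open>K\<close>; this is the purpose of the summand \<open>2 * T\<close>.\<close>
  then show False using eq1 K w'(2) len(1) \<open>m = m'\<close> by simp
qed

theorem halting_separable: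
  assumes T: "\<forall>n t c. trace e n t c \<longrightarrow> n < T"
  shows "separation_problem (input e)"
proof -
  define K where "K = T * T + 2 * T + 2"
  define G where "G = (\<lambda>t. summary K (yield t)) ` language e 11"
  interpret depth_first "max_letter e" "summary K" G
    by unfold_locales (auto simp: finite_summary K_def intro: summary_congruence)
  have "language e 11 \<subseteq> dtwa_language (\<Sigma> e) search"
    unfolding language_search by (auto simp: G_def language_iff)
  moreover have "dtwa_language (\<Sigma> e) search \<inter> language e 16 = {}"
  proof -
    have False if s: "s \<in> language e 11" and t: "t \<in> language e 16"
      and eq: "summary K (yield t) = summary K (yield s)" for s t
    proof -
      obtain m where m: "lang1 e m m (yield s)" using language_11_sound[OF s] by blast
      obtain m' p where m': "0 < m'" "bounded e (fst p)" "lang2 e (2 * m') m' (word e [p]) (yield t)"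
        using language_16_sound[OF t] by blast
      show False using halting_disjoint[OF T _ m m'(3,1,2), of K] eq by (simp add: K_def)
    qed
    then show ?thesis unfolding language_search by (auto simp: G_def)
  qed
  ultimately show ?thesis using dtwa_search
    unfolding separation_problem_def input_def dtwa_separable_def by auto
qed

theorem theorem1: "\<not> decidable_problem encode_input separation_inputs separation_problem"
proof
  assume "decidable_problem encode_input separation_inputs separation_problem"
  then obtain f where f: "\<And>x. x \<in> separation_inputs \<Longrightarrow>
      evaluates f [encode_input x] (if separation_problem x then 1 else 0)"
    unfolding decidable_problem_def by blast
  obtain r where r: "\<And>xs. length xs = 1 \<Longrightarrow> evaluates r xs (encode_input (input (xs ! 0)))"
    using computable_input unfolding computable_def by blast
  have h: "evaluates (Comp f [r]) [e] (if separation_problem (input e) then 1 else 0)" for e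
    using f[OF input_in] r[of "[e]"] by (intro evaluates.comp[of _ _ "[encode_input (input e)]"]) simp_all
  obtain e where e: "evaluates (Comp f [r]) [e] 0 \<Longrightarrow> \<exists>T. \<forall>n t c. trace e n t c \<longrightarrow> n < T"
    "evaluates (Comp f [r]) [e] 1 \<Longrightarrow> \<exists>t c. (\<forall>n. trace e n t c) \<and>
      (\<forall>i. t i < width e \<and> pure e (t i) \<and> set_mset (c i) \<subseteq> {..<width e})"
    using ex_code[of "Comp f [r]"] by blast
  show False
  proof (cases "separation_problem (input e)")
    case True
    then have "evaluates (Comp f [r]) [e] 1" using h[of e] by simp
    then obtain t c where "\<forall>n. trace e n t c"
      "\<forall>i. t i < width e \<and> pure e (t i) \<and> set_mset (c i) \<subseteq> {..<width e}" using e(2) by blast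
    then have "\<not> separation_problem (input e)"
      using diverging_not_separable[of e t c] by blast
    then show False using True by blast
  next
    case False
    then have "evaluates (Comp f [r]) [e] 0" using h[of e] by simp
    then show False using e(1) halting_separable False by blast
  qed
qed

end
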